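(* Let $(\mathcal{A},\phi)$ be a $W^*$-probability space with a non-degenerated normal state such that $\mathcal{A}$ is generated by a bilateral sequence $(x_i)_{i\in\mathbb{Z}}$ of selfadjoint random variables, the unit of $\mathcal{A}$ being contained in the WOT-closure of the non-unital algebra generated by $(x_i)_{i\in\mathbb{Z}}$, and such that $(x_i)_{i\in\mathbb{Z}}$ is boolean spreadable. Then $E^-$ and $E^+$ can be extended (normally) to the whole algebra $\mathcal{A}$. Moreover, $E^-=E^+$ on $\mathcal{A}$.
   Context: **Non-degenerated normal state.** $\mathcal{A}$ is a von Neumann algebra and $\phi$ a normal state such that $x=0$ whenever $\phi(axb)=0$ for all $a,b\in\mathcal{A}$ ($\phi$ is not assumed faithful). The GNS representation of $\phi$ is then faithful; $\mathcal{A}$ is identified with its image, and WOT refers to it. **Boolean spreadability.** $\mathbb{C}\langle X_1,\dots,X_n\rangle$ is the algebra of noncommutative polynomials. The joint distribution of $x_1,\dots,x_n\in\mathcal{A}$ is $\mu_{x_1,\dots,x_n}(p)=\phi(p(x_1,\dots,x_n))$. For $k\le n$ in $\mathbb{N}$, $B_i(n,k)$ is the universal unital $C^*$-algebra generated by elements $u_{i,j}$ ($1\le i\le n$, $1\le j\le k$) and a projection $\mathbf{P}$ such that: (1) each $u_{i,j}$ is an orthogonal projection; (2) $\sum_{i=1}^nu_{i,j}\mathbf{P}=\mathbf{P}$ for $1\le j\le k$; (3) $u_{i,j}u_{i',j'}=0$ if $j<j'$ and $i\ge i'$. Let $\alpha^{(b)}_{n,k}:\mathbb{C}\langle X_1,\dots,X_k\rangle\to\mathbb{C}\langle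 X_1,\dots,X_n\rangle\otimes B_i(n,k)$ be the unital homomorphism with $X_j\mapsto\sum_{i=1}^nX_i\otimes u_{i,j}$. The sequence $(x_1,\dots,x_n)$ is boolean spreadable if for all $k=1,\dots,n-1$ and all $p\in\mathbb{C}\langle X_1,\dots,X_k\rangle$, $\mu_{x_1,\dots,x_n}(p)\mathbf{P}=\mathbf{P}\,\big[(\mu_{x_1,\dots,x_n}\otimes id)(\alpha^{(b)}_{n,k}(p))\big]\,\mathbf{P}$. A sequence indexed by an ordered infinite set is boolean spreadable if all its finite subsequences $(x_{i_1},\dots,x_{i_l})$, $i_1<\dots<i_l$, are. **Shift, $E^+$ and $E^-$.** Boolean spreadability implies that joint moments of $(x_{i_1},\dots,x_{i_l})$, $i_1<\dots<i_l$, depend only on $l$, and in this setting there is a normal $\phi$-preserving automorphism $\alpha$ of $\mathcal{A}$ with $\alpha(x_i)=x_{i+1}$ for all $i\in\mathbb{Z}$. Let $\mathcal{A}^+_k$ (resp. $\mathcal{A}^-_k$) be the WOT-closure of the non-unital algebra generated by $\{x_i:i\ge k\}$ (resp. $\{x_i:i\le k\}$), $\mathcal{A}^+_{tail}=\bigcap_{k>0}\mathcal{A}^+_k$ and $\mathcal{A}^-_{tail}=\bigcap_{k<0}\mathcal{A}^-_k$. The limits $E^+[a]=\text{WOT-}\lim_{l\to\infty}\alpha^l(a)\in\mathcal{A}^+_{tail}$ for $a\in\bigcup_k\mathcal{A}^+_k$ and $E^-[a]=\text{WOT-}\lim_{l\to\infty}\alpha^{-l}(a)\in\mathcal{A}^-_{tail}$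 for $a\in\bigcup_k\mathcal{A}^-_k$ exist; these define $E^+$ and $E^-$ on the respective domains. *)

theory Defs
  imports "HOL-Analysis.Analysis" "HOL-Library.Poly_Mapping"
begin

section \<open>Complex Hilbert spaces and bounded operators\<close>

text \<open>The inner product is linear in the first argument.\<close>

class complex_hilbert_space = banach +
  fixes scaleC :: "complex \<Rightarrow> 'a \<Rightarrow> 'a"
    and cinner :: "'a \<Rightarrow> 'a \<Rightarrow> complex"
  assumes scaleC_add_right: "scaleC c (v + w) = scaleC c v + scaleC c w"
    and scaleC_add_left: "scaleC (c + d) v = scaleC c v + scaleC d v"
    and scaleC_scaleC: "scaleC c (scaleC d v) = scaleC (c * d) v"
    and scaleR_eq_scaleC: "r *\<^sub>R v = scaleC (complex_of_real r) v"
    and cinner_commute: "cinner v w = cnj (cinner w v)"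
    and cinner_add_left: "cinner (u + v) w = cinner u w + cinner v w"
    and cinner_scaleC_left: "cinner (scaleC c v) w = c * cinner v w"
    and cinner_self: "cinner v v = complex_of_real ((norm v)\<^sup>2)"

lemma norm_scaleC:
  fixes v :: "'a::complex_hilbert_space"
  shows "norm (scaleC c v) = cmod c * norm v"
proof -
  have "cinner (scaleC c v) (scaleC c v) = c * cinner v (scaleC c v)"
    by (rule cinner_scaleC_left)
  also have "cinner v (scaleC c v) = cnj (c * cinner v v)"
    by (subst cinner_commute) (simp add: cinner_scaleC_left)
  also have "c * \<dots> = complex_of_real ((cmod c * norm v)\<^sup>2)"
    by (simp add: cinner_self complex_norm_square power_mult_distrib)
       (simp flip: complex_norm_square)
  finally have "(norm (scaleC c v))\<^sup>2 = (cmod c * norm v)\<^sup>2"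
    unfolding cinner_self of_real_eq_iff .
  then show ?thesis
    by (simp add: power2_eq_iff_nonneg)
qed

lemma bounded_linear_scaleC:
  "bounded_linear (scaleC c :: 'a::complex_hilbert_space \<Rightarrow> 'a)"
proof (rule bounded_linear_intro[where K = "cmod c"])
  fix r and v w :: 'a
  show "scaleC c (v + w) = scaleC c v + scaleC c w"
    by (rule scaleC_add_right)
  show "scaleC c (r *\<^sub>R v) = r *\<^sub>R scaleC c v"
    by (simp add: scaleR_eq_scaleC scaleC_scaleC mult.commute)
  show "norm (scaleC c v) \<le> norm v * cmod c"
    by (simp add: norm_scaleC)
qed

text \<open>The library type of bounded operators only knows real linearity; the elements of
  \<open>B(H)\<close> are those that are complex linear.\<close>

type_synonym 'h bop = "'h \<Rightarrow>\<^sub>L 'h"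

definition B_H :: "'h::complex_hilbert_space bop set" where
  "B_H = {T. \<forall>c v. blinfun_apply T (scaleC c v) = scaleC c (blinfun_apply T v)}"

lift_definition scaleC_op :: "complex \<Rightarrow> 'h::complex_hilbert_space bop \<Rightarrow> 'h bop"
  is "\<lambda>c T v. scaleC c (T v)"
  by (rule bounded_linear_compose[OF bounded_linear_scaleC])

definition is_adjoint :: "'h::complex_hilbert_space bop \<Rightarrow> 'h bop \<Rightarrow> bool" where
  "is_adjoint S T \<longleftrightarrow> (\<forall>v w. cinner (S v) w = cinner v (T w))"

definition selfadjoint :: "'h::complex_hilbert_space bop \<Rightarrow> bool" where
  "selfadjoint T \<longleftrightarrow> is_adjoint T T"

definition positive_op :: "'h::complex_hilbert_space bop \<Rightarrow> bool" where
  "positive_op T \<longleftrightarrow> (\<forall>v. cinner (T v) v \<in> \<real>\<^sub>\<ge>\<^sub>0)"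

text \<open>The weak operator topology on \<open>B(H)\<close>: the initial topology for the matrix
  coefficients.\<close>

definition wot :: "'h::complex_hilbert_space bop topology" where
  "wot = pullback_topology B_H (\<lambda>T (v, w). cinner (blinfun_apply T v) w)
           (product_topology (\<lambda>_. euclidean) UNIV)"


section \<open>Von Neumann algebras, normal maps and states\<close>

definition von_neumann_algebra :: "'h::complex_hilbert_space bop set \<Rightarrow> bool" where
  "von_neumann_algebra M \<longleftrightarrow>
     M \<subseteq> B_H \<and> id_blinfun \<in> M \<and>
     (\<forall>a\<in>M. \<forall>b\<in>M. a + b \<in> M) \<and> (\<forall>c. \<forall>a\<in>M. scaleC_op c a \<in> M) \<and>
     (\<forall>a\<in>M. \<forall>b\<in>M. a o\<^sub>L b \<in> M) \<and> (\<forall>a\<in>M. \<exists>b\<in>M. is_adjoint b a) \<and>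
     closedin wot M"

definition vN_generated :: "'h::complex_hilbert_space bop set \<Rightarrow> 'h bop set" where
  "vN_generated S = \<Inter>{N. von_neumann_algebra N \<and> S \<subseteq> N}"

inductive_set nonunital_alg :: "'h::complex_hilbert_space bop set \<Rightarrow> 'h bop set"
  for S where
    gen: "a \<in> S \<Longrightarrow> a \<in> nonunital_alg S"
  | add: "a \<in> nonunital_alg S \<Longrightarrow> b \<in> nonunital_alg S \<Longrightarrow> a + b \<in> nonunital_alg S"
  | scale: "a \<in> nonunital_alg S \<Longrightarrow> scaleC_op c a \<in> nonunital_alg S"
  | mult: "a \<in> nonunital_alg S \<Longrightarrow> b \<in> nonunital_alg S \<Longrightarrow> a o\<^sub>L b \<in> nonunital_alg S"

text \<open>Least upper bounds in the ordered space of selfadjoint elements of \<open>M\<close>. Increasing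
  nets are rendered as upward directed sets.\<close>

definition is_lub_in :: "'h::complex_hilbert_space bop set \<Rightarrow> 'h bop set \<Rightarrow> 'h bop \<Rightarrow> bool" where
  "is_lub_in M D s \<longleftrightarrow>
     s \<in> M \<and> selfadjoint s \<and> (\<forall>d\<in>D. positive_op (s - d)) \<and>
     (\<forall>t\<in>M. selfadjoint t \<and> (\<forall>d\<in>D. positive_op (t - d)) \<longrightarrow> positive_op (t - s))"

definition directed_in :: "'h::complex_hilbert_space bop set \<Rightarrow> 'h bop set \<Rightarrow> bool" where
  "directed_in M D \<longleftrightarrow>
     D \<noteq> {} \<and> D \<subseteq> M \<and> (\<forall>d\<in>D. selfadjoint d) \<and>
     (\<forall>d\<in>D. \<forall>e\<in>D. \<exists>f\<in>D. positive_op (f - d) \<and> positive_op (f - e))"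

definition normal_map ::
    "'h::complex_hilbert_space bop set \<Rightarrow> ('h bop \<Rightarrow> 'h bop) \<Rightarrow> bool" where
  "normal_map M E \<longleftrightarrow>
     E ` M \<subseteq> M \<and>
     (\<forall>a\<in>M. \<forall>b\<in>M. E (a + b) = E a + E b) \<and>
     (\<forall>c. \<forall>a\<in>M. E (scaleC_op c a) = scaleC_op c (E a)) \<and>
     (\<forall>a\<in>M. positive_op a \<longrightarrow> positive_op (E a)) \<and>
     (\<forall>D s. directed_in M D \<and> is_lub_in M D s \<longrightarrow> is_lub_in M (E ` D) (E s))"

definition normal_state ::
    "'h::complex_hilbert_space bop set \<Rightarrow> ('h bop \<Rightarrow> complex) \<Rightarrow> bool" where
  "normal_state M \<phi> \<longleftrightarrow>
     (\<forall>a\<in>M. \<forall>b\<in>M. \<phi> (a + b) = \<phi> a + \<phi> b) \<and>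
     (\<forall>c. \<forall>a\<in>M. \<phi> (scaleC_op c a) = c * \<phi> a) \<and>
     (\<forall>a\<in>M. positive_op a \<longrightarrow> \<phi> a \<in> \<real>\<^sub>\<ge>\<^sub>0) \<and>
     \<phi> id_blinfun = 1 \<and>
     (\<forall>D s. directed_in M D \<and> is_lub_in M D s \<longrightarrow> Re (\<phi> s) = (SUP d\<in>D. Re (\<phi> d)))"

definition nondegenerated ::
    "'h::complex_hilbert_space bop set \<Rightarrow> ('h bop \<Rightarrow> complex) \<Rightarrow> bool" where
  "nondegenerated M \<phi> \<longleftrightarrow>
     (\<forall>y\<in>M. (\<forall>a\<in>M. \<forall>b\<in>M. \<phi> (a o\<^sub>L y o\<^sub>L b) = 0) \<longrightarrow> y = 0)"

text \<open>\<open>M\<close> is identified with its image in the GNS representation of \<open>\<phi>\<close>: the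
  Hilbert space on which \<open>M\<close> acts is the GNS space, with cyclic vector \<open>\<xi>\<close>.
  Consequently \<^const>\<open>wot\<close> is the weak operator topology of the GNS representation.\<close>

definition gns_identified ::
    "'h::complex_hilbert_space bop set \<Rightarrow> ('h bop \<Rightarrow> complex) \<Rightarrow> 'h \<Rightarrow> bool" where
  "gns_identified M \<phi> \<xi> \<longleftrightarrow>
     (\<forall>a\<in>M. \<phi> a = cinner (blinfun_apply a \<xi>) \<xi>) \<and>
     closure ((\<lambda>a. blinfun_apply a \<xi>) ` M) = UNIV"


section \<open>Noncommutative polynomials\<close>

text \<open>Words form the free monoid, written additively because \<^typ>\<open>'a \<Rightarrow>\<^sub>0 'b\<close> is the
  monoid algebra of an additive monoid. Finitely supported functions on words are thus the
  polynomials in noncommuting variables, which commute with the coefficients.\<close>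

datatype 'g ncword = Word (letters: "'g list")

instantiation ncword :: (type) monoid_add
begin

definition zero_ncword :: "'a ncword" where
  "0 = Word []"

definition plus_ncword :: "'a ncword \<Rightarrow> 'a ncword \<Rightarrow> 'a ncword" where
  "v + w = Word (letters v @ letters w)"

instance
  by standard (simp_all add: zero_ncword_def plus_ncword_def)

end

type_synonym ('g, 'r) ncpoly = "'g ncword \<Rightarrow>\<^sub>0 'r"

definition nc_var :: "'g \<Rightarrow> ('g, 'r::zero_neq_one) ncpoly" where
  "nc_var g = Poly_Mapping.single (Word [g]) 1"

definition nc_const :: "'r::zero \<Rightarrow> ('g, 'r) ncpoly" where
  "nc_const c = Poly_Mapping.single 0 c"

definition nc_vars_in :: "'g set \<Rightarrow> ('g, 'r::zero) ncpoly set" where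
  "nc_vars_in G = {p. \<forall>w \<in> Poly_Mapping.keys p. set (letters w) \<subseteq> G}"

definition eval_op :: "('g \<Rightarrow> 'h::complex_hilbert_space bop) \<Rightarrow> ('g, complex) ncpoly \<Rightarrow> 'h bop" where
  "eval_op y p = (\<Sum>w \<in> Poly_Mapping.keys p. scaleC_op (Poly_Mapping.lookup p w)
                    (foldr (\<lambda>g T. y g o\<^sub>L T) (letters w) id_blinfun))"

definition joint_distribution ::
    "('h::complex_hilbert_space bop \<Rightarrow> complex) \<Rightarrow> (nat \<Rightarrow> 'h bop) \<Rightarrow> (nat, complex) ncpoly \<Rightarrow> complex" where
  "joint_distribution \<phi> y p = \<phi> (eval_op y p)"


section \<open>The universal C*-algebras \<open>B\<^sub>i(n,k)\<close>\<close>

datatype bgen = GenU nat nat | GenP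

text \<open>The free unital *-algebra on selfadjoint generators: the involution reverses words and
  conjugates coefficients.\<close>

type_synonym bfree = "(bgen, complex) ncpoly"

definition bstar :: "bfree \<Rightarrow> bfree" where
  "bstar a = (\<Sum>w \<in> Poly_Mapping.keys a.
     Poly_Mapping.single (Word (rev (letters w))) (cnj (Poly_Mapping.lookup a w)))"

abbreviation gu :: "nat \<Rightarrow> nat \<Rightarrow> bfree" where
  "gu i j \<equiv> nc_var (GenU i j)"

abbreviation gP :: bfree where
  "gP \<equiv> nc_var GenP"

text \<open>Elements to be annihilated. The first set removes the formal generators whose
  index is out of range.\<close>

definition Bi_relations :: "nat \<Rightarrow> nat \<Rightarrow> bfree set" where
  "Bi_relations n k =
     {gu i j | i j. \<not> (i \<in> {1..n} \<and> j \<in> {1..k})} \<union>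
     {gP * gP - gP} \<union>
     {gu i j * gu i j - gu i j | i j. i \<in> {1..n} \<and> j \<in> {1..k}} \<union>
     {(\<Sum>i=1..n. gu i j * gP) - gP | j. j \<in> {1..k}} \<union>
     {gu i j * gu i' j' | i j i' j'. i \<in> {1..n} \<and> i' \<in> {1..n} \<and> j \<in> {1..k} \<and> j' \<in> {1..k} \<and>
        j < j' \<and> i \<ge> i'}"

definition cstar_seminorm :: "(bfree \<Rightarrow> real) \<Rightarrow> bool" where
  "cstar_seminorm \<nu> \<longleftrightarrow>
     (\<forall>a b. \<nu> (a + b) \<le> \<nu> a + \<nu> b) \<and> (\<forall>c a. \<nu> (nc_const c * a) = cmod c * \<nu> a) \<and>
     (\<forall>a b. \<nu> (a * b) \<le> \<nu> a * \<nu> b) \<and> (\<forall>a. \<nu> (bstar a * a) = (\<nu> a)\<^sup>2)"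

text \<open>\<open>B\<^sub>i(n,k)\<close> is the separated completion of the free *-algebra with respect to the
  largest C*-seminorm annihilating the relations. (The supremum is finite, because such a
  seminorm is at most 1 on every generator.) Only the dense image of the free *-algebra is
  needed: two of its elements have the same image in \<open>B\<^sub>i(n,k)\<close> iff the universal seminorm
  of their difference is 0.\<close>

definition Bi_norm :: "nat \<Rightarrow> nat \<Rightarrow> bfree \<Rightarrow> real" where
  "Bi_norm n k a = (SUP \<nu> \<in> {\<nu>. cstar_seminorm \<nu> \<and> (\<forall>r \<in> Bi_relations n k. \<nu> r = 0)}. \<nu> a)"

definition Bi_eq :: "nat \<Rightarrow> nat \<Rightarrow> bfree \<Rightarrow> bfree \<Rightarrow> bool" where
  "Bi_eq n k a b \<longleftrightarrow> Bi_norm n k (a - b) = 0"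


section \<open>Boolean spreadability\<close>

text \<open>\<open>\<complex>\<langle>X\<^sub>1,\<dots>,X\<^sub>n\<rangle> \<otimes> B\<close> is the algebra of noncommutative polynomials with coefficients
  in \<open>B\<close>; the pure tensor \<open>X\<^sub>i \<otimes> b\<close> is \<^term>\<open>nc_const b * nc_var i\<close>.\<close>

definition spread_hom :: "nat \<Rightarrow> (nat, complex) ncpoly \<Rightarrow> (nat, bfree) ncpoly" where
  "spread_hom n p = (\<Sum>w \<in> Poly_Mapping.keys p.
     nc_const (nc_const (Poly_Mapping.lookup p w)) *
     prod_list (map (\<lambda>j. \<Sum>i=1..n. nc_const (gu i j) * nc_var i) (letters w)))"

definition tensor_id :: "((nat, complex) ncpoly \<Rightarrow> complex) \<Rightarrow> (nat, bfree) ncpoly \<Rightarrow> bfree" where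
  "tensor_id \<mu> t = (\<Sum>w \<in> Poly_Mapping.keys t.
     nc_const (\<mu> (Poly_Mapping.single w 1)) * Poly_Mapping.lookup t w)"

definition boolean_spreadable_fin ::
    "('h::complex_hilbert_space bop \<Rightarrow> complex) \<Rightarrow> nat \<Rightarrow> (nat \<Rightarrow> 'h bop) \<Rightarrow> bool" where
  "boolean_spreadable_fin \<phi> n y \<longleftrightarrow>
     (\<forall>k \<in> {1..<n}. \<forall>p \<in> nc_vars_in {1..k}.
        Bi_eq n k (nc_const (joint_distribution \<phi> y p) * gP)
                  (gP * tensor_id (joint_distribution \<phi> y) (spread_hom n p) * gP))"

definition boolean_spreadable ::
    "('h::complex_hilbert_space bop \<Rightarrow> complex) \<Rightarrow> (int \<Rightarrow> 'h bop) \<Rightarrow> bool" where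
  "boolean_spreadable \<phi> x \<longleftrightarrow>
     (\<forall>l (s :: nat \<Rightarrow> int). strict_mono_on {1..l} s \<longrightarrow> boolean_spreadable_fin \<phi> l (x \<circ> s))"


section \<open>The shift and the maps \<open>E\<^sup>+\<close>, \<open>E\<^sup>-\<close>\<close>

definition is_shift ::
    "'h::complex_hilbert_space bop set \<Rightarrow> ('h bop \<Rightarrow> complex) \<Rightarrow> (int \<Rightarrow> 'h bop) \<Rightarrow>
     ('h bop \<Rightarrow> 'h bop) \<Rightarrow> bool" where
  "is_shift M \<phi> x \<alpha> \<longleftrightarrow>
     bij_betw \<alpha> M M \<and> normal_map M \<alpha> \<and>
     (\<forall>a\<in>M. \<forall>b\<in>M. \<alpha> (a o\<^sub>L b) = \<alpha> a o\<^sub>L \<alpha> b) \<and>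
     (\<forall>a\<in>M. \<forall>b\<in>M. is_adjoint b a \<longrightarrow> is_adjoint (\<alpha> b) (\<alpha> a)) \<and>
     (\<forall>a\<in>M. \<phi> (\<alpha> a) = \<phi> a) \<and> (\<forall>i. \<alpha> (x i) = x (i + 1))"

text \<open>Being normal, the automorphism is determined on \<open>M\<close> by its values on the generators; the
  choice only affects its values outside \<open>M\<close>.\<close>

definition shift_aut ::
    "'h::complex_hilbert_space bop set \<Rightarrow> ('h bop \<Rightarrow> complex) \<Rightarrow> (int \<Rightarrow> 'h bop) \<Rightarrow> 'h bop \<Rightarrow> 'h bop" where
  "shift_aut M \<phi> x = (SOME \<alpha>. is_shift M \<phi> x \<alpha>)"

definition A_plus :: "(int \<Rightarrow> 'h::complex_hilbert_space bop) \<Rightarrow> int \<Rightarrow> 'h bop set" where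
  "A_plus x k = wot closure_of nonunital_alg (x ` {k..})"

definition A_minus :: "(int \<Rightarrow> 'h::complex_hilbert_space bop) \<Rightarrow> int \<Rightarrow> 'h bop set" where
  "A_minus x k = wot closure_of nonunital_alg (x ` {..k})"

definition A_plus_tail :: "(int \<Rightarrow> 'h::complex_hilbert_space bop) \<Rightarrow> 'h bop set" where
  "A_plus_tail x = (\<Inter>k\<in>{0<..}. A_plus x k)"

definition A_minus_tail :: "(int \<Rightarrow> 'h::complex_hilbert_space bop) \<Rightarrow> 'h bop set" where
  "A_minus_tail x = (\<Inter>k\<in>{..<0}. A_minus x k)"

definition E_plus ::
    "'h::complex_hilbert_space bop set \<Rightarrow> ('h bop \<Rightarrow> complex) \<Rightarrow> (int \<Rightarrow> 'h bop) \<Rightarrow> 'h bop \<Rightarrow> 'h bop" where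
  "E_plus M \<phi> x a = (THE b. b \<in> A_plus_tail x \<and>
     limitin wot (\<lambda>l. (shift_aut M \<phi> x ^^ l) a) b sequentially)"

definition E_minus ::
    "'h::complex_hilbert_space bop set \<Rightarrow> ('h bop \<Rightarrow> complex) \<Rightarrow> (int \<Rightarrow> 'h bop) \<Rightarrow> 'h bop \<Rightarrow> 'h bop" where
  "E_minus M \<phi> x a = (THE b. b \<in> A_minus_tail x \<and>
     limitin wot (\<lambda>l. (inv_into M (shift_aut M \<phi> x) ^^ l) a) b sequentially)"

end

theory Submission
  imports Defs
begin

text \<open>
  Spreadability makes the shift of the variables unitary on the GNS space. Let \<open>W\<^sub>l\<close> be its powers. Matrix
  coefficients of \<open>W\<^sub>l\<close> between word vectors are eventually constant, so \<open>W\<^sub>l\<close>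
  has a weak limit as \<open>l \<rightarrow> \<infinity>\<close>; this limit \<open>Q\<close> is selfadjoint (it projects onto the
  fixed vectors), hence it is the weak limit for \<open>l \<rightarrow> -\<infinity>\<close> as well. A representation of
  \<open>B\<^sub>i(n,k)\<close> by two by two matrices shows that, when the indices of \<open>b\<close> all lie on one side
  of those of \<open>v\<close> and \<open>w\<close>, the moment of \<open>v b w\<close> is the mean of the two moments obtained
  by moving \<open>v\<close> alone or \<open>w\<close> alone away from \<open>b\<close>. In the limit this says that
  \<open>\<langle>b w, v\<rangle> = \<langle>b Q w, Q v\<rangle>\<close>, so both \<open>E\<^sup>+\<close> and \<open>E\<^sup>-\<close> are the
  compression \<open>a \<mapsto> Q a Q\<close>, which is normal on the whole algebra.
\<close>


subsection \<open>Noncommutative polynomials\<close>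

text \<open>The relations of \<open>B_i(n,k)\<close> leave the projection P free not to commute with
  the u's, and the matrix representation uses exactly this freedom. There P is the rank one
  projection onto the constants, the u's belonging to v and w are built from coordinate projections,
  and every letter of the separating word b puts a P between the two blocks. The blocks then choose
  their copies independently, each choice having weight 1/2. Two of the four equally weighted
  outcomes are the original moment, which leaves the mean of the two mixed ones.

  The separating word must be nonempty, since otherwise no P gets between the blocks; for b = 1 the
  compression formula would say that Q is the identity. Hence the work is done in nonunital
  algebras, and the hypothesis on the unit leads back to M: nonempty words yield a dense set of
  vectors, and their linear span is weakly dense in M. A single word has finitely many indices, so
  it lies in the domains of both limits; this is why the compression maps M into itself. The common
  extension sends 1 to Q, so it need not be unital.\<close>

lemma ncpoly_induct [case_names single add]:
  fixes p :: "('g, 'r::ab_group_add) ncpoly"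
  assumes "\<And>w c. P (Poly_Mapping.single w c)"
    and "\<And>p q. P p \<Longrightarrow> P q \<Longrightarrow> P (p + q)"
  shows "P p"
proof (induction p rule: update_induct)
  case const
  show ?case using assms(1)[of undefined 0] by simp
next
  case (update p w c)
  have "Poly_Mapping.update w c p = Poly_Mapping.single w c + p"
  proof (rule poly_mapping_eqI)
    fix v
    show "Poly_Mapping.lookup (Poly_Mapping.update w c p) v
        = Poly_Mapping.lookup (Poly_Mapping.single w c + p) v"
      using update(1) by (auto simp: lookup_update lookup_add lookup_single not_in_keys_iff_lookup_eq_zero)
  qed
  then show ?case using assms update by metis
qed

subsection \<open>Two by two matrices\<close>

text \<open>A type of its own turns matrix multiplication into the multiplication of a ring, so that
  \<open>sum\<close>, \<open>prod_list\<close> and the distributive laws apply to matrix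
  values.\<close>

datatype mat2 = Mat2 complex complex complex complex

instantiation mat2 :: ring_1
begin

definition "0 = Mat2 0 0 0 0"
definition "1 = Mat2 1 0 0 1"
fun plus_mat2 where "Mat2 a b c d + Mat2 a' b' c' d' = Mat2 (a + a') (b + b') (c + c') (d + d')"
fun uminus_mat2 where "- Mat2 a b c d = Mat2 (- a) (- b) (- c) (- d)"
definition "A - B = A + - (B::mat2)"
fun times_mat2 where
  "Mat2 a b c d * Mat2 a' b' c' d' =
     Mat2 (a * a' + b * c') (a * b' + b * d') (c * a' + d * c') (c * b' + d * d')"

instance
proof
  fix A B C :: mat2
  show "A * B * C = A * (B * C)" by (cases A; cases B; cases C) (simp add: algebra_simps)
  show "A + B + C = A + (B + C)" by (cases A; cases B; cases C) simp
  show "A + B = B + A" by (cases A; cases B) simp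
  show "(A + B) * C = A * C + B * C" by (cases A; cases B; cases C) (simp add: algebra_simps)
  show "A * (B + C) = A * B + A * C" by (cases A; cases B; cases C) (simp add: algebra_simps)
  show "0 + A = A" by (cases A) (simp add: zero_mat2_def)
  show "- A + A = 0" by (cases A) (simp add: zero_mat2_def)
  show "A - B = A + - B" by (rule minus_mat2_def)
  show "1 * A = A" by (cases A) (simp add: one_mat2_def)
  show "A * 1 = A" by (cases A) (simp add: one_mat2_def)
  show "(0::mat2) \<noteq> 1" by (simp add: zero_mat2_def one_mat2_def)
qed

end

definition scalar_mat2 :: "complex \<Rightarrow> mat2" where
  "scalar_mat2 c = Mat2 c 0 0 c"

fun adj_mat2 :: "mat2 \<Rightarrow> mat2" where
  "adj_mat2 (Mat2 a b c d) = Mat2 (cnj a) (cnj c) (cnj b) (cnj d)"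

fun mat2_apply :: "mat2 \<Rightarrow> complex \<times> complex \<Rightarrow> complex \<times> complex" where
  "mat2_apply (Mat2 a b c d) (z, w) = (a * z + b * w, c * z + d * w)"

lemma scalar_mat2_add: "scalar_mat2 (c + d) = scalar_mat2 c + scalar_mat2 d"
  and scalar_mat2_mult: "scalar_mat2 (c * d) = scalar_mat2 c * scalar_mat2 d"
  and scalar_mat2_0 [simp]: "scalar_mat2 0 = 0"
  and scalar_mat2_1 [simp]: "scalar_mat2 1 = 1"
  by (simp_all add: scalar_mat2_def zero_mat2_def one_mat2_def)

lemma scalar_mat2_commute: "A * scalar_mat2 c = scalar_mat2 c * A"
  by (cases A) (simp add: scalar_mat2_def mult.commute)

lemma adj_mat2_add: "adj_mat2 (A + B) = adj_mat2 A + adj_mat2 B"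
  by (cases A; cases B) simp

lemma adj_mat2_mult: "adj_mat2 (A * B) = adj_mat2 B * adj_mat2 A"
  by (cases A; cases B) (simp add: mult.commute)

lemma adj_mat2_adj [simp]: "adj_mat2 (adj_mat2 A) = A"
  by (cases A) simp

lemma adj_mat2_0 [simp]: "adj_mat2 0 = 0" and adj_mat2_1 [simp]: "adj_mat2 1 = 1"
  and adj_mat2_scalar: "adj_mat2 (scalar_mat2 c) = scalar_mat2 (cnj c)"
  by (simp_all add: zero_mat2_def one_mat2_def scalar_mat2_def)

lemma mat2_apply_mult: "mat2_apply (A * B) v = mat2_apply A (mat2_apply B v)"
  by (cases A; cases B; cases v) (simp add: algebra_simps)

lemma mat2_apply_add_mat: "mat2_apply (A + B) v = mat2_apply A v + mat2_apply B v"
  by (cases A; cases B; cases v) (simp add: algebra_simps)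

lemma bounded_linear_mat2_apply: "bounded_linear (mat2_apply A)"
proof -
  obtain a b c d where A: "A = Mat2 a b c d" by (cases A)
  have "mat2_apply A = (\<lambda>v. (a * fst v + b * snd v, c * fst v + d * snd v))"
    by (auto simp: A)
  moreover have "bounded_linear (\<lambda>v::complex \<times> complex. (a * fst v + b * snd v, c * fst v + d * snd v))"
    by (intro bounded_linear_Pair bounded_linear_add bounded_linear_mult_right[THEN bounded_linear_compose]
        bounded_linear_fst bounded_linear_snd)
  ultimately show ?thesis by simp
qed

lemma inner_mat2_apply: "inner (mat2_apply A v) w = inner v (mat2_apply (adj_mat2 A) w)"
  by (cases A; cases v; cases w) (simp add: inner_complex_def algebra_simps)

text \<open>Pairs of complex numbers carry the Euclidean norm, so this operator norm satisfies the
  C*-identity; an entrywise maximum would not.\<close>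

definition norm_mat2 :: "mat2 \<Rightarrow> real" where
  "norm_mat2 A = onorm (mat2_apply A)"

lemma norm_mat2_apply: "norm (mat2_apply A v) \<le> norm_mat2 A * norm v"
  unfolding norm_mat2_def by (rule onorm[OF bounded_linear_mat2_apply])

lemma norm_mat2_nonneg: "0 \<le> norm_mat2 A"
  unfolding norm_mat2_def by (rule onorm_pos_le[OF bounded_linear_mat2_apply])

lemma norm_mat2_le:
  assumes "0 \<le> b" "\<And>v. norm (mat2_apply A v) \<le> b * norm v"
  shows "norm_mat2 A \<le> b"
  unfolding norm_mat2_def using assms by (rule onorm_bound)

lemma norm_mat2_eq_0: "norm_mat2 A = 0 \<Longrightarrow> A = 0"
  unfolding norm_mat2_def onorm_eq_0[OF bounded_linear_mat2_apply]
proof -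
  assume *: "\<forall>v. mat2_apply A v = 0"
  show "A = 0"
    using *[rule_format, of "(1,0)"] *[rule_format, of "(0,1)"]
    by (cases A) (simp add: zero_mat2_def zero_prod_def)
qed

lemma norm_mat2_0 [simp]: "norm_mat2 0 = 0"
proof -
  have "mat2_apply 0 = (\<lambda>v. 0)" by (auto simp: zero_mat2_def zero_prod_def)
  then show ?thesis by (simp add: norm_mat2_def onorm_zero)
qed

lemma norm_mat2_add: "norm_mat2 (A + B) \<le> norm_mat2 A + norm_mat2 B"
proof (rule norm_mat2_le)
  fix v
  show "norm (mat2_apply (A + B) v) \<le> (norm_mat2 A + norm_mat2 B) * norm v"
    unfolding mat2_apply_add_mat distrib_right
    by (rule norm_triangle_le[OF add_mono[OF norm_mat2_apply norm_mat2_apply]])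
qed (simp add: norm_mat2_nonneg)

lemma norm_mat2_mult: "norm_mat2 (A * B) \<le> norm_mat2 A * norm_mat2 B"
proof (rule norm_mat2_le)
  fix v
  show "norm (mat2_apply (A * B) v) \<le> norm_mat2 A * norm_mat2 B * norm v"
    unfolding mat2_apply_mult mult.assoc
    by (rule order_trans[OF norm_mat2_apply mult_left_mono[OF norm_mat2_apply norm_mat2_nonneg]])
qed (simp add: norm_mat2_nonneg)

text \<open>One inequality is enough: the reverse one is the same inequality for the inverse
  scalar.\<close>

lemma norm_mat2_scalar: "norm_mat2 (scalar_mat2 c * A) = cmod c * norm_mat2 A"
proof -
  have le: "norm_mat2 (scalar_mat2 c * A) \<le> cmod c * norm_mat2 A" for c A
  proof (rule norm_mat2_le)
    fix v
    have "norm (mat2_apply (scalar_mat2 c) u) = cmod c * norm u" for u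
    proof -
      obtain y z where u: "u = (y, z)" by (cases u)
      have "norm (mat2_apply (scalar_mat2 c) u) = sqrt ((cmod c)\<^sup>2 * ((cmod y)\<^sup>2 + (cmod z)\<^sup>2))"
        by (simp add: u scalar_mat2_def norm_Pair norm_mult power_mult_distrib distrib_left)
      then show ?thesis by (simp add: u norm_Pair real_sqrt_mult)
    qed
    then show "norm (mat2_apply (scalar_mat2 c * A) v) \<le> cmod c * norm_mat2 A * norm v"
      by (simp add: mat2_apply_mult mult_left_mono norm_mat2_apply mult.assoc)
  qed (simp add: norm_mat2_nonneg)
  show ?thesis
  proof (cases "c = 0")
    case False
    have "A = scalar_mat2 (inverse c) * (scalar_mat2 c * A)"
      using False by (simp flip: mult.assoc scalar_mat2_mult)
    then have "norm_mat2 A \<le> cmod (inverse c) * norm_mat2 (scalar_mat2 c * A)"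
      by (metis le)
    then have "cmod c * norm_mat2 A \<le> norm_mat2 (scalar_mat2 c * A)"
      using False by (simp add: norm_inverse field_split_simps norm_divide)
    with le show ?thesis by (simp add: antisym)
  qed simp
qed

text \<open>Cauchy-Schwarz bounds the square of the norm of A by the norm of A*A. Together with
  submultiplicativity this shows that A and its adjoint have the same norm, and the other inequality
  follows.\<close>

lemma norm_mat2_adj_mult: "norm_mat2 (adj_mat2 A * A) = (norm_mat2 A)\<^sup>2"
proof -
  have sq: "(norm_mat2 A)\<^sup>2 \<le> norm_mat2 (adj_mat2 A * A)" for A
  proof -
    have "norm_mat2 A \<le> sqrt (norm_mat2 (adj_mat2 A * A))"
    proof (rule norm_mat2_le)
      fix v
      have "(norm (mat2_apply A v))\<^sup>2 = inner v (mat2_apply (adj_mat2 A * A) v)"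
        by (simp add: mat2_apply_mult inner_mat2_apply power2_norm_eq_inner)
      also have "\<dots> \<le> norm v * norm (mat2_apply (adj_mat2 A * A) v)"
        by (rule norm_cauchy_schwarz)
      also have "\<dots> \<le> norm v * (norm_mat2 (adj_mat2 A * A) * norm v)"
        by (intro mult_left_mono norm_mat2_apply) simp
      finally have "norm (mat2_apply A v) \<le> sqrt (norm_mat2 (adj_mat2 A * A) * (norm v)\<^sup>2)"
        by (intro real_le_rsqrt) (simp add: power2_eq_square algebra_simps)
      then show "norm (mat2_apply A v) \<le> sqrt (norm_mat2 (adj_mat2 A * A)) * norm v"
        by (simp add: real_sqrt_mult)
    qed (simp add: norm_mat2_nonneg)
    then show ?thesis
      by (metis norm_mat2_nonneg power_mono real_sqrt_pow2)
  qed
  have adj: "norm_mat2 A \<le> norm_mat2 (adj_mat2 A)" for A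
  proof (cases "norm_mat2 A = 0")
    case False
    have "norm_mat2 A * norm_mat2 A \<le> norm_mat2 (adj_mat2 A) * norm_mat2 A"
      using order_trans[OF sq norm_mat2_mult] by (simp add: power2_eq_square)
    then show ?thesis using False norm_mat2_nonneg[of A] by simp
  qed (simp add: norm_mat2_nonneg)
  have "norm_mat2 (adj_mat2 A) = norm_mat2 A"
    using adj[of A] adj[of "adj_mat2 A"] by simp
  then show ?thesis
    using sq[of A] norm_mat2_mult[of "adj_mat2 A" A] by (simp add: power2_eq_square)
qed

subsection \<open>Matrix representations of \<open>B\<^sub>i(n,k)\<close>\<close>

definition rep :: "(bgen \<Rightarrow> mat2) \<Rightarrow> bfree \<Rightarrow> mat2" where
  "rep g a = (\<Sum>w\<in>Poly_Mapping.keys a.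
     scalar_mat2 (Poly_Mapping.lookup a w) * prod_list (map g (letters w)))"

lemma rep_add: "rep g (a + b) = rep g a + rep g b"
  unfolding rep_def by (rule setsum_keys_plus_distrib) (simp_all add: scalar_mat2_add distrib_right)

lemma rep_single: "rep g (Poly_Mapping.single w c) = scalar_mat2 c * prod_list (map g (letters w))"
  by (simp add: rep_def)

lemma rep_0 [simp]: "rep g 0 = 0"
  by (simp add: rep_def)

lemma rep_diff: "rep g (a - b) = rep g a - rep g b"
  using rep_add[of g "a - b" b] by (simp add: algebra_simps)

lemma rep_sum: "rep g (sum f A) = (\<Sum>i\<in>A. rep g (f i))"
  by (induction A rule: infinite_finite_induct) (simp_all add: rep_add)

lemma rep_const: "rep g (nc_const c) = scalar_mat2 c"
  by (simp add: nc_const_def rep_single zero_ncword_def)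

lemma rep_var: "rep g (nc_var v) = g v"
  by (simp add: nc_var_def rep_single)

lemma rep_mult: "rep g (a * b) = rep g a * rep g b"
proof (induction a rule: ncpoly_induct)
  case (single w c)
  show ?case
  proof (induction b rule: ncpoly_induct)
    case (single v d)
    show ?case
      by (simp add: mult_single rep_single plus_ncword_def scalar_mat2_mult mult.assoc)
        (metis mult.assoc scalar_mat2_commute)
  qed (simp add: rep_add distrib_left)
qed (simp add: rep_add distrib_right)

lemma rep_bstar:
  assumes "\<And>v. adj_mat2 (g v) = g v"
  shows "rep g (bstar a) = adj_mat2 (rep g a)"
proof -
  have add: "bstar (a + b) = bstar a + bstar b" for a b
    unfolding bstar_def by (rule setsum_keys_plus_distrib) (simp_all add: single_add)
  have rev: "prod_list (map g (rev vs)) = adj_mat2 (prod_list (map g vs))" for vs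
    by (induction vs) (simp_all add: adj_mat2_mult assms)
  show ?thesis
  proof (induction a rule: ncpoly_induct)
    case (single w c)
    show ?case
      by (simp add: bstar_def rep_single rev adj_mat2_mult adj_mat2_scalar)
        (metis scalar_mat2_commute)
  qed (simp add: add rep_add adj_mat2_add)
qed

text \<open>Selfadjoint values on the generators make \<open>rep g\<close> a *-homomorphism, and an
  operator norm pulled back along it competes in the supremum that defines
  \<open>Bi_norm\<close>.\<close>

lemma cstar_seminorm_rep:
  assumes "\<And>v. adj_mat2 (g v) = g v"
  shows "cstar_seminorm (\<lambda>a. norm_mat2 (rep g a))"
  unfolding cstar_seminorm_def
  by (simp add: rep_add rep_mult rep_const rep_bstar assms norm_mat2_add norm_mat2_scalar
      norm_mat2_mult norm_mat2_adj_mult)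

section \<open>C*-seminorms on the free *-algebra\<close>

context
  fixes \<nu> assumes \<nu>: "cstar_seminorm \<nu>"
begin

lemma cstar_seminorm_0: "\<nu> 0 = 0"
  using \<nu>[unfolded cstar_seminorm_def, THEN conjunct2, THEN conjunct1, rule_format, of 0 0] by simp

lemma cstar_seminorm_minus: "\<nu> (- a) = \<nu> a"
proof -
  have "nc_const (-1) * a = - a"
    by (simp add: nc_const_def single_uminus)
  then show ?thesis
    using \<nu>[unfolded cstar_seminorm_def, THEN conjunct2, THEN conjunct1, rule_format, of "-1" a] by simp
qed

lemma cstar_seminorm_nonneg: "0 \<le> \<nu> a"
  using \<nu>[unfolded cstar_seminorm_def, THEN conjunct1, rule_format, of a "- a"]
  by (simp add: cstar_seminorm_0 cstar_seminorm_minus)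

lemma cstar_seminorm_eq:
  assumes "\<nu> (a - b) = 0" shows "\<nu> a = \<nu> b"
proof -
  have tri: "\<nu> (c + d) \<le> \<nu> c + \<nu> d" for c d
    using \<nu> by (simp add: cstar_seminorm_def)
  show ?thesis
    using tri[of "a - b" b] tri[of "- (a - b)" a] assms cstar_seminorm_minus[of "a - b"] by simp
qed

text \<open>The C*-identity turns \<open>a * a = a\<close> modulo the kernel into the equation
  \<open>(\<nu> a)\<^sup>2 = \<nu> a\<close> between real numbers.\<close>

lemma cstar_seminorm_selfadjoint_idempotent_le_1:
  assumes "bstar a = a" "\<nu> (a * a - a) = 0"
  shows "\<nu> a \<le> 1"
proof -
  have "(\<nu> a)\<^sup>2 = \<nu> a"
    using \<nu> cstar_seminorm_eq[OF assms(2)] assms(1) unfolding cstar_seminorm_def by metis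
  then show ?thesis by (auto simp: power2_eq_square)
qed

text \<open>The bound does not depend on \<open>\<nu>\<close>; it keeps the supremum in
  \<open>Bi_norm\<close> finite.\<close>

lemma cstar_seminorm_le:
  assumes gen: "\<And>v. \<nu> (nc_var v) \<le> 1"
  shows "\<nu> a \<le> (\<Sum>w\<in>Poly_Mapping.keys a. cmod (Poly_Mapping.lookup a w))"
proof -
  have tri: "\<nu> (c + d) \<le> \<nu> c + \<nu> d" and mult: "\<nu> (c * d) \<le> \<nu> c * \<nu> d" 
    and const: "\<nu> (nc_const z * c) = cmod z * \<nu> c" for c d z
    using \<nu> by (simp_all add: cstar_seminorm_def)
  have word: "\<nu> (Poly_Mapping.single (Word vs) 1) \<le> 1" for vs
  proof (induction vs)
    case Nil
    have "\<nu> 1 \<le> 1"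
      by (rule cstar_seminorm_selfadjoint_idempotent_le_1)
        (simp_all add: bstar_def cstar_seminorm_0 zero_ncword_def mult_single plus_ncword_def flip: single_one)
    then show ?case by (simp flip: zero_ncword_def)
  next
    case (Cons v vs)
    have "Poly_Mapping.single (Word (v # vs)) (1::complex) = nc_var v * Poly_Mapping.single (Word vs) 1"
      by (simp add: nc_var_def mult_single plus_ncword_def)
    then have "\<nu> (Poly_Mapping.single (Word (v # vs)) 1) \<le> \<nu> (nc_var v) * \<nu> (Poly_Mapping.single (Word vs) 1)"
      using mult by simp
    also have "\<dots> \<le> 1 * 1"
      by (intro mult_mono gen Cons cstar_seminorm_nonneg) simp
    finally show ?case by simp
  qed
  have sum: "\<nu> (sum f A) \<le> (\<Sum>i\<in>A. \<nu> (f i))" for f :: "bgen ncword \<Rightarrow> bfree" and A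
    by (induction A rule: infinite_finite_induct)
      (auto simp: cstar_seminorm_0 intro: order_trans[OF tri])
  have "a = (\<Sum>w\<in>Poly_Mapping.keys a. nc_const (Poly_Mapping.lookup a w) * Poly_Mapping.single w 1)"
  proof (induction a rule: ncpoly_induct)
    case (single w c)
    show ?case by (simp add: nc_const_def mult_single)
  next
    case (add p q)
    have "(\<Sum>w\<in>Poly_Mapping.keys (p + q). nc_const (Poly_Mapping.lookup (p + q) w) * Poly_Mapping.single w 1)
      = (\<Sum>w\<in>Poly_Mapping.keys p. nc_const (Poly_Mapping.lookup p w) * Poly_Mapping.single w 1)
      + (\<Sum>w\<in>Poly_Mapping.keys q. nc_const (Poly_Mapping.lookup q w) * (Poly_Mapping.single w 1 :: bfree))"
      by (rule setsum_keys_plus_distrib) (simp_all add: nc_const_def single_add distrib_right)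
    then show ?case using add by simp
  qed
  then have "\<nu> a \<le> (\<Sum>w\<in>Poly_Mapping.keys a. \<nu> (nc_const (Poly_Mapping.lookup a w) * Poly_Mapping.single w 1))"
    using sum by metis
  also have "\<dots> \<le> (\<Sum>w\<in>Poly_Mapping.keys a. cmod (Poly_Mapping.lookup a w))"
    unfolding const by (intro sum_mono mult_left_le, metis word ncword.collapse) simp
  finally show ?thesis .
qed

end

text \<open>A real supremum dominates its members only over a bounded family. Each generator is
  either annihilated or a selfadjoint idempotent modulo the relations, so all competing seminorms
  are at most 1 on it.\<close>

lemma seminorm_le_Bi_norm:
  assumes "cstar_seminorm \<nu>" "\<forall>r\<in>Bi_relations n k. \<nu> r = 0"
  shows "\<nu> a \<le> Bi_norm n k a"
  unfolding Bi_norm_def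
proof (rule cSUP_upper)
  have "\<nu> (nc_var v) \<le> 1" if \<nu>: "cstar_seminorm \<nu>" "\<forall>r\<in>Bi_relations n k. \<nu> r = 0" for \<nu> v
  proof -
    have star: "bstar (nc_var v) = nc_var v"
      by (simp add: bstar_def nc_var_def)
    show ?thesis
    proof (cases "nc_var v \<in> Bi_relations n k")
      case True
      then show ?thesis using \<nu> by simp
    next
      case False
      then have "nc_var v * nc_var v - nc_var v \<in> Bi_relations n k"
        unfolding Bi_relations_def by (cases v) blast+
      then show ?thesis
        using cstar_seminorm_selfadjoint_idempotent_le_1[OF \<nu>(1) star] \<nu>(2) by blast
    qed
  qed
  then show "bdd_above ((\<lambda>\<nu>. \<nu> a) ` {\<nu>. cstar_seminorm \<nu> \<and> (\<forall>r\<in>Bi_relations n k. \<nu> r = 0)})"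
    by (intro bdd_aboveI2[where M = "\<Sum>w\<in>Poly_Mapping.keys a. cmod (Poly_Mapping.lookup a w)"])
      (auto intro: cstar_seminorm_le)
qed (use assms in auto)

text \<open>Any matrix representation of the relations tests equality in the universal algebra,
  since universal seminorm 0 forces operator norm 0.\<close>

lemma Bi_eq_rep:
  assumes "\<And>v. adj_mat2 (g v) = g v" "\<And>r. r \<in> Bi_relations n k \<Longrightarrow> rep g r = 0"
    and "Bi_eq n k a b"
  shows "rep g a = rep g b"
proof -
  have "norm_mat2 (rep g (a - b)) \<le> Bi_norm n k (a - b)"
    using assms by (intro seminorm_le_Bi_norm cstar_seminorm_rep) auto
  then have "rep g (a - b) = 0"
    using assms(3) norm_mat2_nonneg[of "rep g (a - b)"] by (intro norm_mat2_eq_0) (simp add: Bi_eq_def)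
  then show ?thesis by (simp add: rep_diff)
qed

section \<open>The spreading homomorphism seen through a representation\<close>

definition tensor_rep :: "(bgen \<Rightarrow> mat2) \<Rightarrow> (nat list \<Rightarrow> complex) \<Rightarrow> (nat, bfree) ncpoly \<Rightarrow> mat2" where
  "tensor_rep g m t = (\<Sum>w\<in>Poly_Mapping.keys t.
     scalar_mat2 (m (letters w)) * rep g (Poly_Mapping.lookup t w))"

lemma tensor_rep_add: "tensor_rep g m (s + t) = tensor_rep g m s + tensor_rep g m t"
  unfolding tensor_rep_def
  by (rule setsum_keys_plus_distrib) (simp_all add: rep_add distrib_left)

lemma tensor_rep_sum: "tensor_rep g m (sum f A) = (\<Sum>i\<in>A. tensor_rep g m (f i))"
  by (induction A rule: infinite_finite_induct) (simp_all add: tensor_rep_add, simp_all add: tensor_rep_def)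

text \<open>The functional \<open>m\<close> is an arbitrary function of letter lists, so a leading
  letter can be absorbed into it; this gives a recursion over words.\<close>

lemma tensor_rep_Cons:
  "tensor_rep g m (nc_const b * nc_var i * t) = rep g b * tensor_rep g (\<lambda>w. m (i # w)) t"
proof (induction t rule: ncpoly_induct)
  case (single w c)
  have "nc_const b * nc_var i * Poly_Mapping.single w c = Poly_Mapping.single (Word (i # letters w)) (b * c)"
    by (simp add: nc_const_def nc_var_def mult_single plus_ncword_def zero_ncword_def)
  then show ?case
    by (simp add: tensor_rep_def rep_mult) (metis mult.assoc scalar_mat2_commute mult_zero_right rep_0 rep_mult)
qed (simp add: tensor_rep_add distrib_left)

lemma tensor_rep_1: "tensor_rep g m 1 = scalar_mat2 (m [])"
proof -
  have "rep g 1 = 1" using rep_const[of g 1] by (simp add: nc_const_def)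
  then show ?thesis by (simp add: tensor_rep_def lookup_one) (simp add: zero_ncword_def)
qed

text \<open>The image of the monomial \<open>js\<close> under the spreading homomorphism, with
  \<open>m\<close> applied to the polynomial factor and \<open>g\<close> to the coefficient
  factor.\<close>

definition spread_rep :: "(bgen \<Rightarrow> mat2) \<Rightarrow> nat \<Rightarrow> (nat list \<Rightarrow> complex) \<Rightarrow> nat list \<Rightarrow> mat2" where
  "spread_rep g n m js =
     tensor_rep g m (prod_list (map (\<lambda>j. \<Sum>i=1..n. nc_const (gu i j) * nc_var i) js))"

lemma spread_rep_Nil: "spread_rep g n m [] = scalar_mat2 (m [])"
  by (simp add: spread_rep_def tensor_rep_1)

lemma spread_rep_Cons:
  "spread_rep g n m (j # js) = (\<Sum>i=1..n. g (GenU i j) * spread_rep g n (\<lambda>w. m (i # w)) js)"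
  by (simp add: spread_rep_def sum_distrib_right tensor_rep_sum tensor_rep_Cons rep_var)

lemma rep_tensor_id:
  "rep g (tensor_id \<mu> t) = tensor_rep g (\<lambda>w. \<mu> (Poly_Mapping.single (Word w) 1)) t"
  by (simp add: tensor_id_def tensor_rep_def rep_sum rep_mult rep_const)

text \<open>The spreadability condition for a single monomial, read as an equation between matrices;
  only representations are used from here on.\<close>

lemma boolean_spreadable_fin_rep:
  assumes "boolean_spreadable_fin \<phi> n y" "1 \<le> k" "k < n" "set js \<subseteq> {1..k}"
    and "\<And>v. adj_mat2 (g v) = g v" "\<And>r. r \<in> Bi_relations n k \<Longrightarrow> rep g r = 0"
  defines "m \<equiv> \<lambda>w. joint_distribution \<phi> y (Poly_Mapping.single (Word w) 1)"
  shows "scalar_mat2 (m js) * g GenP = g GenP * spread_rep g n m js * g GenP"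
proof -
  let ?p = "Poly_Mapping.single (Word js) (1::complex)"
  have "?p \<in> nc_vars_in {1..k}" using assms(4) by (simp add: nc_vars_in_def)
  then have "Bi_eq n k (nc_const (joint_distribution \<phi> y ?p) * gP)
                  (gP * tensor_id (joint_distribution \<phi> y) (spread_hom n ?p) * gP)"
    using assms(1-3) by (auto simp: boolean_spreadable_fin_def)
  from Bi_eq_rep[OF assms(5,6) this]
  have "scalar_mat2 (m js) * g GenP
      = g GenP * tensor_rep g m (spread_hom n ?p) * g GenP"
    by (simp add: rep_mult rep_const rep_var rep_tensor_id m_def)
  moreover have "spread_hom n ?p = prod_list (map (\<lambda>j. \<Sum>i=1..n. nc_const (gu i j) * nc_var i) js)"
    by (simp add: spread_hom_def, simp add: nc_const_def)
  ultimately show ?thesis by (simp add: spread_rep_def)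
qed

section \<open>The representation by two copies\<close>

definition diag_proj :: "bool \<Rightarrow> mat2" where
  "diag_proj c = (if c then Mat2 1 0 0 0 else Mat2 0 0 0 1)"

text \<open>The projection onto the line through (1, 1). Having rank one, it turns a matrix
  compressed by it into a multiple of itself, and it gives both coordinate projections the same
  weight 1/2.\<close>

definition mean_proj :: mat2 where
  "mean_proj = Mat2 (1/2) (1/2) (1/2) (1/2)"

lemma diag_proj_mult: "diag_proj c * diag_proj d = (if c = d then diag_proj c else 0)"
  by (simp add: diag_proj_def zero_mat2_def)

lemma diag_proj_sum: "diag_proj True + diag_proj False = 1"
  by (simp add: diag_proj_def one_mat2_def)

lemma mean_proj_idem: "mean_proj * mean_proj = mean_proj"
  by (simp add: mean_proj_def)

lemma scalar_mean_proj_cancel: "scalar_mat2 c * mean_proj = scalar_mat2 d * mean_proj \<Longrightarrow> c = d"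
  by (simp add: mean_proj_def scalar_mat2_def)

text \<open>A letter of \<open>J\<close> is sent to one of two places, chosen by the two coordinate
  projections; the other letters have a single destination, weighted by the projection onto the
  constants. The compressions \<open>P p\<^sub>c P = P/2\<close> then decouple the blocks of a word that are
  separated by a letter outside \<open>J\<close>.\<close>

fun two_copies :: "nat \<Rightarrow> nat set \<Rightarrow> (bool \<Rightarrow> nat \<Rightarrow> nat) \<Rightarrow> bgen \<Rightarrow> mat2" where
  "two_copies k J \<sigma> GenP = mean_proj"
| "two_copies k J \<sigma> (GenU i j) =
     (if j \<notin> {1..k} then 0
      else if j \<in> J then (if i = \<sigma> True j then diag_proj True else 0)
                        + (if i = \<sigma> False j then diag_proj False else 0)
      else if i = \<sigma> True j then mean_proj else 0)"

context
  fixes n k :: nat and J :: "nat set" and \<sigma> :: "bool \<Rightarrow> nat \<Rightarrow> nat"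
  assumes mono: "\<And>c. strict_mono_on {1..k} (\<sigma> c)"
    and range: "\<And>c. \<sigma> c ` {1..k} \<subseteq> {1..n}"
    and agree: "\<And>j. j \<in> {1..k} \<Longrightarrow> j \<notin> J \<Longrightarrow> \<sigma> True j = \<sigma> False j"
begin

lemma two_copies_sum:
  assumes "j \<in> {1..k}"
  shows "(\<Sum>i=1..n. two_copies k J \<sigma> (GenU i j) * F i) =
    (if j \<in> J then diag_proj True * F (\<sigma> True j) + diag_proj False * F (\<sigma> False j)
     else mean_proj * F (\<sigma> True j))"
proof -
  have *: "\<sigma> c j \<in> {1..n}" for c using range assms by blast
  have "(\<Sum>i=1..n. (if i = \<sigma> c j then A else 0) * F i) = A * F (\<sigma> c j)" for c A
  proof -
    have "(\<Sum>i=1..n. (if i = \<sigma> c j then A else 0) * F i) = (\<Sum>i=1..n. if i = \<sigma> c j then A * F i else 0)"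
      by (rule sum.cong) auto
    then show ?thesis using * by simp
  qed
  then show ?thesis using assms by (simp add: distrib_right sum.distrib)
qed

lemma two_copies_selfadjoint: "adj_mat2 (two_copies k J \<sigma> v) = two_copies k J \<sigma> v"
  by (cases v) (auto simp: diag_proj_def mean_proj_def adj_mat2_add)

text \<open>The orthogonality relation holds within one copy because \<open>\<sigma> c\<close> is
  strictly increasing, and across copies because the coordinate projections are orthogonal. A letter
  outside \<open>J\<close> meets both copies, which is where \<open>agree\<close> enters. The sum
  relation reduces to \<open>diag_proj_sum\<close> or to the idempotence of
  \<open>mean_proj\<close>.\<close>

lemma two_copies_relations:
  assumes "r \<in> Bi_relations n k"
  shows "rep (two_copies k J \<sigma>) r = 0"
proof -
  have out: "two_copies k J \<sigma> (GenU i j) = 0" if "\<not> (i \<in> {1..n} \<and> j \<in> {1..k})" for i j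
    using that range by (auto simp: image_subset_iff)
  have idem: "two_copies k J \<sigma> (GenU i j) * two_copies k J \<sigma> (GenU i j) = two_copies k J \<sigma> (GenU i j)" for i j
    by (simp add: diag_proj_mult mean_proj_idem distrib_left distrib_right)
  have less: "\<sigma> c j < \<sigma> c j'" if "j \<in> {1..k}" "j' \<in> {1..k}" "j < j'" for c j j'
    using mono that by (auto simp: strict_mono_on_def)
  have orth: "two_copies k J \<sigma> (GenU i j) * two_copies k J \<sigma> (GenU i' j') = 0"
    if "j \<in> {1..k}" "j' \<in> {1..k}" "j < j'" "i' \<le> i" for i i' j j'
    using less[OF that(1-3), of True] less[OF that(1-3), of False] that agree[OF that(1)] agree[OF that(2)]
    by (auto simp: distrib_left distrib_right diag_proj_mult)
  have sum: "(\<Sum>i=1..n. two_copies k J \<sigma> (GenU i j) * mean_proj) = mean_proj" if "j \<in> {1..k}" for j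
    unfolding two_copies_sum[OF that]
    by (simp add: diag_proj_sum mean_proj_idem flip: distrib_right)
  show ?thesis
    using assms unfolding Bi_relations_def
    by (elim UnE CollectE exE conjE singletonE)
      (simp_all add: rep_var rep_mult rep_diff rep_sum out idem orth sum mean_proj_idem
        del: two_copies.simps(2) One_nat_def)
qed

text \<open>Orthogonality of the two coordinate projections removes every term in which two letters
  of the block follow different copies.\<close>

lemma spread_rep_copies:
  assumes "js \<noteq> []" "set js \<subseteq> J \<inter> {1..k}"
  shows "spread_rep (two_copies k J \<sigma>) n m (js @ ls) =
    diag_proj True * spread_rep (two_copies k J \<sigma>) n (\<lambda>w. m (map (\<sigma> True) js @ w)) ls
    + diag_proj False * spread_rep (two_copies k J \<sigma>) n (\<lambda>w. m (map (\<sigma> False) js @ w)) ls"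
  using assms
proof (induction js arbitrary: m)
  case (Cons j js)
  then have j: "j \<in> {1..k}" "j \<in> J" by auto
  show ?case
  proof (cases "js = []")
    case True
    then show ?thesis using j by (simp add: spread_rep_Cons two_copies_sum del: two_copies.simps(2) One_nat_def)
  next
    case False
    have IH: "spread_rep (two_copies k J \<sigma>) n m (js @ ls) =
      diag_proj True * spread_rep (two_copies k J \<sigma>) n (\<lambda>w. m (map (\<sigma> True) js @ w)) ls
      + diag_proj False * spread_rep (two_copies k J \<sigma>) n (\<lambda>w. m (map (\<sigma> False) js @ w)) ls" for m
      using Cons False by simp
    show ?thesis
      unfolding append_Cons list.map spread_rep_Cons IH two_copies_sum[OF j(1)] using j(2)
      by (simp add: distrib_left diag_proj_mult flip: mult.assoc)
  qed
qed simp

text \<open>Each letter contributes a \<open>mean_proj\<close>, and idempotence merges them into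
  one. An empty block would contribute none.\<close>

lemma spread_rep_single:
  assumes "js \<noteq> []" "set js \<subseteq> {1..k} - J"
  shows "spread_rep (two_copies k J \<sigma>) n m (js @ ls) =
    mean_proj * spread_rep (two_copies k J \<sigma>) n (\<lambda>w. m (map (\<sigma> True) js @ w)) ls"
  using assms
proof (induction js arbitrary: m)
  case (Cons j js)
  then have j: "j \<in> {1..k}" "j \<notin> J" by auto
  show ?case
  proof (cases "js = []")
    case True
    then show ?thesis using j by (simp add: spread_rep_Cons two_copies_sum del: two_copies.simps(2) One_nat_def)
  next
    case False
    have IH: "spread_rep (two_copies k J \<sigma>) n m (js @ ls) =
      mean_proj * spread_rep (two_copies k J \<sigma>) n (\<lambda>w. m (map (\<sigma> True) js @ w)) ls" for m
      using Cons False by simp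
    show ?thesis
      unfolding append_Cons list.map spread_rep_Cons IH two_copies_sum[OF j(1)] using j(2)
      by (simp add: mean_proj_idem flip: mult.assoc)
  qed
qed simp

end

text \<open>The word expands into terms \<open>P p\<^sub>c P p\<^sub>d P\<close>. Each of the two
  compressions costs a factor 1/2, so every pair (c, d) has weight 1/4.\<close>

lemma boolean_spreadable_fin_decouple:
  fixes \<sigma> :: "bool \<Rightarrow> nat \<Rightarrow> nat"
  assumes "boolean_spreadable_fin \<phi> n y" "1 \<le> k" "k < n"
    and \<sigma>: "\<And>c. strict_mono_on {1..k} (\<sigma> c)" "\<And>c. \<sigma> c ` {1..k} \<subseteq> {1..n}"
      "\<And>j. j \<in> {1..k} \<Longrightarrow> j \<notin> J \<Longrightarrow> \<sigma> True j = \<sigma> False j"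
    and words: "set v \<subseteq> J \<inter> {1..k}" "set w \<subseteq> J \<inter> {1..k}" "set b \<subseteq> {1..k} - J" "v \<noteq> []" "w \<noteq> []" "b \<noteq> []"
  defines "m \<equiv> \<lambda>w. joint_distribution \<phi> y (Poly_Mapping.single (Word w) 1)"
  shows "4 * m (v @ b @ w) =
    (\<Sum>c\<in>UNIV. \<Sum>d\<in>UNIV. m (map (\<sigma> c) v @ map (\<sigma> True) b @ map (\<sigma> d) w))"
proof -
  let ?P = mean_proj and ?p = diag_proj
  let ?m = "\<lambda>c d. scalar_mat2 (m (map (\<sigma> c) v @ map (\<sigma> True) b @ map (\<sigma> d) w))"
  have copies: "spread_rep (two_copies k J \<sigma>) n m' (v @ ls) =
      ?p True * spread_rep (two_copies k J \<sigma>) n (\<lambda>w. m' (map (\<sigma> True) v @ w)) ls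
      + ?p False * spread_rep (two_copies k J \<sigma>) n (\<lambda>w. m' (map (\<sigma> False) v @ w)) ls" for m' ls
    using \<sigma> words(4,1) by (rule spread_rep_copies)
  have single: "spread_rep (two_copies k J \<sigma>) n m' (b @ ls) =
      ?P * spread_rep (two_copies k J \<sigma>) n (\<lambda>w. m' (map (\<sigma> True) b @ w)) ls" for m' ls
    using \<sigma> words(6,3) by (rule spread_rep_single)
  have last: "spread_rep (two_copies k J \<sigma>) n m' w = ?p True * scalar_mat2 (m' (map (\<sigma> True) w))
      + ?p False * scalar_mat2 (m' (map (\<sigma> False) w))" for m'
    using spread_rep_copies[where \<sigma> = \<sigma>, OF \<sigma> words(5,2), of m' "[]"] by (simp add: spread_rep_Nil)
  have summand: "?P * (?p c * (?P * (?p d * ?m c d))) * ?P = scalar_mat2 (m (map (\<sigma> c) v @ map (\<sigma> True) b @ map (\<sigma> d) w) / 4) * ?P" for c d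
    by (cases c; cases d) (simp_all add: mean_proj_def diag_proj_def scalar_mat2_def)
  have "set (v @ b @ w) \<subseteq> {1..k}" using words by auto
  from boolean_spreadable_fin_rep[OF assms(1-3) this two_copies_selfadjoint[where \<sigma> = \<sigma>, OF \<sigma>] two_copies_relations[where \<sigma> = \<sigma>, OF \<sigma>]]
  have "scalar_mat2 (m (v @ b @ w)) * ?P = ?P * spread_rep (two_copies k J \<sigma>) n m (v @ b @ w) * ?P"
    by (simp add: m_def)
  also have "\<dots> = scalar_mat2 ((\<Sum>c\<in>UNIV. \<Sum>d\<in>UNIV. m (map (\<sigma> c) v @ map (\<sigma> True) b @ map (\<sigma> d) w)) / 4) * ?P"
    unfolding copies single last
    by (simp add: distrib_left distrib_right summand UNIV_bool scalar_mat2_add add_divide_distrib)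
  finally have "m (v @ b @ w) = (\<Sum>c\<in>UNIV. \<Sum>d\<in>UNIV. m (map (\<sigma> c) v @ map (\<sigma> True) b @ map (\<sigma> d) w)) / 4"
    by (rule scalar_mean_proj_cancel)
  then show ?thesis by (simp only: divide_inverse) simp
qed

text \<open>With equal copies and every letter in \<open>J\<close> the two coordinate projections
  add up to 1, so the representation is a mere relabelling by \<open>\<sigma>\<close>.\<close>

lemma boolean_spreadable_fin_mono:
  assumes "boolean_spreadable_fin \<phi> n y" "1 \<le> k" "k < n"
    and \<sigma>: "strict_mono_on {1..k} \<sigma>" "\<sigma> ` {1..k} \<subseteq> {1..n}"
    and w: "set w \<subseteq> {1..k}"
  defines "m \<equiv> \<lambda>w. joint_distribution \<phi> y (Poly_Mapping.single (Word w) 1)"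
  shows "m (map \<sigma> w) = m w"
proof (cases "w = []")
  case False
  let ?P = mean_proj and ?g = "two_copies k {1..k} (\<lambda>_. \<sigma>)"
  have sp: "spread_rep ?g n m w = scalar_mat2 (m (map \<sigma> w))"
    using spread_rep_copies[of k "\<lambda>_. \<sigma>" n "{1..k}" w m "[]"] \<sigma> w False
    by (simp add: spread_rep_Nil diag_proj_sum flip: distrib_right)
  have "scalar_mat2 (m w) * ?P = ?P * spread_rep ?g n m w * ?P"
    using boolean_spreadable_fin_rep[OF assms(1-3) w, where g = ?g]
      two_copies_selfadjoint[of k "\<lambda>_. \<sigma>" n "{1..k}"] two_copies_relations[of k "\<lambda>_. \<sigma>" n "{1..k}"] \<sigma>
    by (simp add: m_def)
  also have "\<dots> = scalar_mat2 (m (map \<sigma> w)) * ?P"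
    unfolding sp scalar_mat2_commute by (simp add: mult.assoc mean_proj_idem)
  finally show ?thesis by (simp add: scalar_mean_proj_cancel)
qed simp

subsection \<open>Moments of a spreadable sequence\<close>

definition word_op :: "('g \<Rightarrow> 'h::complex_hilbert_space bop) \<Rightarrow> 'g list \<Rightarrow> 'h bop" where
  "word_op y w = foldr (\<lambda>g T. y g o\<^sub>L T) w id_blinfun"

lemma scaleC_one: "scaleC 1 (v::'h::complex_hilbert_space) = v"
  using scaleR_eq_scaleC[of 1 v] by simp

lemma joint_distribution_word: "joint_distribution \<phi> y (Poly_Mapping.single (Word w) 1) = \<phi> (word_op y w)"
proof -
  have "scaleC_op 1 T = T" for T :: "'a bop"
    by (rule blinfun_eqI) (simp add: scaleC_op.rep_eq scaleC_one)
  then show ?thesis by (simp add: joint_distribution_def eval_op_def word_op_def)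
qed

lemma word_op_map: "word_op y (map f w) = word_op (y \<circ> f) w"
  by (simp add: word_op_def foldr_map comp_def)

lemma word_op_cong: "(\<And>i. i \<in> set w \<Longrightarrow> y i = z i) \<Longrightarrow> word_op y w = word_op z w"
  unfolding word_op_def by (induction w) simp_all

text \<open>Finite spreadability speaks of variables numbered from 1, with k < n. A window of n
  consecutive integers contains \<open>R\<close>: \<open>r\<close> is the position in the window,
  \<open>e\<close> enumerates \<open>S\<close> increasingly, and \<open>idx\<close> inverts
  \<open>e\<close>.\<close>

lemma boolean_spreadable_coordinates:
  fixes S R :: "int set"
  assumes "boolean_spreadable \<phi> x" "finite R" "S \<subseteq> R" "S \<noteq> {}"
  obtains n k y r e idx where
    "boolean_spreadable_fin \<phi> n y" "1 \<le> k" "k < n"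
    "strict_mono_on R r" "r ` R \<subseteq> {1..n}" "\<And>t. t \<in> R \<Longrightarrow> y (r t) = x t"
    "strict_mono_on {1..k} e" "e ` {1..k} = S" "\<And>t. t \<in> S \<Longrightarrow> idx t \<in> {1..k}" "\<And>t. t \<in> S \<Longrightarrow> e (idx t) = t"
proof -
  \<comment> \<open>The added 1 keeps both ends of the window from -N to N outside \<open>R\<close>,
    which yields \<open>card S < n\<close>.\<close>
  define N where "N = Max (abs ` R) + 1"
  have N: "- N < t \<and> t < N" if "t \<in> R" for t
  proof -
    have "\<bar>t\<bar> \<le> Max (abs ` R)" using that assms(2) by (intro Max_ge) auto
    then show ?thesis by (auto simp: N_def)
  qed
  have "0 < N" using N assms(3,4) by force
  define n where "n = nat (2 * N + 1)"
  define s where "s i = int i - N - 1" for i :: nat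
  define r where "r t = nat (t + N + 1)" for t
  have S: "finite S" using assms finite_subset by blast
  \<comment> \<open>Positions are counted from 1, list entries from 0.\<close>
  define e where "e j = sorted_list_of_set S ! (j - 1)" for j
  have eS: "e ` {1..card S} = S"
  proof -
    have "(\<lambda>j. j - 1) ` {1..card S} = {..<card S}"
      by (force simp: image_iff intro: bexI[of _ "Suc _"])
    then have "e ` {1..card S} = (!) (sorted_list_of_set S) ` {..<card S}"
      unfolding e_def by (metis image_image)
    also have "\<dots> = S"
      using nth_image[of "card S" "sorted_list_of_set S"] S by (simp add: lessThan_atLeast0)
    finally show ?thesis .
  qed
  have "card S \<le> card {- N<..<N}"
    using N assms(3) by (intro card_mono) auto
  then have "card S < n" using \<open>0 < N\<close> by (simp add: n_def)
  show ?thesis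
  proof (rule that[of n "x \<circ> s" "card S" r e "inv_into {1..card S} e"])
    show "boolean_spreadable_fin \<phi> n (x \<circ> s)"
      using assms(1) unfolding boolean_spreadable_def by (auto simp: strict_mono_on_def s_def)
    show "1 \<le> card S" using S assms(4) by (simp add: Suc_le_eq card_gt_0_iff)
    show "strict_mono_on R r" using N by (force simp: strict_mono_on_def r_def)
    show "r ` R \<subseteq> {1..n}" using N by (force simp: r_def n_def)
    show "(x \<circ> s) (r t) = x t" if "t \<in> R" for t
      using N[OF that] by (simp add: s_def r_def)
    show "strict_mono_on {1..card S} e"
      using S by (auto simp: strict_mono_on_def e_def intro!: sorted_wrt_nth_less[OF strict_sorted_list_of_set])
    show "inv_into {1..card S} e t \<in> {1..card S}" "e (inv_into {1..card S} e t) = t" if "t \<in> S" for t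
      using that eS inv_into_into[of t e] f_inv_into_f[of t e] by blast+
  qed fact+
qed

text \<open>Both words are compared with the same normal form, the word \<open>map idx w\<close> in
  the first k variables: \<open>main\<close> is applied to \<open>f\<close> and to
  \<open>id\<close>.\<close>

lemma boolean_spreadable_strict_mono:
  assumes "boolean_spreadable \<phi> x" "strict_mono_on (set w) f"
  shows "\<phi> (word_op x (map f w)) = \<phi> (word_op x w)"
proof (cases "w = []")
  case False
  have "finite (set w \<union> f ` set w)" "set w \<subseteq> set w \<union> f ` set w" "set w \<noteq> {}"
    using False by auto
  from boolean_spreadable_coordinates[OF assms(1) this]
  obtain n k y r e idx where *:
    "boolean_spreadable_fin \<phi> n y" "1 \<le> k" "k < n"
    "strict_mono_on (set w \<union> f ` set w) r" "r ` (set w \<union> f ` set w) \<subseteq> {1..n}"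
    "\<And>t. t \<in> set w \<union> f ` set w \<Longrightarrow> y (r t) = x t"
    "strict_mono_on {1..k} e" "e ` {1..k} = set w"
    "\<And>t. t \<in> set w \<Longrightarrow> idx t \<in> {1..k}" "\<And>t. t \<in> set w \<Longrightarrow> e (idx t) = t"
    by (metis (no_types, lifting))
  have main: "\<phi> (word_op x (map g w)) = \<phi> (word_op y (map idx w))"
    if g: "strict_mono_on (set w) g" "g ` set w \<subseteq> set w \<union> f ` set w" for g
  proof -
    have "\<phi> (word_op y (map (\<lambda>j. r (g (e j))) (map idx w))) = \<phi> (word_op y (map idx w))"
      unfolding joint_distribution_word[symmetric]
    proof (rule boolean_spreadable_fin_mono[OF *(1-3)])
      have "e i \<in> set w" if "i \<in> {1..k}" for i using *(8) that by blast
      then show "strict_mono_on {1..k} (\<lambda>j. r (g (e j)))"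
        using *(4,7) g unfolding strict_mono_on_def image_subset_iff by meson
      show "(\<lambda>j. r (g (e j))) ` {1..k} \<subseteq> {1..n}"
        using *(5,8) g(2) by blast
      show "set (map idx w) \<subseteq> {1..k}" using *(9) by auto
    qed
    moreover have "word_op y (map (\<lambda>j. r (g (e j))) (map idx w)) = word_op x (map g w)"
      unfolding word_op_map using *(6,10) g(2) by (intro word_op_cong) (auto simp: image_subset_iff)
    ultimately show ?thesis by simp
  qed
  show ?thesis
    using main[OF assms(2)] main[of id] by (simp add: strict_mono_on_def)
qed simp

text \<open>Copy \<open>True\<close> stays in place and copy \<open>False\<close> moves by
  \<open>f\<close>. Of the four summands, the one with nothing moved and the one with
  \<open>v\<close> and \<open>w\<close> both moved equal the moment itself, the latter by invariance
  under \<open>f\<close>; cancelling them from four times the moment leaves the two mixed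
  ones.\<close>

lemma boolean_spreadable_decouple:
  assumes bs: "boolean_spreadable \<phi> x" and f: "strict_mono_on (set (v @ b @ w)) f"
    and b: "\<And>t. t \<in> set b \<Longrightarrow> f t = t" "set b \<inter> (set v \<union> set w) = {}"
    and ne: "v \<noteq> []" "b \<noteq> []" "w \<noteq> []"
  shows "2 * \<phi> (word_op x (v @ b @ w)) =
    \<phi> (word_op x (map f v @ b @ w)) + \<phi> (word_op x (v @ b @ map f w))"
proof -
  define S where "S = set (v @ b @ w)"
  have sub: "set v \<subseteq> S" "set b \<subseteq> S" "set w \<subseteq> S" by (auto simp: S_def)
  have "finite (S \<union> f ` S)" "S \<subseteq> S \<union> f ` S" "S \<noteq> {}"
    using ne by (auto simp: S_def)
  from boolean_spreadable_coordinates[OF bs this]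
  obtain n k y r e idx where *:
    "boolean_spreadable_fin \<phi> n y" "1 \<le> k" "k < n"
    "strict_mono_on (S \<union> f ` S) r" "r ` (S \<union> f ` S) \<subseteq> {1..n}"
    "\<And>t. t \<in> S \<union> f ` S \<Longrightarrow> y (r t) = x t"
    "strict_mono_on {1..k} e" "e ` {1..k} = S"
    "\<And>t. t \<in> S \<Longrightarrow> idx t \<in> {1..k}" "\<And>t. t \<in> S \<Longrightarrow> e (idx t) = t"
    by (metis (no_types, lifting))
  define F where "F c = (if c then id else f)" for c
  define \<sigma> where "\<sigma> c j = r (F c (e j))" for c j
  \<comment> \<open>The positions of the letters of \<open>v\<close> and \<open>w\<close>; the
    letters of \<open>b\<close> must have a single destination.\<close>
  define J where "J = {j. e j \<notin> set b}"
  have eS: "e i \<in> S" if "i \<in> {1..k}" for i using *(8) that by blast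
  have F: "strict_mono_on S (F c)" "F c ` S \<subseteq> S \<union> f ` S" for c
    using f by (auto simp: F_def S_def strict_mono_on_def)
  have words: "word_op y (map (\<sigma> c) (map idx v) @ map (\<sigma> True) (map idx b) @ map (\<sigma> d) (map idx w))
      = word_op x (map (F c) v @ b @ map (F d) w)" for c d
  proof -
    have "word_op y (map r (map (F c) v @ map (F True) b @ map (F d) w)) = word_op x (map (F c) v @ map (F True) b @ map (F d) w)"
      unfolding word_op_map using *(6) F(2) sub by (intro word_op_cong) (auto, blast+)
    moreover have "map (\<sigma> c) (map idx u) = map r (map (F c) u)" if "set u \<subseteq> S" for c u
      using that *(10) by (auto simp: \<sigma>_def)
    moreover have "map (F True) b = b" by (simp add: F_def)
    ultimately show ?thesis using sub unfolding map_append by metis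
  qed
  have "4 * \<phi> (word_op y (map idx v @ map idx b @ map idx w)) =
    (\<Sum>c\<in>UNIV. \<Sum>d\<in>UNIV. \<phi> (word_op y (map (\<sigma> c) (map idx v) @ map (\<sigma> True) (map idx b) @ map (\<sigma> d) (map idx w))))"
    unfolding joint_distribution_word[symmetric]
  proof (rule boolean_spreadable_fin_decouple[OF *(1-3), where J = J])
    show "strict_mono_on {1..k} (\<sigma> c)" for c
      using *(4,7) F[of c] eS unfolding strict_mono_on_def image_subset_iff \<sigma>_def by meson
    show "\<sigma> c ` {1..k} \<subseteq> {1..n}" for c
      using *(5) F(2)[of c] eS by (auto simp: \<sigma>_def image_subset_iff)
    show "\<sigma> True j = \<sigma> False j" if "j \<in> {1..k}" "j \<notin> J" for j
      using that b by (simp add: \<sigma>_def F_def J_def)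
    show "set (map idx v) \<subseteq> J \<inter> {1..k}" "set (map idx w) \<subseteq> J \<inter> {1..k}" "set (map idx b) \<subseteq> {1..k} - J"
      using *(9,10) sub b(2) unfolding J_def by (fastforce simp: subset_iff)+
  qed (use ne in auto)
  \<comment> \<open>The left-hand side of the four-term identity is a moment at the positions 1 to
    k; the unmoved copy carries it to the actual letters.\<close>
  moreover have "\<phi> (word_op y (map idx v @ map idx b @ map idx w)) = \<phi> (word_op x (v @ b @ w))"
  proof -
    have "\<phi> (word_op y (map (\<sigma> True) (map idx v @ map idx b @ map idx w))) = \<phi> (word_op y (map idx v @ map idx b @ map idx w))"
      unfolding joint_distribution_word[symmetric]
    proof (rule boolean_spreadable_fin_mono[OF *(1-3)])
      show "strict_mono_on {1..k} (\<sigma> True)"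
        using *(4,7) F[of True] eS unfolding strict_mono_on_def image_subset_iff \<sigma>_def by meson
      show "\<sigma> True ` {1..k} \<subseteq> {1..n}"
        using *(5) F(2)[of True] eS by (auto simp: \<sigma>_def image_subset_iff)
      show "set (map idx v @ map idx b @ map idx w) \<subseteq> {1..k}"
        using *(9) sub by (auto simp: subset_iff)
    qed
    then show ?thesis using words[of True True] by (simp add: F_def)
  qed
  moreover have "\<phi> (word_op x (map f v @ b @ map f w)) = \<phi> (word_op x (v @ b @ w))"
  proof -
    have "map f b = b" using b(1) by (simp add: map_idI)
    then show ?thesis using boolean_spreadable_strict_mono[OF bs f] by simp
  qed
  ultimately show ?thesis
    unfolding words by (simp add: UNIV_bool F_def)
qed

subsection \<open>Geometry of complex Hilbert spaces\<close>

lemma scaleC_minus_one: "scaleC (- 1) (v::'h::complex_hilbert_space) = - v"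
  using scaleR_eq_scaleC[of "- 1" v] by simp

lemma scaleC_zero [simp]: "scaleC 0 (v::'h::complex_hilbert_space) = 0"
  using scaleR_eq_scaleC[of 0 v] by simp

lemma scaleC_zero_right [simp]: "scaleC c (0::'h::complex_hilbert_space) = 0"
  by (rule linear_0[OF bounded_linear.linear[OF bounded_linear_scaleC]])

lemma cinner_add_right: "cinner u (v + w) = cinner u v + cinner u (w::'h::complex_hilbert_space)"
  by (metis cinner_add_left cinner_commute complex_cnj_add)

lemma cinner_scaleC_right: "cinner u (scaleC c v) = cnj c * cinner u (v::'h::complex_hilbert_space)"
  by (metis cinner_scaleC_left cinner_commute complex_cnj_mult)

lemma cinner_minus_left: "cinner (- u) v = - cinner u (v::'h::complex_hilbert_space)"
  by (simp add: cinner_scaleC_left flip: scaleC_minus_one)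

lemma cinner_minus_right: "cinner u (- v) = - cinner u (v::'h::complex_hilbert_space)"
  by (simp add: cinner_scaleC_right flip: scaleC_minus_one)

lemma cinner_diff_left: "cinner (u - v) w = cinner u w - cinner v (w::'h::complex_hilbert_space)"
  by (simp add: diff_conv_add_uminus cinner_add_left cinner_minus_left del: add_uminus_conv_diff)

lemma cinner_diff_right: "cinner u (v - w) = cinner u v - cinner u (w::'h::complex_hilbert_space)"
  by (simp add: diff_conv_add_uminus cinner_add_right cinner_minus_right del: add_uminus_conv_diff)

lemma cinner_zero_left [simp]: "cinner 0 (v::'h::complex_hilbert_space) = 0"
  using cinner_scaleC_left[of 0 0 v] by simp

lemma cinner_zero_right [simp]: "cinner (v::'h::complex_hilbert_space) 0 = 0"
  using cinner_scaleC_right[of v 0 0] by simp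

lemma cinner_self_eq_0 [simp]: "cinner v v = 0 \<longleftrightarrow> v = (0::'h::complex_hilbert_space)"
  by (simp add: cinner_self)

lemma norm_diff_square:
  "(norm (u - v))\<^sup>2 = (norm u)\<^sup>2 - 2 * Re (cinner u v) + (norm (v::'h::complex_hilbert_space))\<^sup>2"
proof -
  have "complex_of_real ((norm (u - v))\<^sup>2) = of_real ((norm u)\<^sup>2) - (cinner u v + cnj (cinner u v)) + of_real ((norm v)\<^sup>2)"
    using cinner_commute[of v u]
    by (simp only: cinner_self[symmetric] cinner_diff_left cinner_diff_right) (simp add: algebra_simps)
  also have "cinner u v + cnj (cinner u v) = of_real (2 * Re (cinner u v))"
    by (rule complex_add_cnj)
  finally show ?thesis
    by (simp only: of_real_add[symmetric] of_real_diff[symmetric] of_real_eq_iff)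
qed

lemma norm_add_square:
  "(norm (u + v))\<^sup>2 = (norm u)\<^sup>2 + 2 * Re (cinner u v) + (norm (v::'h::complex_hilbert_space))\<^sup>2"
  using norm_diff_square[of u "- v"] by (simp add: cinner_minus_right)

lemma cinner_Cauchy_Schwarz: "cmod (cinner v w) \<le> norm v * norm (w::'h::complex_hilbert_space)"
proof (cases "w = 0")
  case False
  define a where "a = (norm w)\<^sup>2"
  define c where "c = cinner v w"
  have a: "a > 0" using False by (simp add: a_def)
  \<comment> \<open>The component of \<open>v\<close> orthogonal to \<open>w\<close>, multiplied by
    \<open>a\<close> to avoid a division.\<close>
  have "0 \<le> (norm (a *\<^sub>R v - scaleC c w))\<^sup>2" by simp
  also have "\<dots> = a * (a * (norm v)\<^sup>2 - (cmod c)\<^sup>2)"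
  proof -
    have "cinner (a *\<^sub>R v) (scaleC c w) = of_real (a * (cmod c)\<^sup>2)"
      by (simp add: scaleR_eq_scaleC cinner_scaleC_left cinner_scaleC_right mult.commute flip: c_def)
        (simp flip: complex_norm_square of_real_power)
    then show ?thesis
      unfolding norm_diff_square by (simp add: norm_scaleC power_mult_distrib a_def algebra_simps power2_eq_square)
  qed
  finally have "(cmod c)\<^sup>2 \<le> a * (norm v)\<^sup>2"
    using a by (simp add: zero_le_mult_iff)
  then have "(cmod c)\<^sup>2 \<le> (norm v * norm w)\<^sup>2"
    by (simp add: a_def power_mult_distrib mult.commute)
  then show ?thesis by (simp add: c_def power2_le_iff_abs_le)
qed simp

lemma bounded_bilinear_cinner: "bounded_bilinear (cinner :: 'h::complex_hilbert_space \<Rightarrow> _)"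
proof
  show "\<exists>K. \<forall>a b::'h. cmod (cinner a b) \<le> norm a * norm b * K"
    by (rule exI[of _ 1]) (simp add: cinner_Cauchy_Schwarz)
qed (simp_all add: cinner_add_left cinner_add_right cinner_scaleC_left cinner_scaleC_right scaleR_eq_scaleC
      scaleR_conv_of_real)

lemmas tendsto_cinner [tendsto_intros] = bounded_bilinear.tendsto[OF bounded_bilinear_cinner]

lemma cinner_eqI: "(\<And>w. cinner u w = cinner v w) \<Longrightarrow> u = (v::'h::complex_hilbert_space)"
  using cinner_self_eq_0[of "u - v"] by (simp add: cinner_diff_left)

section \<open>Orthogonal projection and Riesz representation\<close>

definition csubspace :: "'h::complex_hilbert_space set \<Rightarrow> bool" where
  "csubspace K \<longleftrightarrow> 0 \<in> K \<and> (\<forall>u\<in>K. \<forall>v\<in>K. u + v \<in> K) \<and> (\<forall>c. \<forall>v\<in>K. scaleC c v \<in> K)"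

lemma csubspace_closure:
  assumes "csubspace K" shows "csubspace (closure K)"
  unfolding csubspace_def
proof (intro conjI ballI allI)
  show "0 \<in> closure K" using assms closure_subset by (auto simp: csubspace_def)
next
  fix u v assume "u \<in> closure K" "v \<in> closure K"
  then obtain f g where "\<forall>n. f n \<in> K" "f \<longlonglongrightarrow> u" "\<forall>n. g n \<in> K" "g \<longlonglongrightarrow> v"
    by (metis closure_sequential)
  then have "\<forall>n. f n + g n \<in> K" "(\<lambda>n. f n + g n) \<longlonglongrightarrow> u + v"
    using assms by (auto simp: csubspace_def intro: tendsto_add)
  then show "u + v \<in> closure K" unfolding closure_sequential by (intro exI conjI)
next
  fix c v assume "v \<in> closure K"
  then obtain f where "\<forall>n. f n \<in> K" "f \<longlonglongrightarrow> v"
    by (metis closure_sequential)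
  then have "\<forall>n. scaleC c (f n) \<in> K" "(\<lambda>n. scaleC c (f n)) \<longlonglongrightarrow> scaleC c v"
    using assms by (auto simp: csubspace_def intro: bounded_linear.tendsto[OF bounded_linear_scaleC])
  then show "scaleC c v \<in> closure K" unfolding closure_sequential by (intro exI conjI)
qed

text \<open>The parallelogram law makes a minimising sequence Cauchy. Its limit attains the
  distance, and minimality along each line in \<open>K\<close> gives orthogonality.\<close>

lemma orthogonal_projection_exists:
  fixes v :: "'h::complex_hilbert_space"
  assumes K: "csubspace K" "closed K"
  obtains p where "p \<in> K" "\<And>k. k \<in> K \<Longrightarrow> cinner (v - p) k = 0"
proof -
  have add: "a + b \<in> K" if "a \<in> K" "b \<in> K" for a b using K that by (simp add: csubspace_def)
  have scale: "scaleC c a \<in> K" if "a \<in> K" for a c using K that by (simp add: csubspace_def)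
  have ne: "K \<noteq> {}" using K by (auto simp: csubspace_def)
  define d where "d = infdist v K"
  have d: "d \<le> norm (v - k)" if "k \<in> K" for k
    using infdist_le[OF that, of v] by (simp add: d_def dist_norm)
  have d0: "0 \<le> d" by (simp add: d_def infdist_nonneg)
  have "\<exists>k\<in>K. norm (v - k) < d + 1 / Suc n" for n
  proof -
    have "infdist v K < d + 1 / Suc n" by (simp add: d_def)
    then have "\<exists>k\<in>K. dist v k < d + 1 / Suc n"
      unfolding infdist_notempty[OF ne] by (subst (asm) cINF_less_iff) (use ne in auto)
    then show ?thesis by (simp add: dist_norm)
  qed
  then obtain k where k: "\<And>n. k n \<in> K" "\<And>n. norm (v - k n) < d + 1 / Suc n" by metis
  \<comment> \<open>With \<delta> = 1/(N+1) the error is at most 4(2d\<delta> + \<delta>), where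
    \<delta>^2 has been bounded by \<delta>.\<close>
  have close: "(norm (k m - k n))\<^sup>2 \<le> (8 * d + 4) / Suc N" if "N \<le> m" "N \<le> n" for m n N
  proof -
    define \<delta> where "\<delta> = 1 / real (Suc N)"
    have e: "0 < \<delta>" "\<delta> \<le> 1" by (auto simp: \<delta>_def)
    have le: "(norm (v - k i))\<^sup>2 \<le> d\<^sup>2 + 2 * d * \<delta> + \<delta>" if "N \<le> i" for i
    proof -
      have "1 / real (Suc i) \<le> \<delta>" using that by (simp add: frac_le \<delta>_def)
      then have "norm (v - k i) \<le> d + \<delta>" using k(2)[of i] by linarith
      then have "(norm (v - k i))\<^sup>2 \<le> (d + \<delta>)\<^sup>2" by (intro power_mono) auto
      also have "\<dots> = d\<^sup>2 + 2 * d * \<delta> + \<delta> * \<delta>" by (simp only: power2_eq_square) (simp only: algebra_simps mult_2)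
      also have "\<delta> * \<delta> \<le> \<delta> * 1" using e by (intro mult_left_mono) auto
      finally show ?thesis by simp
    qed
    have "d \<le> norm (v - scaleC (1/2) (k m + k n))"
      by (intro d scale add k)
    also have "\<dots> = norm ((1/2) *\<^sub>R ((v - k m) + (v - k n)))"
      by (rule arg_cong[of _ _ norm])
        (simp add: scaleR_eq_scaleC[symmetric, of "1/2", simplified] algebra_simps flip: scaleR_add_left)
    also have "\<dots> = (1/2) * norm ((v - k m) + (v - k n))" by simp
    finally have "(2 * d)\<^sup>2 \<le> (norm ((v - k m) + (v - k n)))\<^sup>2"
      using d0 by (intro power_mono) auto
    moreover have "(norm ((v - k m) + (v - k n)))\<^sup>2 + (norm ((v - k n) - (v - k m)))\<^sup>2
        = 2 * (norm (v - k m))\<^sup>2 + 2 * (norm (v - k n))\<^sup>2"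
      using norm_add_square[of "v - k m" "v - k n"] norm_diff_square[of "v - k m" "v - k n"]
      by (simp add: norm_minus_commute)
    moreover have "(v - k n) - (v - k m) = k m - k n" by simp
    ultimately have "(norm (k m - k n))\<^sup>2 \<le> 2 * (norm (v - k m))\<^sup>2 + 2 * (norm (v - k n))\<^sup>2 - 4 * d\<^sup>2"
      by (simp add: power_mult_distrib)
    also have "\<dots> \<le> 4 * (2 * d * \<delta> + \<delta>)"
      using le[OF that(1)] le[OF that(2)] by (simp add: distrib_left)
    also have "\<dots> = (8 * d + 4) / Suc N" by (simp add: \<delta>_def field_simps)
    finally show ?thesis .
  qed
  have "Cauchy k"
  proof (rule metric_CauchyI)
    fix e :: real assume e: "e > 0"
    have "(\<lambda>N. (8 * d + 4) * inverse (real (Suc N))) \<longlonglongrightarrow> (8 * d + 4) * 0"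
      by (intro tendsto_intros LIMSEQ_inverse_real_of_nat)
    then have "eventually (\<lambda>N. (8 * d + 4) * inverse (real (Suc N)) < e\<^sup>2) sequentially"
      using e by (intro order_tendstoD) auto
    then obtain N where N: "(8 * d + 4) / Suc N < e\<^sup>2"
      by (auto simp: eventually_sequentially divide_inverse)
    have "dist (k m) (k n) < e" if "m \<ge> N" "n \<ge> N" for m n
      using close[OF that] N e unfolding dist_norm by (intro power2_less_imp_less[of _ e]) auto
    then show "\<exists>M. \<forall>m\<ge>M. \<forall>n\<ge>M. dist (k m) (k n) < e" by blast
  qed
  then obtain p where p: "k \<longlonglongrightarrow> p" using Cauchy_convergent convergent_def by blast
  have pK: "p \<in> K" using K(2) k(1) p closed_sequentially by blast
  have "(\<lambda>n. norm (v - k n)) \<longlonglongrightarrow> norm (v - p)" by (intro tendsto_intros p)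
  moreover have "(\<lambda>n. d + 1 / Suc n) \<longlonglongrightarrow> d + 0"
    using LIMSEQ_inverse_real_of_nat by (intro tendsto_intros) (simp add: divide_inverse)
  ultimately have "norm (v - p) \<le> d + 0"
    by (rule LIMSEQ_le) (use k(2) in \<open>auto intro: less_imp_le\<close>)
  then have min: "norm (v - p) \<le> norm (v - q)" if "q \<in> K" for q using d[OF that] by simp
  have "cinner (v - p) q = 0" if q: "q \<in> K" for q
  proof (cases "q = 0")
    case False
    define z where "z = v - p"
    \<comment> \<open>The best coefficient along \<open>q\<close>: subtracting
      \<open>scaleC c q\<close> lowers the squared norm of \<open>z\<close> by |\<langle>z,
      q\<rangle>|^2 / |q|^2, which minimality forbids unless it is 0.\<close>
    define c where "c = cinner z q / of_real ((norm q)\<^sup>2)"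
    have "norm z \<le> norm (v - (p + scaleC c q))" unfolding z_def by (intro min add scale pK q)
    also have "v - (p + scaleC c q) = z - scaleC c q" by (simp add: z_def)
    finally have "(norm z)\<^sup>2 \<le> (norm (z - scaleC c q))\<^sup>2" by simp
    moreover have "Re (cinner z (scaleC c q)) = (cmod (cinner z q))\<^sup>2 / (norm q)\<^sup>2"
    proof -
      have "cinner z (scaleC c q) = of_real ((cmod (cinner z q))\<^sup>2 / (norm q)\<^sup>2)"
        by (simp add: cinner_scaleC_right c_def mult.commute)
          (simp flip: complex_norm_square of_real_power)
      then show ?thesis by simp
    qed
    moreover have "(norm (scaleC c q))\<^sup>2 = (cmod (cinner z q))\<^sup>2 / (norm q)\<^sup>2"
      using False by (simp add: norm_scaleC c_def norm_divide power_mult_distrib power_divide norm_power)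
        (simp add: field_simps power2_eq_square power4_eq_xxxx)
    ultimately have "(cmod (cinner z q))\<^sup>2 / (norm q)\<^sup>2 \<le> 0"
      unfolding norm_diff_square by simp
    then show ?thesis using False by (simp add: divide_le_0_iff z_def)
  qed simp
  then show ?thesis using that pK by blast
qed

lemma Riesz_representation:
  fixes f :: "'h::complex_hilbert_space \<Rightarrow> complex"
  assumes add: "\<And>u v. f (u + v) = f u + f v" and scale: "\<And>c u. f (scaleC c u) = c * f u"
    and bound: "\<And>u. cmod (f u) \<le> C * norm u"
  obtains q where "\<And>u. f u = cinner u q"
proof (cases "\<forall>u. f u = 0")
  case True
  then show ?thesis using that[of 0] by simp
next
  case False
  then obtain v where v: "f v \<noteq> 0" by blast
  have "bounded_linear f"
    by (rule bounded_linear_intro[where K = C])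
      (simp_all add: add scale scaleR_eq_scaleC bound mult.commute scaleR_conv_of_real)
  then have "closed (f -` {0})"
    by (intro closed_vimage) (auto intro: bounded_linear.continuous_on)
  moreover have diff: "f (u - w) = f u - f w" for u w
    using add[of "u - w" w] by simp
  moreover have "csubspace (f -` {0})"
    using diff[of 0 0] by (auto simp: csubspace_def add scale)
  ultimately obtain p where p: "f p = 0" "\<And>k. f k = 0 \<Longrightarrow> cinner (v - p) k = 0"
    using orthogonal_projection_exists[of "f -` {0}" v] by auto
  define z where "z = v - p"
  have fz: "f z = f v" using p by (simp add: z_def diff)
  have z0: "z \<noteq> 0" using fz v diff[of 0 0] by auto
  show ?thesis
  proof (rule that[of "scaleC (cnj (f z) / of_real ((norm z)\<^sup>2)) z"])
    fix u
    \<comment> \<open>This combination lies in the kernel of \<open>f\<close>, to which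
      \<open>z\<close> is orthogonal.\<close>
    have "f (scaleC (f z) u - scaleC (f u) z) = 0" by (simp add: diff scale)
    then have "cinner z (scaleC (f z) u - scaleC (f u) z) = 0" using p(2) z_def by simp
    then have "cinner (scaleC (f z) u - scaleC (f u) z) z = 0" by (metis cinner_commute complex_cnj_zero)
    then have "f z * cinner u z = f u * of_real ((norm z)\<^sup>2)"
      by (simp add: cinner_diff_left cinner_scaleC_left cinner_self)
    then show "f u = cinner u (scaleC (cnj (f z) / of_real ((norm z)\<^sup>2)) z)"
      using z0 by (simp add: cinner_scaleC_right field_simps)
  qed
qed

lemma B_H_apply_scaleC: "T \<in> B_H \<Longrightarrow> blinfun_apply T (scaleC c v) = scaleC c (blinfun_apply T v)"
  by (simp add: B_H_def)

text \<open>Adjoints and weak limits are known only through their matrix coefficients; this turns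
  such coefficients into operators.\<close>

lemma bounded_form_operator:
  fixes B :: "'h::complex_hilbert_space \<Rightarrow> 'h \<Rightarrow> complex"
  assumes addl: "\<And>u u' v. B (u + u') v = B u v + B u' v" and scalel: "\<And>c u v. B (scaleC c u) v = c * B u v"
    and addr: "\<And>u v v'. B u (v + v') = B u v + B u v'" and scaler: "\<And>c u v. B u (scaleC c v) = cnj c * B u v"
    and bound: "\<And>u v. cmod (B u v) \<le> C * norm u * norm v"
  obtains T where "T \<in> B_H" "\<And>u v. cinner (blinfun_apply T u) v = B u v"
proof -
  have "\<exists>q. \<forall>v. cinner q v = B u v" for u
  proof -
    \<comment> \<open>The form is conjugate linear in \<open>v\<close>, so its complex conjugate is
      the functional to be represented.\<close>
    obtain q where "\<And>v. cnj (B u v) = cinner v q"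
      by (rule Riesz_representation[of "\<lambda>v. cnj (B u v)" "C * norm u"]) (auto simp: addr scaler bound)
    then have "cinner q v = B u v" for v using cinner_commute[of q v] by (metis complex_cnj_cnj)
    then show ?thesis by blast
  qed
  then obtain T where T: "\<And>u v. cinner (T u) v = B u v" by metis
  have Tadd: "T (u + v) = T u + T v" for u v
    by (rule cinner_eqI) (simp add: T addl cinner_add_left)
  have Tscale: "T (scaleC c u) = scaleC c (T u)" for c u
    by (rule cinner_eqI) (simp add: T scalel cinner_scaleC_left)
  have "norm (T u) \<le> norm u * C" for u
  proof (cases "T u = 0")
    case True
    \<comment> \<open>For \<open>u \<noteq> 0\<close> the bound at (u, u) shows that
      \<open>C\<close> is nonnegative.\<close>
    then show ?thesis
      using order_trans[OF norm_ge_zero bound[of u u]] by (cases "u = 0") (auto simp: zero_le_mult_iff)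
  next
    case False
    have "(norm (T u))\<^sup>2 = cmod (B u (T u))"
      by (simp add: T[symmetric] cinner_self norm_power)
    also have "\<dots> \<le> C * norm u * norm (T u)" by (rule bound)
    finally have "norm (T u) * norm (T u) \<le> C * norm u * norm (T u)" by (simp add: power2_eq_square)
    then show ?thesis using False by (simp add: mult.commute)
  qed
  then have bl: "bounded_linear T"
    by (intro bounded_linear_intro[where K = C]) (simp_all add: Tadd Tscale scaleR_eq_scaleC)
  show ?thesis
    by (rule that[of "Blinfun T"]) (simp_all add: B_H_def bounded_linear_Blinfun_apply[OF bl] Tscale T)
qed

lemma adjoint_exists:
  assumes "T \<in> B_H"
  obtains S where "S \<in> B_H" "is_adjoint S (T::'h::complex_hilbert_space bop)"
proof -
  obtain S where "S \<in> B_H" "\<And>u v. cinner (blinfun_apply S u) v = cinner u (T v)"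
  proof (rule bounded_form_operator[of "\<lambda>u v. cinner u (T v)" "norm T"])
    fix u v
    have "cmod (cinner u (T v)) \<le> norm u * norm (T v)" by (rule cinner_Cauchy_Schwarz)
    also have "\<dots> \<le> norm u * (norm T * norm v)" by (intro mult_left_mono norm_blinfun) simp
    finally show "cmod (cinner u (T v)) \<le> norm T * norm u * norm v" by (simp add: mult_ac)
  qed (auto simp: cinner_add_left cinner_scaleC_left cinner_add_right cinner_scaleC_right
      blinfun.add_right B_H_apply_scaleC[OF assms])
  then show ?thesis using that by (simp add: is_adjoint_def)
qed

lemma is_adjoint_sym: "is_adjoint S T \<Longrightarrow> is_adjoint T S"
  unfolding is_adjoint_def by (metis cinner_commute)

lemma B_H_compose: "S \<in> B_H \<Longrightarrow> T \<in> B_H \<Longrightarrow> S o\<^sub>L T \<in> B_H"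
  and B_H_add: "S \<in> B_H \<Longrightarrow> T \<in> B_H \<Longrightarrow> S + T \<in> B_H"
  and B_H_scaleC: "S \<in> B_H \<Longrightarrow> scaleC_op c S \<in> B_H"
  and B_H_id: "id_blinfun \<in> B_H"
  by (auto simp: B_H_def blinfun.add_left scaleC_add_right scaleC_op.rep_eq scaleC_scaleC mult.commute)

subsection \<open>Linear spans, limits on dense sets and isometric extension\<close>

inductive_set cspan :: "'h::complex_hilbert_space set \<Rightarrow> 'h set" for A where
  zero: "0 \<in> cspan A"
| gen: "v \<in> A \<Longrightarrow> v \<in> cspan A"
| add: "u \<in> cspan A \<Longrightarrow> v \<in> cspan A \<Longrightarrow> u + v \<in> cspan A"
| scale: "v \<in> cspan A \<Longrightarrow> scaleC c v \<in> cspan A"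

lemma csubspace_cspan: "csubspace (cspan A)"
  by (auto simp: csubspace_def intro: cspan.intros)

text \<open>The approximating vectors are chosen before \<open>T\<close>, so one pair serves a whole
  bounded sequence together with its limit.\<close>

lemma bounded_forms_approx:
  fixes u v :: "'h::complex_hilbert_space"
  assumes D: "closure D = UNIV" and "e > 0"
  obtains u' v' where "u' \<in> D" "v' \<in> D"
    "\<And>T. (\<And>w. norm (blinfun_apply T w) \<le> C * norm w) \<Longrightarrow> cmod (cinner (T u) v - cinner (T u') v') \<le> e"
proof -
  obtain f where f: "\<And>n. f n \<in> D" "f \<longlonglongrightarrow> u" using D closure_sequential[of u D] by auto
  obtain g where g: "\<And>n. g n \<in> D" "g \<longlonglongrightarrow> v" using D closure_sequential[of v D] by auto
  have "(\<lambda>n. C * norm (u - f n) * norm v + C * norm (f n) * norm (v - g n)) \<longlonglongrightarrow>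
      C * norm (u - u) * norm v + C * norm u * norm (v - v)"
    by (intro tendsto_intros f g)
  then have "eventually (\<lambda>n. C * norm (u - f n) * norm v + C * norm (f n) * norm (v - g n) < e) sequentially"
    using \<open>e > 0\<close> by (intro order_tendstoD) auto
  then obtain n where n: "C * norm (u - f n) * norm v + C * norm (f n) * norm (v - g n) < e"
    by (auto simp: eventually_sequentially)
  show ?thesis
  proof (rule that[OF f(1)[of n] g(1)[of n]])
    fix T :: "'h bop" assume T: "\<And>w. norm (T w) \<le> C * norm w"
    have "cinner (T u) v - cinner (T (f n)) (g n) = cinner (T (u - f n)) v + cinner (T (f n)) (v - g n)"
      by (simp add: blinfun.diff_right cinner_diff_left cinner_diff_right)
    also have "cmod \<dots> \<le> norm (T (u - f n)) * norm v + norm (T (f n)) * norm (v - g n)"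
      by (intro order_trans[OF norm_triangle_ineq] add_mono cinner_Cauchy_Schwarz)
    also have "\<dots> \<le> C * norm (u - f n) * norm v + C * norm (f n) * norm (v - g n)"
      by (intro add_mono mult_right_mono T) auto
    finally show "cmod (cinner (T u) v - cinner (T (f n)) (g n)) \<le> e" using n by linarith
  qed
qed

text \<open>Two uniform approximation errors and one Cauchy error on \<open>D\<close>, each at most
  e/4, make the coefficients at arbitrary vectors Cauchy.\<close>

lemma weak_convergent_dense:
  fixes T :: "nat \<Rightarrow> 'h::complex_hilbert_space bop"
  assumes D: "closure D = UNIV" and T: "\<And>n w. norm (T n w) \<le> C * norm w"
    and conv: "\<And>u v. u \<in> D \<Longrightarrow> v \<in> D \<Longrightarrow> convergent (\<lambda>n. cinner (T n u) v)"
  shows "convergent (\<lambda>n. cinner (T n u) v)"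
proof -
  have "Cauchy (\<lambda>n. cinner (T n u) v)"
  proof (rule metric_CauchyI)
    fix e :: real assume "e > 0"
    then have e: "e / 4 > 0" by simp
    obtain u' v' where D': "u' \<in> D" "v' \<in> D"
      and app: "\<And>S. (\<And>w. norm (blinfun_apply S w) \<le> C * norm w) \<Longrightarrow> cmod (cinner (S u) v - cinner (S u') v') \<le> e / 4"
      by (rule bounded_forms_approx[OF D e]) blast
    have "Cauchy (\<lambda>n. cinner (T n u') v')" using conv[OF D'] by (rule convergent_Cauchy)
    from metric_CauchyD[OF this e] obtain M where
      M: "\<And>m n. m \<ge> M \<Longrightarrow> n \<ge> M \<Longrightarrow> dist (cinner (T m u') v') (cinner (T n u') v') < e / 4" by blast
    have "dist (cinner (T m u) v) (cinner (T n u) v) < e" if "m \<ge> M" "n \<ge> M" for m n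
      using M[OF that] app[OF T, of m] app[OF T, of n] \<open>e > 0\<close> unfolding dist_norm[symmetric]
      by (metric)
    then show "\<exists>M. \<forall>m\<ge>M. \<forall>n\<ge>M. dist (cinner (T m u) v) (cinner (T n u) v) < e" by blast
  qed
  then show ?thesis by (rule Cauchy_convergent)
qed

lemma weak_limit_dense:
  fixes T :: "nat \<Rightarrow> 'h::complex_hilbert_space bop"
  assumes D: "closure D = UNIV" and T: "\<And>n w. norm (T n w) \<le> C * norm w" and S: "\<And>w. norm (blinfun_apply S w) \<le> C * norm w"
    and lim: "\<And>u v. u \<in> D \<Longrightarrow> v \<in> D \<Longrightarrow> (\<lambda>n. cinner (T n u) v) \<longlonglongrightarrow> cinner (blinfun_apply S u) v"
  shows "(\<lambda>n. cinner (T n u) v) \<longlonglongrightarrow> cinner (S u) v"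
proof (rule metric_LIMSEQ_I)
  fix e :: real assume "e > 0"
  then have e: "e / 4 > 0" by simp
  obtain u' v' where D': "u' \<in> D" "v' \<in> D"
    and app: "\<And>S. (\<And>w. norm (blinfun_apply S w) \<le> C * norm w) \<Longrightarrow> cmod (cinner (S u) v - cinner (S u') v') \<le> e / 4"
    by (rule bounded_forms_approx[OF D e]) blast
  obtain M where M: "\<And>n. n \<ge> M \<Longrightarrow> dist (cinner (T n u') v') (cinner (S u') v') < e / 4"
    using metric_LIMSEQ_D[OF lim[OF D'] e] by blast
  have "dist (cinner (T n u) v) (cinner (S u) v) < e" if "n \<ge> M" for n
    using M[OF that] app[OF T, of n] app[OF S] \<open>e > 0\<close> unfolding dist_norm[symmetric] by metric
  then show "\<exists>M. \<forall>n\<ge>M. dist (cinner (T n u) v) (cinner (S u) v) < e" by blast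
qed

lemma cinner_eq_dense:
  assumes D: "closure D = UNIV"
    and eq: "\<And>u v. u \<in> D \<Longrightarrow> v \<in> D \<Longrightarrow> cinner (blinfun_apply S u) v = cinner (blinfun_apply T u) (v::'h::complex_hilbert_space)"
  shows "S = T"
proof (rule blinfun_eqI, rule cinner_eqI)
  fix u v
  let ?C = "max (norm S) (norm T)"
  have le: "norm (S w) \<le> ?C * norm w" "norm (T w) \<le> ?C * norm w" for w
    using order_trans[OF norm_blinfun[of S w] mult_right_mono[of "norm S" ?C "norm w"]]
      order_trans[OF norm_blinfun[of T w] mult_right_mono[of "norm T" ?C "norm w"]] by auto
  \<comment> \<open>A constant sequence reduces the equality to
    \<open>weak_limit_dense\<close>.\<close>
  have "(\<lambda>n::nat. cinner (S u) v) \<longlonglongrightarrow> cinner (T u) v"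
    by (rule weak_limit_dense[OF D, where C = ?C]) (use le eq in auto)
  then show "cinner (S u) v = cinner (T u) v" by (simp add: LIMSEQ_const_iff)
qed

text \<open>A relation instead of a map, because g i \<mapsto> h i is not yet known to extend to a
  single-valued linear map.\<close>

inductive_set lin_graph :: "('i \<Rightarrow> 'h::complex_hilbert_space) \<Rightarrow> ('i \<Rightarrow> 'h) \<Rightarrow> 'i set \<Rightarrow> ('h \<times> 'h) set"
  for g h I where
  zero: "(0, 0) \<in> lin_graph g h I"
| gen: "i \<in> I \<Longrightarrow> (g i, h i) \<in> lin_graph g h I"
| add: "(u, u') \<in> lin_graph g h I \<Longrightarrow> (v, v') \<in> lin_graph g h I \<Longrightarrow> (u + v, u' + v') \<in> lin_graph g h I"
| scale: "(u, u') \<in> lin_graph g h I \<Longrightarrow> (scaleC c u, scaleC c u') \<in> lin_graph g h I"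

text \<open>Equal Gram matrices make inner products agree along the graph and along its closure. Two
  images of one vector then differ by an image of 0, which has norm 0; density and completeness give
  the closure full domain.\<close>

lemma isometry_extension:
  fixes g h :: "'i \<Rightarrow> 'h::complex_hilbert_space"
  assumes gh: "\<And>i j. i \<in> I \<Longrightarrow> j \<in> I \<Longrightarrow> cinner (g i) (g j) = cinner (h i) (h j)"
    and dense: "closure (cspan (g ` I)) = UNIV"
  obtains T where "T \<in> B_H" "\<And>i. i \<in> I \<Longrightarrow> T (g i) = h i"
    "\<And>u v. cinner (blinfun_apply T u) (blinfun_apply T v) = cinner u v"
proof -
  let ?G = "lin_graph g h I"
  have iso1: "cinner u (g j) = cinner u' (h j)" if "(u, u') \<in> ?G" "j \<in> I" for u u' j
    using that(1)
    by induction (auto simp: gh that(2) cinner_add_left cinner_scaleC_left)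
  have iso: "cinner u v = cinner u' v'" if "(v, v') \<in> ?G" "(u, u') \<in> ?G" for u u' v v'
    using that(1)
    by induction (auto simp: iso1 that(2) cinner_add_right cinner_scaleC_right)
  let ?C = "closure ?G"
  have seq: "p \<in> ?C \<longleftrightarrow> (\<exists>f f'. (\<forall>n. (f n, f' n) \<in> ?G) \<and> f \<longlonglongrightarrow> fst p \<and> f' \<longlonglongrightarrow> snd p)" for p
  proof
    assume "p \<in> ?C"
    then obtain s where s: "\<forall>n. s n \<in> ?G" "s \<longlonglongrightarrow> p" by (metis closure_sequential)
    then show "\<exists>f f'. (\<forall>n. (f n, f' n) \<in> ?G) \<and> f \<longlonglongrightarrow> fst p \<and> f' \<longlonglongrightarrow> snd p"
      by (intro exI[of _ "\<lambda>n. fst (s n)"] exI[of _ "\<lambda>n. snd (s n)"]) (auto intro: tendsto_intros)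
  next
    assume "\<exists>f f'. (\<forall>n. (f n, f' n) \<in> ?G) \<and> f \<longlonglongrightarrow> fst p \<and> f' \<longlonglongrightarrow> snd p"
    then obtain f f' where f: "\<forall>n. (f n, f' n) \<in> ?G" "f \<longlonglongrightarrow> fst p" "f' \<longlonglongrightarrow> snd p" by blast
    then have "(\<lambda>n. (f n, f' n)) \<longlonglongrightarrow> (fst p, snd p)" by (intro tendsto_intros)
    then show "p \<in> ?C" using f(1) by (auto simp: closure_sequential intro!: exI[of _ "\<lambda>n. (f n, f' n)"])
  qed
  have isoC: "cinner u v = cinner u' v'" if "(u, u') \<in> ?C" "(v, v') \<in> ?C" for u u' v v'
  proof -
    from that obtain f f' k k' where *: "\<forall>n. (f n, f' n) \<in> ?G" "f \<longlonglongrightarrow> u" "f' \<longlonglongrightarrow> u'"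
      "\<forall>n. (k n, k' n) \<in> ?G" "k \<longlonglongrightarrow> v" "k' \<longlonglongrightarrow> v'"
      unfolding seq by auto
    have "(\<lambda>n. cinner (f n) (k n)) \<longlonglongrightarrow> cinner u v" by (intro tendsto_intros *)
    moreover have "(\<lambda>n. cinner (f n) (k n)) = (\<lambda>n. cinner (f' n) (k' n))"
      using * iso by blast
    moreover have "(\<lambda>n. cinner (f' n) (k' n)) \<longlonglongrightarrow> cinner u' v'" by (intro tendsto_intros *)
    ultimately show ?thesis using LIMSEQ_unique by simp
  qed
  have addC: "(u + v, u' + v') \<in> ?C" if "(u, u') \<in> ?C" "(v, v') \<in> ?C" for u u' v v'
  proof -
    from that obtain f f' k k' where *: "\<forall>n. (f n, f' n) \<in> ?G" "f \<longlonglongrightarrow> u" "f' \<longlonglongrightarrow> u'"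
      "\<forall>n. (k n, k' n) \<in> ?G" "k \<longlonglongrightarrow> v" "k' \<longlonglongrightarrow> v'"
      unfolding seq by auto
    then show ?thesis unfolding seq
      by (intro exI[of _ "\<lambda>n. f n + k n"] exI[of _ "\<lambda>n. f' n + k' n"])
        (auto intro: lin_graph.add tendsto_add)
  qed
  have scaleC: "(scaleC c u, scaleC c u') \<in> ?C" if "(u, u') \<in> ?C" for c u u'
  proof -
    from that obtain f f' where *: "\<forall>n. (f n, f' n) \<in> ?G" "f \<longlonglongrightarrow> u" "f' \<longlonglongrightarrow> u'"
      unfolding seq by auto
    then show ?thesis unfolding seq
      by (intro exI[of _ "\<lambda>n. scaleC c (f n)"] exI[of _ "\<lambda>n. scaleC c (f' n)"])
        (auto intro: lin_graph.scale bounded_linear.tendsto[OF bounded_linear_scaleC])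
  qed
  have diffC: "(u - v, u' - v') \<in> ?C" if "(u, u') \<in> ?C" "(v, v') \<in> ?C" for u u' v v'
    using addC[OF that(1) scaleC[OF that(2), of "-1"]] by (simp add: scaleC_minus_one)
  have normC: "norm u' = norm u" if "(u, u') \<in> ?C" for u u'
  proof -
    have "(norm u)\<^sup>2 = (norm u')\<^sup>2"
      using isoC[OF that that] unfolding cinner_self of_real_eq_iff .
    then show ?thesis by (simp add: power2_eq_iff_nonneg)
  qed
  have uniq: "u' = u''" if "(u, u') \<in> ?C" "(u, u'') \<in> ?C" for u u' u''
    using normC[OF diffC[OF that]] by simp
  have ex: "\<exists>u'. (u, u') \<in> ?C" for u
  proof -
    have dom: "\<exists>w'. (w, w') \<in> ?G" if "w \<in> cspan (g ` I)" for w
      using that by induction (auto intro: lin_graph.intros)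
    obtain f where f: "\<And>n. f n \<in> cspan (g ` I)" "f \<longlonglongrightarrow> u"
      using dense closure_sequential[of u "cspan (g ` I)"] by auto
    have "\<exists>f'. \<forall>n. (f n, f' n) \<in> ?G" using dom[OF f(1)] by (intro choice) blast
    then obtain f' where f': "\<And>n. (f n, f' n) \<in> ?G" by blast
    have "dist (f' m) (f' n) = dist (f m) (f n)" for m n
      unfolding dist_norm using f' closure_subset by (intro normC diffC) blast+
    moreover have "Cauchy f" using f(2) by (rule LIMSEQ_imp_Cauchy)
    ultimately have "Cauchy f'" by (simp add: Cauchy_def)
    then obtain u' where "f' \<longlonglongrightarrow> u'" using Cauchy_convergent convergent_def by blast
    then have "(u, u') \<in> ?C" unfolding seq using f f' by auto
    then show ?thesis by blast
  qed
  then obtain T where T: "\<And>u. (u, T u) \<in> ?C" by metis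
  have Tadd: "T (u + v) = T u + T v" for u v using uniq[OF T addC[OF T T]] .
  have Tscale: "T (scaleC c u) = scaleC c (T u)" for c u using uniq[OF T scaleC[OF T]] .
  have bl: "bounded_linear T"
    by (rule bounded_linear_intro[where K = 1])
      (simp_all add: Tadd Tscale scaleR_eq_scaleC normC[OF T])
  show ?thesis
  proof (rule that[of "Blinfun T"])
    show "Blinfun T \<in> B_H" by (simp add: B_H_def bounded_linear_Blinfun_apply[OF bl] Tscale)
    show "Blinfun T (g i) = h i" if "i \<in> I" for i
      using uniq[OF T, of "g i" "h i"] closure_subset lin_graph.gen[OF that, of g h]
      by (auto simp: bounded_linear_Blinfun_apply[OF bl])
    show "cinner (Blinfun T u) (Blinfun T v) = cinner u v" for u v
      using isoC[OF T T] by (simp add: bounded_linear_Blinfun_apply[OF bl])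
  qed
qed

subsection \<open>The weak operator topology\<close>

lemma topspace_wot [simp]: "topspace wot = B_H"
  by (auto simp: wot_def topspace_pullback_topology PiE_UNIV_domain)

lemma continuous_map_wot_cinner: "continuous_map wot euclidean (\<lambda>T. cinner (blinfun_apply T v) w)"
proof -
  have "continuous_map wot euclidean ((\<lambda>f. f (v, w)) \<circ> (\<lambda>T (v, w). cinner (blinfun_apply T v) w))"
    unfolding wot_def by (intro continuous_map_pullback continuous_map_product_projection) simp
  then show ?thesis by (simp add: comp_def)
qed

lemma continuous_map_into_wot:
  assumes "\<And>t. t \<in> topspace X \<Longrightarrow> f t \<in> B_H"
    and "\<And>v w. continuous_map X euclidean (\<lambda>t. cinner (blinfun_apply (f t) v) w)"
  shows "continuous_map X wot f"
  unfolding wot_def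
proof (rule continuous_map_pullback')
  show "continuous_map X (product_topology (\<lambda>_. euclidean) UNIV) ((\<lambda>T (v, w). cinner (blinfun_apply T v) w) \<circ> f)"
    unfolding continuous_map_componentwise_UNIV using assms(2) by (simp add: comp_def split_beta)
qed (use assms(1) in auto)

lemma limitin_wot:
  assumes "b \<in> B_H" "eventually (\<lambda>t. f t \<in> B_H) F"
  shows "limitin wot f b F \<longleftrightarrow> (\<forall>v w. ((\<lambda>t. cinner (blinfun_apply (f t) v) w) \<longlongrightarrow> cinner (blinfun_apply b v) w) F)"
proof
  assume "limitin wot f b F"
  then show "\<forall>v w. ((\<lambda>t. cinner (f t v) w) \<longlongrightarrow> cinner (b v) w) F"
    using continuous_map_limit[OF continuous_map_wot_cinner] by (fastforce simp: comp_def)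
next
  assume *: "\<forall>v w. ((\<lambda>t. cinner (f t v) w) \<longlongrightarrow> cinner (b v) w) F"
  let ?c = "\<lambda>T (v, w). cinner (blinfun_apply T v) w"
  have lim: "limitin (product_topology (\<lambda>_. euclidean) UNIV) (\<lambda>t. ?c (f t)) (?c b) F"
    unfolding limitin_componentwise using * by (auto simp: PiE_UNIV_domain)
  show "limitin wot f b F"
    unfolding limitin_def
  proof (intro conjI allI impI)
    fix U assume "openin wot U \<and> b \<in> U"
    then obtain V where V: "openin (product_topology (\<lambda>_. euclidean) UNIV) V" "U = ?c -` V \<inter> B_H" "b \<in> U"
      unfolding wot_def openin_pullback_topology by blast
    then have "eventually (\<lambda>t. ?c (f t) \<in> V) F"
      using lim unfolding limitin_def by blast
    then show "eventually (\<lambda>t. f t \<in> U) F"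
      using assms(2) by eventually_elim (simp add: V(2))
  qed (simp add: assms)
qed

lemma wot_limit_unique:
  assumes "limitin wot f a F" "limitin wot f b F" "F \<noteq> bot"
  shows "a = b"
proof (rule blinfun_eqI, rule cinner_eqI)
  fix v w
  show "cinner (a v) w = cinner (b v) w"
    using continuous_map_limit[OF continuous_map_wot_cinner assms(1), of v w]
      continuous_map_limit[OF continuous_map_wot_cinner assms(2), of v w] tendsto_unique[OF assms(3)]
    by (simp add: comp_def)
qed

text \<open>The means of passing identities between coefficients from an algebra to its weak
  closure; with \<open>w' = 0\<close> it expresses that a coefficient vanishes.\<close>

lemma closedin_wot_cinner_eq:
  "closedin wot {T \<in> B_H. cinner (blinfun_apply T v) w = cinner (blinfun_apply T v') w'}"
proof -
  have "continuous_map wot euclidean (\<lambda>T. cinner (blinfun_apply T v) w - cinner (blinfun_apply T v') w')"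
    by (intro continuous_map_diff continuous_map_wot_cinner)
  then have "closedin wot {T \<in> topspace wot. cinner (blinfun_apply T v) w - cinner (blinfun_apply T v') w' \<in> {0}}"
    by (rule closedin_continuous_map_preimage) simp
  then show ?thesis by simp
qed

lemma continuous_map_wot_add: "S \<in> B_H \<Longrightarrow> continuous_map wot wot (\<lambda>T. S + T)"
  by (rule continuous_map_into_wot)
    (auto simp: B_H_add blinfun.add_left cinner_add_left intro!: continuous_map_add continuous_map_wot_cinner)

lemma continuous_map_wot_scaleC: "continuous_map wot wot (scaleC_op c)"
proof (rule continuous_map_into_wot)
  fix v w :: 'a
  have "continuous_map wot euclidean ((\<lambda>z. c * z) \<circ> (\<lambda>T. cinner (blinfun_apply T v) w))"
    by (rule continuous_map_compose[OF continuous_map_wot_cinner]) (auto intro!: continuous_intros)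
  then show "continuous_map wot euclidean (\<lambda>T. cinner (blinfun_apply (scaleC_op c T) v) w)"
    by (simp add: comp_def scaleC_op.rep_eq cinner_scaleC_left)
qed (simp add: B_H_scaleC)

lemma continuous_map_wot_compose_left:
  assumes "S \<in> B_H"
  shows "continuous_map wot wot (\<lambda>T. S o\<^sub>L T)"
proof -
  obtain S' where "is_adjoint S' S" using adjoint_exists[OF assms] by blast
  then have *: "cinner (S v) w = cinner v (S' w)" for v w
    using is_adjoint_sym by (metis is_adjoint_def)
  show ?thesis
    by (rule continuous_map_into_wot) (auto simp: B_H_compose assms * continuous_map_wot_cinner)
qed

lemma continuous_map_wot_compose_right:
  assumes "S \<in> B_H"
  shows "continuous_map wot wot (\<lambda>T. T o\<^sub>L S)"
  by (rule continuous_map_into_wot) (auto simp: B_H_compose assms continuous_map_wot_cinner)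

lemma continuous_map_wot_conj:
  assumes "S \<in> B_H" "R \<in> B_H"
  shows "continuous_map wot wot (\<lambda>T. S o\<^sub>L T o\<^sub>L R)"
  using continuous_map_compose[OF continuous_map_wot_compose_left[OF assms(1)]
      continuous_map_wot_compose_right[OF assms(2)]] by (simp add: comp_def)

lemma wot_closure_mapsto:
  assumes "continuous_map wot wot f" "\<And>a. a \<in> A \<Longrightarrow> f a \<in> wot closure_of B" "a \<in> wot closure_of A"
  shows "f a \<in> wot closure_of B"
proof -
  have "f a \<in> wot closure_of (f ` A)"
    using continuous_map_image_closure_subset[OF assms(1)] assms(3) by blast
  also have "\<dots> \<subseteq> wot closure_of B"
    by (rule closure_of_minimal) (use assms(2) in auto)
  finally show ?thesis .
qed

subsection \<open>The von Neumann algebra generated by selfadjoint operators\<close>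

lemma nonunital_alg_subset_B_H: "S \<subseteq> B_H \<Longrightarrow> nonunital_alg S \<subseteq> B_H"
proof
  fix a assume "S \<subseteq> B_H" "a \<in> nonunital_alg S"
  from this(2,1) show "a \<in> B_H"
    by induction (auto simp: B_H_add B_H_scaleC B_H_compose)
qed

lemma nonunital_alg_subset_vN:
  assumes "von_neumann_algebra M" "S \<subseteq> M" shows "nonunital_alg S \<subseteq> M"
proof
  fix a assume "a \<in> nonunital_alg S"
  then show "a \<in> M" using assms by induction (auto simp: von_neumann_algebra_def)
qed

lemma is_adjoint_unique: "is_adjoint S T \<Longrightarrow> is_adjoint S' T \<Longrightarrow> S = S'"
  by (rule blinfun_eqI, rule cinner_eqI) (simp add: is_adjoint_def)

lemma nonunital_alg_adjoint:
  assumes "\<And>a. a \<in> S \<Longrightarrow> selfadjoint a" "a \<in> nonunital_alg S"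
  shows "\<exists>b\<in>nonunital_alg S. is_adjoint b a"
  using assms(2)
proof induction
  case (gen a)
  then show ?case using assms(1) nonunital_alg.gen by (auto simp: selfadjoint_def)
next
  case (add a b)
  then obtain a' b' where "a' \<in> nonunital_alg S" "is_adjoint a' a" "b' \<in> nonunital_alg S" "is_adjoint b' b" by blast
  then show ?case
    by (intro bexI[of _ "a' + b'"] nonunital_alg.add)
      (auto simp: is_adjoint_def blinfun.add_left cinner_add_left cinner_add_right)
next
  case (scale a c)
  then obtain a' where "a' \<in> nonunital_alg S" "is_adjoint a' a" by blast
  then show ?case
    by (intro bexI[of _ "scaleC_op (cnj c) a'"] nonunital_alg.scale)
      (auto simp: is_adjoint_def scaleC_op.rep_eq cinner_scaleC_left cinner_scaleC_right)
next
  case (mult a b)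
  then obtain a' b' where "a' \<in> nonunital_alg S" "is_adjoint a' a" "b' \<in> nonunital_alg S" "is_adjoint b' b" by blast
  then show ?case
    by (intro bexI[of _ "b' o\<^sub>L a'"] nonunital_alg.mult) (auto simp: is_adjoint_def)
qed

text \<open>Multiplication is only separately continuous for the weak operator topology, so the
  closure is reached in one factor at a time; addition is treated in the same way.\<close>

lemma von_neumann_algebra_closure:
  assumes S: "S \<subseteq> B_H" "\<And>a. a \<in> S \<Longrightarrow> selfadjoint a"
    and unit: "id_blinfun \<in> wot closure_of nonunital_alg S"
  shows "von_neumann_algebra (wot closure_of nonunital_alg S)"
proof -
  let ?A = "nonunital_alg S" and ?C = "wot closure_of nonunital_alg S"
  have AB: "?A \<subseteq> B_H" by (rule nonunital_alg_subset_B_H[OF S(1)])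
  have AC: "?A \<subseteq> ?C" using AB by (intro closure_of_subset) simp
  have CB: "?C \<subseteq> B_H" using closure_of_subset_topspace[of wot ?A] by simp
  have add1: "a + b \<in> ?C" if "a \<in> ?A" "b \<in> ?C" for a b
    using wot_closure_mapsto[OF continuous_map_wot_add[of a], of ?A ?A b] that AB AC
    by (auto intro: nonunital_alg.add)
  have add: "a + b \<in> ?C" if "a \<in> ?C" "b \<in> ?C" for a b
    using wot_closure_mapsto[OF continuous_map_wot_add[of b], of ?A ?A a] that add1 CB
    by (auto simp: add.commute)
  have mult1: "a o\<^sub>L b \<in> ?C" if "a \<in> ?A" "b \<in> ?C" for a b
    using wot_closure_mapsto[OF continuous_map_wot_compose_left[of a], of ?A ?A b] that AB AC
    by (auto intro: nonunital_alg.mult)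
  have mult: "a o\<^sub>L b \<in> ?C" if "a \<in> ?C" "b \<in> ?C" for a b
    using wot_closure_mapsto[OF continuous_map_wot_compose_right[of b], of ?A ?A a] that mult1 CB by auto
  have scale: "scaleC_op c a \<in> ?C" if "a \<in> ?C" for a c
    using wot_closure_mapsto[OF continuous_map_wot_scaleC[of c], of ?A ?A a] that AC by (auto intro: nonunital_alg.scale)
  have "\<forall>T. \<exists>T'. T \<in> B_H \<longrightarrow> T' \<in> B_H \<and> is_adjoint T' (T::'a bop)" using adjoint_exists by metis
  then obtain adj where adj: "\<And>T. T \<in> B_H \<Longrightarrow> adj T \<in> B_H" "\<And>T. T \<in> B_H \<Longrightarrow> is_adjoint (adj T) (T::'a bop)"
    by metis
  \<comment> \<open>Taking adjoints conjugates each coefficient and exchanges its two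
    vectors.\<close>
  have "continuous_map wot wot adj"
  proof (rule continuous_map_into_wot)
    fix v w :: 'a
    have "continuous_map wot euclidean (\<lambda>T. cnj (cinner (blinfun_apply T w) v))"
      using continuous_map_compose[OF continuous_map_wot_cinner, of euclidean cnj w v]
      by (simp add: comp_def continuous_on_cnj)
    moreover have "cinner (adj T v) w = cnj (cinner (T w) v)" if "T \<in> B_H" for T
      using adj(2)[OF that] by (metis is_adjoint_def cinner_commute)
    ultimately show "continuous_map wot euclidean (\<lambda>T. cinner (blinfun_apply (adj T) v) w)"
      by (auto intro: continuous_map_eq)
  qed (simp add: adj)
  moreover have "adj a \<in> ?C" if "a \<in> ?A" for a
    using nonunital_alg_adjoint[OF S(2) that] adj(2)[of a] that AB AC is_adjoint_unique by blast
  ultimately have "adj a \<in> ?C" if "a \<in> ?C" for a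
    using wot_closure_mapsto[of adj ?A ?A a] that by blast
  then have "\<exists>b\<in>?C. is_adjoint b a" if "a \<in> ?C" for a
    using adj(2)[of a] that CB by blast
  then show ?thesis
    using CB unit add scale mult unfolding von_neumann_algebra_def by simp
qed

subsection \<open>Least upper bounds and normality of compressions\<close>

lemma selfadjoint_quadratic_real: "selfadjoint a \<Longrightarrow> cinner (blinfun_apply a v) v = of_real (Re (cinner (blinfun_apply a v) v))"
  unfolding selfadjoint_def is_adjoint_def using cinner_commute
  by (metis complex_is_Real_iff Reals_cnj_iff of_real_Re)

lemma positive_op_diff_iff:
  assumes "selfadjoint a" "selfadjoint b"
  shows "positive_op (a - b) \<longleftrightarrow> (\<forall>v. Re (cinner (blinfun_apply b v) v) \<le> Re (cinner (blinfun_apply a v) v))"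
proof -
  have "Im (cinner (a v) v) = 0" "Im (cinner (b v) v) = 0" for v
    using selfadjoint_quadratic_real[OF assms(1), of v] selfadjoint_quadratic_real[OF assms(2), of v]
    by (metis Im_complex_of_real)+
  then show ?thesis
    by (simp add: positive_op_def complex_nonneg_Reals_iff blinfun.diff_left cinner_diff_left)
qed

lemma cinner_polarization:
  assumes "T \<in> B_H"
  defines "q \<equiv> \<lambda>w. cinner (blinfun_apply T w) w"
  shows "cinner (T u) v = (q (u + v) - q (u - v) + \<i> * q (u + scaleC \<i> v) - \<i> * q (u - scaleC \<i> v)) / 4"
  by (simp add: q_def blinfun.add_right blinfun.diff_right B_H_apply_scaleC[OF assms(1)]
      cinner_add_left cinner_add_right cinner_diff_left cinner_diff_right cinner_scaleC_left cinner_scaleC_right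
      algebra_simps)

text \<open>Scaling both vectors to norm 1 separates the variables; the 4 is (1 + 1)^2.\<close>

lemma sesquilinear_bounded:
  fixes B :: "'h::complex_hilbert_space \<Rightarrow> 'h \<Rightarrow> complex"
  assumes scalel: "\<And>c u v. B (scaleC c u) v = c * B u v" and scaler: "\<And>c u v. B u (scaleC c v) = cnj c * B u v"
    and bound: "\<And>u v. cmod (B u v) \<le> C * (norm u + norm v)\<^sup>2"
  shows "cmod (B u v) \<le> 4 * C * norm u * norm v"
proof (cases "u = 0 \<or> v = 0")
  case True
  have "B 0 v = 0" "B u 0 = 0" using scalel[of 0 0 v] scaler[of u 0 0] by auto
  then show ?thesis using True by auto
next
  case False
  let ?u = "scaleC (of_real (1 / norm u)) u" and ?v = "scaleC (of_real (1 / norm v)) v"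
  have n: "norm ?u = 1" "norm ?v = 1" using False by (simp_all add: norm_scaleC norm_divide)
  have "B u v = of_real (norm u * norm v) * B ?u ?v"
    using False by (simp add: scalel scaler)
  then have "cmod (B u v) = norm u * norm v * cmod (B ?u ?v)" by (simp add: norm_mult)
  also have "\<dots> \<le> norm u * norm v * (C * (1 + 1)\<^sup>2)"
    using bound[of ?u ?v] unfolding n by (intro mult_left_mono) auto
  finally show ?thesis by (simp add: algebra_simps)
qed

text \<open>A least upper bound is compared only with selfadjoint elements of \<open>M\<close>, so
  it is not obviously the pointwise supremum of the quadratic forms. That supremum is the form of
  the weak limit of \<open>D\<close>, which belongs to \<open>M\<close> because \<open>M\<close> is
  weakly closed; being an upper bound, this limit dominates \<open>s\<close>.\<close>

lemma lub_quadratic_form: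
  fixes M :: "'h::complex_hilbert_space bop set"
  assumes M: "von_neumann_algebra M" and D: "directed_in M D" and s: "is_lub_in M D s" and "e > 0"
  shows "\<exists>d\<in>D. Re (cinner (s v) v) - e < Re (cinner (blinfun_apply d v) v)"
proof -
  have sa: "selfadjoint d" "d \<in> M" "d \<in> B_H" if "d \<in> D" for d
    using that D M by (auto simp: directed_in_def von_neumann_algebra_def)
  define q where "q d w = Re (cinner (blinfun_apply d w) w)" for d and w :: 'h
  have ssa: "selfadjoint s" "s \<in> M" using s by (auto simp: is_lub_in_def)
  have qs: "q d w \<le> q s w" if "d \<in> D" for d w
    using s that positive_op_diff_iff[OF ssa(1) sa(1)[OF that]] by (auto simp: is_lub_in_def q_def)
  obtain d0 where d0: "d0 \<in> D" using D by (auto simp: directed_in_def)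
  define L where "L w = (SUP d\<in>D. q d w)" for w
  have bdd: "bdd_above ((\<lambda>d. q d w) ` D)" for w using qs by (auto intro!: bdd_aboveI2)
  \<comment> \<open>The filter of tails of the directed set, with the order expressed by quadratic
    forms.\<close>
  define F where "F = (INF d\<in>D. principal {f \<in> D. \<forall>w. q d w \<le> q f w})"
  have evF: "eventually P F \<longleftrightarrow> (\<exists>d\<in>D. \<forall>f\<in>D. (\<forall>w. q d w \<le> q f w) \<longrightarrow> P f)" for P
  proof -
    have "\<exists>f\<in>D. principal {g \<in> D. \<forall>w. q f w \<le> q g w}
        \<le> inf (principal {g \<in> D. \<forall>w. q d w \<le> q g w}) (principal {g \<in> D. \<forall>w. q d' w \<le> q g w})"
      if dd: "d \<in> D" "d' \<in> D" for d d'
    proof -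
      obtain f where f: "f \<in> D" "positive_op (f - d)" "positive_op (f - d')"
        using D dd unfolding directed_in_def by blast
      then have "q d w \<le> q f w" "q d' w \<le> q f w" for w
        using positive_op_diff_iff sa dd by (auto simp: q_def)
      then show ?thesis using f(1) by (intro bexI[of _ f]) (auto intro: order_trans)
    qed
    then show ?thesis
      unfolding F_def using d0
      by (subst eventually_INF_base) (blast, blast, simp add: eventually_principal, blast)
  qed
  have Fbot: "F \<noteq> bot" unfolding trivial_limit_def evF by blast
  have FD: "eventually (\<lambda>d. d \<in> D) F" unfolding evF using d0 by blast
  have limq: "((\<lambda>d. q d w) \<longlongrightarrow> L w) F" for w
  proof (rule order_tendstoI)
    fix a assume "a < L w"
    then obtain d where d: "d \<in> D" "a < q d w"
      unfolding L_def using less_cSUP_iff[OF _ bdd] d0 by blast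
    then show "eventually (\<lambda>f. a < q f w) F" unfolding evF by (meson less_le_trans)
  next
    fix a assume a: "L w < a"
    have "q f w < a" if "f \<in> D" for f
      using cSUP_upper[OF that bdd, of w] a by (simp add: L_def)
    then show "eventually (\<lambda>f. q f w < a) F" unfolding evF using d0 by blast
  qed
  have Ls: "L w \<le> q s w" for w unfolding L_def using d0 qs by (intro cSUP_least) auto
  have limc: "((\<lambda>d. cinner (blinfun_apply d w) w) \<longlongrightarrow> of_real (L w)) F" for w
    using tendsto_of_real[OF limq, of w, where 'a = complex]
    by (rule Lim_transform_eventually)
      (use FD in \<open>eventually_elim; simp add: q_def flip: selfadjoint_quadratic_real[OF sa(1)]\<close>)
  \<comment> \<open>The polarization of \<open>L\<close>, the only candidate for the coefficients of
    the limit.\<close>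
  define B where "B u v = (of_real (L (u + v)) - of_real (L (u - v))
      + \<i> * of_real (L (u + scaleC \<i> v)) - \<i> * of_real (L (u - scaleC \<i> v))) / 4" for u v
  have limB: "((\<lambda>d. cinner (blinfun_apply d u) v) \<longlongrightarrow> B u v) F" for u v
  proof -
    have "((\<lambda>d. (cinner (blinfun_apply d (u + v)) (u + v) - cinner (blinfun_apply d (u - v)) (u - v)
      + \<i> * cinner (blinfun_apply d (u + scaleC \<i> v)) (u + scaleC \<i> v)
      - \<i> * cinner (blinfun_apply d (u - scaleC \<i> v)) (u - scaleC \<i> v)) / 4) \<longlongrightarrow> B u v) F"
      unfolding B_def by (intro tendsto_intros limc) simp
    then show ?thesis
      by (rule Lim_transform_eventually)
        (use FD in \<open>eventually_elim; simp flip: cinner_polarization[OF sa(3)]\<close>)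
  qed
  \<comment> \<open>\<open>L\<close> lies between the quadratic forms of \<open>d0\<close> and
    \<open>s\<close>.\<close>
  define c where "c = norm d0 + norm s"
  have Lb: "\<bar>L w\<bar> \<le> c * (norm w)\<^sup>2" for w
  proof -
    have b: "\<bar>q T w\<bar> \<le> norm T * (norm w)\<^sup>2" for T
    proof -
      have "\<bar>q T w\<bar> \<le> cmod (cinner (T w) w)" by (simp add: q_def abs_Re_le_cmod)
      also have "\<dots> \<le> norm (T w) * norm w" by (rule cinner_Cauchy_Schwarz)
      also have "\<dots> \<le> norm T * norm w * norm w" by (intro mult_right_mono norm_blinfun) simp
      finally show ?thesis by (simp add: power2_eq_square mult.assoc)
    qed
    have "q d0 w \<le> L w" unfolding L_def by (rule cSUP_upper[OF d0 bdd])
    moreover have "0 \<le> norm d0 * (norm w)\<^sup>2" "0 \<le> norm s * (norm w)\<^sup>2" by auto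
    ultimately show ?thesis
      using Ls[of w] b[of d0] b[of s] unfolding c_def distrib_right by linarith
  qed
  have c0: "0 \<le> c" by (simp add: c_def)
  have Bb: "cmod (B u v) \<le> c * (norm u + norm v)\<^sup>2" for u v
  proof -
    have Lw: "\<bar>L w\<bar> \<le> c * (norm u + norm v)\<^sup>2" if "norm w \<le> norm u + norm v" for w
      using order_trans[OF Lb[of w] mult_left_mono[OF power_mono[OF that] c0]] by simp
    have iv: "norm (scaleC \<i> v) = norm v" by (simp add: norm_scaleC)
    have "cmod (B u v) \<le> (\<bar>L (u + v)\<bar> + \<bar>L (u - v)\<bar> + \<bar>L (u + scaleC \<i> v)\<bar> + \<bar>L (u - scaleC \<i> v)\<bar>) / 4"
      unfolding B_def norm_divide
      by (simp add: norm_mult divide_right_mono)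
        (intro norm_triangle_le norm_triangle_le_diff order_trans[OF norm_triangle_ineq4] add_mono order_trans[OF norm_triangle_ineq]; simp add: norm_mult)
    also have "\<dots> \<le> c * (norm u + norm v)\<^sup>2"
      using Lw[OF norm_triangle_ineq] Lw[OF norm_triangle_ineq4]
        Lw[OF order_trans[OF norm_triangle_ineq], of u "scaleC \<i> v"]
        Lw[OF order_trans[OF norm_triangle_ineq4], of u "scaleC \<i> v"] iv by simp
    finally show ?thesis .
  qed
  have Badd: "B (u + u') v = B u v + B u' v" "B v (u + u') = B v u + B v u'" for u u' v
    using tendsto_unique[OF Fbot limB[of "u + u'" v]] tendsto_unique[OF Fbot limB[of v "u + u'"]]
      tendsto_add[OF limB[of u v] limB[of u' v]] tendsto_add[OF limB[of v u] limB[of v u']]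
    by (simp_all add: blinfun.add_right cinner_add_left cinner_add_right)
  have Bscaler: "B u (scaleC a v) = cnj a * B u v" for a u v
    using tendsto_unique[OF Fbot limB[of u "scaleC a v"]] tendsto_mult_left[OF limB[of u v], of "cnj a"]
    by (simp add: cinner_scaleC_right)
  have Bscalel: "B (scaleC a u) v = a * B u v" for a u v
  proof -
    have "((\<lambda>d. cinner (blinfun_apply d (scaleC a u)) v) \<longlongrightarrow> a * B u v) F"
      using tendsto_mult_left[OF limB[of u v], of a]
      by (rule Lim_transform_eventually)
        (use FD in \<open>eventually_elim; simp add: B_H_apply_scaleC[OF sa(3)] cinner_scaleC_left\<close>)
    then show ?thesis using tendsto_unique[OF Fbot limB] by blast
  qed
  obtain T where T: "T \<in> B_H" "\<And>u v. cinner (blinfun_apply T u) v = B u v"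
    using bounded_form_operator[of B, OF Badd(1) Bscalel Badd(2) Bscaler sesquilinear_bounded[OF Bscalel Bscaler Bb]]
    by blast
  have limT: "limitin wot (\<lambda>d. d) T F"
    using limB T FD sa(3) by (subst limitin_wot) (auto elim: eventually_mono)
  have TM: "T \<in> M"
    by (rule limitin_closedin[OF limT _ _ Fbot])
      (use M FD sa(2) in \<open>auto simp: von_neumann_algebra_def elim: eventually_mono\<close>)
  have qT: "cinner (T w) w = of_real (L w)" for w
    using tendsto_unique[OF Fbot limB limc] by (simp add: T)
  have Tsa: "selfadjoint T"
    unfolding selfadjoint_def is_adjoint_def
  proof (intro allI)
    fix v w
    have "((\<lambda>d. cnj (cinner (blinfun_apply d w) v)) \<longlongrightarrow> cnj (B w v)) F"
      by (intro tendsto_intros limB)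
    then have "((\<lambda>d. cinner (blinfun_apply d v) w) \<longlongrightarrow> cnj (B w v)) F"
      by (rule Lim_transform_eventually)
        (use FD in \<open>eventually_elim; use sa(1) cinner_commute in \<open>metis selfadjoint_def is_adjoint_def\<close>\<close>)
    then show "cinner (T v) w = cinner v (T w)"
      using tendsto_unique[OF Fbot limB] by (metis T(2) cinner_commute)
  qed
  have "positive_op (T - d)" if "d \<in> D" for d
    unfolding positive_op_diff_iff[OF Tsa sa(1)[OF that]] qT
    using cSUP_upper[OF that bdd] by (simp add: L_def q_def)
  then have "positive_op (T - s)" using s TM Tsa by (auto simp: is_lub_in_def)
  then have "q s v \<le> L v"
    unfolding positive_op_diff_iff[OF Tsa ssa(1)] qT by (simp add: q_def)
  then have "q s v - e < L v" using \<open>e > 0\<close> by simp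
  then show ?thesis
    unfolding L_def using less_cSUP_iff[OF _ bdd] d0 by (auto simp: q_def)
qed

text \<open>The quadratic form of the image at \<open>v\<close> is that of \<open>a\<close> at
  \<open>R v\<close>, so \<open>lub_quadratic_form\<close> applies there. The lemma serves both the
  shift and the compression.\<close>

lemma normal_map_conj:
  fixes M :: "'h::complex_hilbert_space bop set"
  assumes M: "von_neumann_algebra M" and R: "R' \<in> B_H" "is_adjoint R' R"
    and maps: "\<And>a. a \<in> M \<Longrightarrow> R' o\<^sub>L a o\<^sub>L R \<in> M"
  shows "normal_map M (\<lambda>a. R' o\<^sub>L a o\<^sub>L R)"
proof -
  let ?E = "\<lambda>a. R' o\<^sub>L a o\<^sub>L R"
  have quad: "cinner (?E a v) w = cinner (a (R v)) (R w)" for a v w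
    using R(2) by (simp add: is_adjoint_def)
  have sa: "selfadjoint (?E a)" if "selfadjoint a" for a
    using that R(2) is_adjoint_sym[OF R(2)] by (simp add: selfadjoint_def is_adjoint_def)
  have pos: "positive_op (?E a)" if "positive_op a" for a
    using that by (simp add: positive_op_def quad del: blinfun_apply_blinfun_compose)
  have diff: "?E a - ?E b = ?E (a - b)" for a b
    by (rule blinfun_eqI) (simp add: blinfun.diff_left blinfun.diff_right)
  have lub: "is_lub_in M (?E ` D) (?E s)" if D: "directed_in M D" "is_lub_in M D s" for D s
    unfolding is_lub_in_def
  proof (intro conjI ballI impI)
    have s: "s \<in> M" "selfadjoint s" using D(2) by (auto simp: is_lub_in_def)
    show "?E s \<in> M" "selfadjoint (?E s)" using s maps sa by auto
    show "positive_op (?E s - d)" if d: "d \<in> ?E ` D" for d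
    proof -
      obtain a where "a \<in> D" "d = ?E a" using d by blast
      then show ?thesis using D(2) pos[of "s - a"] by (simp add: is_lub_in_def diff)
    qed
    fix t assume t: "t \<in> M" "selfadjoint t \<and> (\<forall>d\<in>?E ` D. positive_op (t - d))"
    show "positive_op (t - ?E s)"
      unfolding positive_op_diff_iff[OF conjunct1[OF t(2)] sa[OF s(2)]]
    proof
      fix v
      show "Re (cinner (?E s v) v) \<le> Re (cinner (t v) v)"
      proof (rule field_le_epsilon)
        fix e :: real assume "e > 0"
        from lub_quadratic_form[OF M D this, of "R v"] obtain d where
          d: "d \<in> D" "Re (cinner (s (R v)) (R v)) - e < Re (cinner (d (R v)) (R v))" by blast
        have "selfadjoint d" using D(1) d(1) by (auto simp: directed_in_def)
        then have "Re (cinner (?E d v) v) \<le> Re (cinner (t v) v)"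
          using t d(1) positive_op_diff_iff[of t "?E d"] sa by blast
        then show "Re (cinner (?E s v) v) \<le> Re (cinner (t v) v) + e"
          using d(2) unfolding quad by linarith
      qed
    qed
  qed
  have "?E (a + b) = ?E a + ?E b" "?E (scaleC_op c a) = scaleC_op c (?E a)" for a b c
    by (rule blinfun_eqI; simp add: blinfun.add_left blinfun.add_right scaleC_op.rep_eq B_H_apply_scaleC[OF R(1)])+
  then show ?thesis
    unfolding normal_map_def using maps pos lub by blast
qed

subsection \<open>Words in a spreadable sequence\<close>

lemma word_op_Nil [simp]: "word_op y [] = id_blinfun"
  and word_op_Cons: "word_op y (i # w) = y i o\<^sub>L word_op y w"
  by (simp_all add: word_op_def)

lemma word_op_append: "word_op y (v @ w) = word_op y v o\<^sub>L word_op y w"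
  by (induction v) (auto simp: word_op_Cons intro: blinfun_eqI)

text \<open>Induction over this span has no product case, as needed for identities that are linear
  but not multiplicative in the operator.\<close>

inductive_set word_span :: "(int \<Rightarrow> 'h::complex_hilbert_space bop) \<Rightarrow> int set \<Rightarrow> 'h bop set" for x I where
  word: "w \<noteq> [] \<Longrightarrow> set w \<subseteq> I \<Longrightarrow> word_op x w \<in> word_span x I"
| add: "a \<in> word_span x I \<Longrightarrow> b \<in> word_span x I \<Longrightarrow> a + b \<in> word_span x I"
| scale: "a \<in> word_span x I \<Longrightarrow> scaleC_op c a \<in> word_span x I"

lemma nonunital_alg_subset_word_span:
  assumes x: "\<And>i. x i \<in> B_H"
  shows "nonunital_alg (x ` I) \<subseteq> word_span x I"
proof
  have wB: "word_op x w \<in> B_H" for w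
    by (induction w) (auto simp: word_op_Cons B_H_id intro: B_H_compose x)
  have spB: "a \<in> B_H" if "a \<in> word_span x I" for a
    using that by induction (auto simp: wB B_H_add B_H_scaleC)
  have m1: "word_op x v o\<^sub>L b \<in> word_span x I" if "b \<in> word_span x I" "v \<noteq> []" "set v \<subseteq> I" for v b
    using that(1)
  proof induction
    case (word w)
    then show ?case using that word_span.word[of "v @ w" I x] by (simp add: word_op_append)
  next
    case (add a b)
    have "word_op x v o\<^sub>L (a + b) = (word_op x v o\<^sub>L a) + (word_op x v o\<^sub>L b)"
      by (rule blinfun_eqI) (simp add: blinfun.add_left blinfun.add_right)
    then show ?case using add by (simp add: word_span.add)
  next
    case (scale a c)
    have "word_op x v o\<^sub>L scaleC_op c a = scaleC_op c (word_op x v o\<^sub>L a)"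
      by (rule blinfun_eqI) (simp add: scaleC_op.rep_eq B_H_apply_scaleC[OF wB])
    then show ?case using scale by (simp add: word_span.scale)
  qed
  have m2: "a o\<^sub>L b \<in> word_span x I" if "a \<in> word_span x I" "b \<in> word_span x I" for a b
    using that(1)
  proof induction
    case (word w)
    then show ?case using m1 that(2) by blast
  next
    case (add a a')
    have "(a + a') o\<^sub>L b = (a o\<^sub>L b) + (a' o\<^sub>L b)"
      by (rule blinfun_eqI) (simp add: blinfun.add_left)
    then show ?case using add by (simp add: word_span.add)
  next
    case (scale a c)
    have "scaleC_op c a o\<^sub>L b = scaleC_op c (a o\<^sub>L b)"
      by (rule blinfun_eqI) (simp add: scaleC_op.rep_eq)
    then show ?case using scale by (simp add: word_span.scale)
  qed
  fix a assume "a \<in> nonunital_alg (x ` I)"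
  then show "a \<in> word_span x I"
  proof induction
    case (gen a)
    then obtain i where "i \<in> I" "a = x i" by blast
    then show ?case using word_span.word[of "[i]" I x]
      by (simp add: word_op_Cons) (metis blinfun_eqI blinfun_apply_blinfun_compose blinfun_apply_id_blinfun)
  qed (auto intro: word_span.intros m2)
qed

lemma word_op_in_nonunital_alg: "w \<noteq> [] \<Longrightarrow> set w \<subseteq> I \<Longrightarrow> word_op x w \<in> nonunital_alg (x ` I)"
proof (induction w)
  case (Cons i w)
  show ?case
  proof (cases "w = []")
    case True
    have "x i o\<^sub>L id_blinfun = x i" by (rule blinfun_eqI) simp
    then show ?thesis using True Cons by (simp add: word_op_Cons nonunital_alg.gen)
  next
    case False
    then show ?thesis using Cons by (simp add: word_op_Cons nonunital_alg.gen nonunital_alg.mult)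
  qed
qed simp

section \<open>Word vectors in the GNS space\<close>

locale spreadable_gns =
  fixes M :: "'h::complex_hilbert_space bop set"
    and \<phi> :: "'h bop \<Rightarrow> complex"
    and \<xi> :: 'h
    and x :: "int \<Rightarrow> 'h bop"
  assumes vN: "von_neumann_algebra M"
    and gns: "gns_identified M \<phi> \<xi>"
    and xM: "\<And>i. x i \<in> M"
    and x_sa: "\<And>i. selfadjoint (x i)"
    and generated: "M = vN_generated (range x)"
    and unit: "id_blinfun \<in> wot closure_of nonunital_alg (range x)"
    and spreadable: "boolean_spreadable \<phi> x"
begin

abbreviation X where "X \<equiv> word_op x"

definition vec :: "int list \<Rightarrow> 'h" where
  "vec w = X w \<xi>"

definition shift :: "int \<Rightarrow> int list \<Rightarrow> int list" where
  "shift l = map (\<lambda>i. i + l)"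

lemma M_B_H: "M \<subseteq> B_H" and M_id: "id_blinfun \<in> M" and M_mult: "a \<in> M \<Longrightarrow> b \<in> M \<Longrightarrow> a o\<^sub>L b \<in> M"
  and M_closed: "closedin wot M"
  using vN by (auto simp: von_neumann_algebra_def)

lemma x_B_H: "x i \<in> B_H"
  using M_B_H xM by blast

lemma X_M: "X w \<in> M"
  by (induction w) (simp_all add: word_op_Cons M_id M_mult xM)

lemma X_B_H: "X w \<in> B_H"
  using X_M M_B_H by blast

lemma X_adjoint: "cinner (X w u) v = cinner u (X (rev w) v)"
proof (induction w arbitrary: u v)
  case (Cons i w)
  then show ?case using x_sa[of i] by (simp add: word_op_Cons word_op_append selfadjoint_def is_adjoint_def)
qed simp

lemma phi_M: "a \<in> M \<Longrightarrow> \<phi> a = cinner (a \<xi>) \<xi>"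
  using gns by (simp add: gns_identified_def)

lemma vec_append: "vec (v @ w) = X v (vec w)"
  by (simp add: vec_def word_op_append)

lemma cinner_vec: "a \<in> M \<Longrightarrow> cinner (a (vec w)) (vec v) = \<phi> (X (rev v) o\<^sub>L a o\<^sub>L X w)"
  using X_adjoint[of "rev v"] by (simp add: vec_def phi_M M_mult X_M)

lemma cinner_X_vec: "cinner (X b (vec w)) (vec v) = \<phi> (X (rev v @ b @ w))"
proof -
  have "X (rev v) o\<^sub>L X b o\<^sub>L X w = X (rev v @ b @ w)"
    by (rule blinfun_eqI) (simp add: word_op_append)
  then show ?thesis by (simp add: cinner_vec[OF X_M])
qed

lemma cinner_vec_vec: "cinner (vec w) (vec v) = \<phi> (X (rev v @ w))"
  using cinner_X_vec[of "[]" w v] by simp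

lemma shift_append [simp]: "shift l (v @ w) = shift l v @ shift l w"
  and shift_rev: "shift l (rev w) = rev (shift l w)"
  and shift_Nil_iff [simp]: "shift l w = [] \<longleftrightarrow> w = []"
  and shift_shift [simp]: "shift l (shift l' w) = shift (l' + l) w"
  and shift_0 [simp]: "shift 0 w = w"
  and set_shift: "set (shift l w) = (\<lambda>i. i + l) ` set w"
  by (auto simp: shift_def rev_map)

lemma moment_shift: "\<phi> (X (shift l w)) = \<phi> (X w)"
  unfolding shift_def
  by (rule boolean_spreadable_strict_mono[OF spreadable]) (auto simp: strict_mono_on_def)

text \<open>The hypothesis on the unit makes the weak closure of the nonunital algebra a von Neumann
  algebra, so it contains the generated one.\<close>

lemma M_eq_closure: "M = wot closure_of nonunital_alg (range x)"
proof
  have "range x \<subseteq> nonunital_alg (range x)" by (auto intro: nonunital_alg.gen)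
  also have "\<dots> \<subseteq> wot closure_of nonunital_alg (range x)"
    using nonunital_alg_subset_B_H[of "range x"] x_B_H by (intro closure_of_subset) auto
  finally show "M \<subseteq> wot closure_of nonunital_alg (range x)"
    using von_neumann_algebra_closure[of "range x"] x_B_H x_sa unit
    unfolding generated vN_generated_def by blast
  show "wot closure_of nonunital_alg (range x) \<subseteq> M"
    using nonunital_alg_subset_vN[OF vN, of "range x"] xM M_closed by (intro closure_of_minimal) auto
qed

text \<open>The vector \<open>\<xi>\<close> of the empty word is left out, because the decoupling
  identity is stated for nonempty words.\<close>

definition D :: "'h set" where
  "D = cspan (vec ` {w. w \<noteq> []})"

lemma D_induct [consumes 1, case_names vec zero add scale]:
  assumes "u \<in> D" "\<And>w. w \<noteq> [] \<Longrightarrow> P (vec w)" "P 0" "\<And>u v. P u \<Longrightarrow> P v \<Longrightarrow> P (u + v)" "\<And>c u. P u \<Longrightarrow> P (scaleC c u)"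
  shows "P u"
  using assms(1) unfolding D_def by induction (use assms(2-) in auto)

lemma vec_D: "w \<noteq> [] \<Longrightarrow> vec w \<in> D"
  by (auto simp: D_def intro: cspan.gen)

text \<open>The component of \<open>\<xi>\<close> orthogonal to the nonunital algebra orbit is annihilated by
  the nonunital algebra, hence by the unit.\<close>

lemma D_dense: "closure D = UNIV"
proof -
  let ?A = "nonunital_alg (range x)" and ?K = "closure D"
  have D: "csubspace D" unfolding D_def by (rule csubspace_cspan)
  have K: "csubspace ?K" by (rule csubspace_closure[OF D])
  have Dadd: "u + v \<in> D" "scaleC c u \<in> D" if "u \<in> D" "v \<in> D" for u v c using D that by (auto simp: csubspace_def)
  have inv: "a u \<in> D" if "a \<in> ?A" "u \<in> D" for a u
    using that
  proof (induction arbitrary: u)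
    case (gen a)
    then obtain i where a: "a = x i" by blast
    have "x i u \<in> D" using gen(2)
    proof (induction rule: D_induct)
      case (vec w)
      then show ?case using vec_D[of "i # w"] by (simp add: vec_def word_op_Cons)
    next
      case zero
      then show ?case using D by (simp add: csubspace_def)
    qed (auto simp: blinfun.add_right B_H_apply_scaleC[OF x_B_H] Dadd)
    then show ?case by (simp add: a)
  qed (auto simp: blinfun.add_left scaleC_op.rep_eq Dadd)
  have inv\<xi>: "a \<xi> \<in> D" if "a \<in> ?A" for a
    using that
  proof induction
    case (gen a)
    then obtain i where "a = x i" by blast
    then show ?case using vec_D[of "[i]"] by (simp add: vec_def word_op_Cons)
  qed (auto simp: blinfun.add_left scaleC_op.rep_eq Dadd inv)
  have invK: "a u \<in> ?K" if a: "a \<in> ?A" and u: "u \<in> ?K" for a u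
  proof -
    obtain f where f: "\<And>n. f n \<in> D" "f \<longlonglongrightarrow> u" using u unfolding closure_sequential by blast
    have "(\<lambda>n. a (f n)) \<longlonglongrightarrow> a u" by (intro tendsto_intros f)
    then show ?thesis using inv[OF a f(1)] unfolding closure_sequential by (intro exI[of _ "\<lambda>n. a (f n)"]) auto
  qed
  have \<xi>K: "\<xi> \<in> ?K"
  proof -
    obtain p where p: "p \<in> ?K" "\<And>k. k \<in> ?K \<Longrightarrow> cinner (\<xi> - p) k = 0"
      by (rule orthogonal_projection_exists[OF K closed_closure, where v = "\<xi>"]) blast
    define \<eta> where "\<eta> = \<xi> - p"
    have "cinner (a \<eta>) \<eta> = 0" if "a \<in> ?A" for a
    proof -
      have "a \<xi> \<in> ?K" using inv\<xi>[OF that] closure_subset by blast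
      moreover have "a p \<in> ?K" by (rule invK[OF that p(1)])
      ultimately have "cinner \<eta> (a \<xi>) = 0" "cinner \<eta> (a p) = 0" using p(2) by (auto simp: \<eta>_def)
      then have "cinner \<eta> (a \<eta>) = 0" by (simp add: \<eta>_def blinfun.diff_right cinner_diff_right)
      then show ?thesis by (metis cinner_commute complex_cnj_zero)
    qed
    then have "?A \<subseteq> {T \<in> B_H. cinner (T \<eta>) \<eta> = cinner (T \<eta>) 0}"
      using nonunital_alg_subset_B_H[of "range x"] x_B_H by auto
    then have "wot closure_of ?A \<subseteq> {T \<in> B_H. cinner (T \<eta>) \<eta> = cinner (T \<eta>) 0}"
      by (rule closure_of_minimal[OF _ closedin_wot_cinner_eq])
    then have "\<eta> = 0" using unit by auto
    then show ?thesis using p(1) by (simp add: \<eta>_def)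
  qed
  \<comment> \<open>Pairing with the component of \<open>a \<xi>\<close> orthogonal to
    \<open>?K\<close> vanishes on the nonunital algebra, hence on its weak closure \<open>M\<close>,
    and so at \<open>a\<close> itself.\<close>
  have "a \<xi> \<in> ?K" if "a \<in> M" for a
  proof -
    obtain p where p: "p \<in> ?K" "\<And>k. k \<in> ?K \<Longrightarrow> cinner (a \<xi> - p) k = 0"
      by (rule orthogonal_projection_exists[OF K closed_closure, where v = "a \<xi>"]) blast
    define \<eta> where "\<eta> = a \<xi> - p"
    have "cinner (b \<xi>) \<eta> = 0" if "b \<in> ?A" for b
      using p(2)[of "b \<xi>"] inv\<xi>[OF that] closure_subset[of D] by (metis \<eta>_def cinner_commute complex_cnj_zero subsetD)
    then have "?A \<subseteq> {T \<in> B_H. cinner (T \<xi>) \<eta> = cinner (T \<xi>) 0}"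
      using nonunital_alg_subset_B_H[of "range x"] x_B_H by auto
    then have "wot closure_of ?A \<subseteq> {T \<in> B_H. cinner (T \<xi>) \<eta> = cinner (T \<xi>) 0}"
      by (rule closure_of_minimal[OF _ closedin_wot_cinner_eq])
    then have "cinner (a \<xi>) \<eta> = 0" using that M_eq_closure by auto
    moreover have "cinner p \<eta> = 0" using p by (metis \<eta>_def cinner_commute complex_cnj_zero)
    ultimately have "cinner \<eta> \<eta> = 0" by (simp add: \<eta>_def cinner_diff_left)
    then show ?thesis using p(1) by (simp add: \<eta>_def)
  qed
  then have "closure ((\<lambda>a. blinfun_apply a \<xi>) ` M) \<subseteq> ?K"
    by (intro closure_minimal) auto
  then show ?thesis using gns by (auto simp: gns_identified_def)
qed

lemma B_H_eqI:
  assumes "S \<in> B_H" "T \<in> B_H"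
    and eq: "\<And>v w. v \<noteq> [] \<Longrightarrow> w \<noteq> [] \<Longrightarrow> cinner (S (vec w)) (vec v) = cinner (T (vec w)) (vec v)"
  shows "S = T"
proof (rule cinner_eq_dense[OF D_dense])
  have 1: "cinner (S u) (vec v) = cinner (T u) (vec v)" if "u \<in> D" "v \<noteq> []" for u v
    using that(1)
    by (induction rule: D_induct) (auto simp: eq that(2) blinfun.add_right cinner_add_left cinner_scaleC_left
        B_H_apply_scaleC assms)
  show "cinner (S u) v = cinner (T u) v" if "u \<in> D" "v \<in> D" for u v
    using that(2) by (induction rule: D_induct) (auto simp: 1 that(1) cinner_add_right cinner_scaleC_right)
qed

subsection \<open>The unitary group of the shift\<close>

text \<open>The Gram matrix of the word vectors consists of moments, and moments are invariant under
  translation.\<close>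

lemma shift_isometry_exists:
  "\<exists>W. W \<in> B_H \<and> (\<forall>w. w \<noteq> [] \<longrightarrow> W (vec w) = vec (shift l w))
     \<and> (\<forall>u v. cinner (blinfun_apply W u) (blinfun_apply W v) = cinner u v)"
proof -
  obtain W where "W \<in> B_H" "\<And>w. w \<in> {w. w \<noteq> []} \<Longrightarrow> W (vec w) = vec (shift l w)"
    "\<And>u v. cinner (blinfun_apply W u) (blinfun_apply W v) = cinner u v"
  proof (rule isometry_extension[of "{w. w \<noteq> []}" vec "\<lambda>w. vec (shift l w)"])
    show "cinner (vec i) (vec j) = cinner (vec (shift l i)) (vec (shift l j))" for i j
      using moment_shift[of l "rev j @ i"] by (simp add: cinner_vec_vec shift_rev)
    show "closure (cspan (vec ` {w. w \<noteq> []})) = UNIV" using D_dense by (simp add: D_def)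
  qed blast
  then show ?thesis by blast
qed

definition W :: "int \<Rightarrow> 'h bop" where
  "W l = (SOME W. W \<in> B_H \<and> (\<forall>w. w \<noteq> [] \<longrightarrow> W (vec w) = vec (shift l w))
     \<and> (\<forall>u v. cinner (blinfun_apply W u) (blinfun_apply W v) = cinner u v))"

lemma W_B_H: "W l \<in> B_H" and W_vec: "w \<noteq> [] \<Longrightarrow> W l (vec w) = vec (shift l w)"
  and W_isometry: "cinner (W l u) (W l v) = cinner u v"
  using someI_ex[OF shift_isometry_exists[of l]] by (auto simp: W_def)

lemma W_compose: "W l o\<^sub>L W m = W (l + m)"
  by (rule B_H_eqI) (auto simp: W_B_H B_H_compose W_vec add.commute)

lemma W_0: "W 0 = id_blinfun"
  by (rule B_H_eqI) (auto simp: W_B_H B_H_id W_vec)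

lemma W_W: "W l (W m u) = W (l + m) u"
  by (metis W_compose blinfun_apply_blinfun_compose)

lemma W_adjoint: "cinner (W l u) v = cinner u (W (- l) v)"
proof -
  have "v = W l (W (- l) v)" by (simp add: W_W W_0)
  then show ?thesis using W_isometry by metis
qed

text \<open>Since \<open>\<xi>\<close> is not one of the vectors on which \<open>W\<close> is
  prescribed, it is tested against the dense set \<open>D\<close>, where the claim is the invariance
  of moments.\<close>

lemma W_xi: "W l \<xi> = \<xi>"
proof -
  have "cinner u (W l \<xi> - \<xi>) = 0" if "u \<in> D" for u
    using that
  proof (induction rule: D_induct)
    case (vec w)
    have "cinner (vec w) (W l \<xi>) = cinner (W (- l) (vec w)) \<xi>" by (simp add: W_adjoint)
    also have "\<dots> = cinner (vec w) \<xi>"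
      using vec moment_shift[of "- l" w] phi_M[OF X_M] by (simp add: W_vec) (simp add: vec_def)
    finally show ?case by (simp add: cinner_diff_right)
  qed (auto simp: cinner_add_left cinner_scaleC_left)
  moreover obtain f where "\<And>n. f n \<in> D" "f \<longlonglongrightarrow> W l \<xi> - \<xi>"
    using D_dense closure_sequential[of "W l \<xi> - \<xi>" D] by auto
  ultimately have "(\<lambda>n. 0) \<longlonglongrightarrow> cinner (W l \<xi> - \<xi>) (W l \<xi> - \<xi>)"
    using tendsto_cinner[of f "W l \<xi> - \<xi>" sequentially "\<lambda>_. W l \<xi> - \<xi>" "W l \<xi> - \<xi>"] by simp
  then show ?thesis by (simp add: LIMSEQ_const_iff)
qed

definition conj_W :: "int \<Rightarrow> 'h bop \<Rightarrow> 'h bop" where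
  "conj_W l a = W l o\<^sub>L a o\<^sub>L W (- l)"

lemma conj_W_B_H: "a \<in> B_H \<Longrightarrow> conj_W l a \<in> B_H"
  by (simp add: conj_W_def B_H_compose W_B_H)

text \<open>Shifting a word vector back, prepending \<open>w\<close> and shifting forward amounts to
  prepending the shifted word.\<close>

lemma conj_W_X: "conj_W l (X w) = X (shift l w)"
proof (rule B_H_eqI)
  fix u v :: "int list" assume "u \<noteq> []"
  then have "conj_W l (X w) (vec u) = X (shift l w) (vec u)"
    by (simp add: conj_W_def W_vec flip: vec_append)
  then show "cinner (conj_W l (X w) (vec u)) (vec v) = cinner (X (shift l w) (vec u)) (vec v)" by simp
qed (simp_all add: conj_W_B_H X_B_H)

lemma conj_W_conj_W: "conj_W l (conj_W m a) = conj_W (l + m) a"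
  by (rule blinfun_eqI) (simp add: conj_W_def W_W minus_diff_commute)

lemma conj_W_0: "conj_W 0 a = a"
  by (rule blinfun_eqI) (simp add: conj_W_def W_0)

lemma conj_W_add: "conj_W l (a + b) = conj_W l a + conj_W l b"
  by (rule blinfun_eqI) (simp add: conj_W_def blinfun.add_left blinfun.add_right)

lemma conj_W_scaleC: "conj_W l (scaleC_op c a) = scaleC_op c (conj_W l a)"
  by (rule blinfun_eqI) (simp add: conj_W_def scaleC_op.rep_eq B_H_apply_scaleC[OF W_B_H])

lemma conj_W_closure:
  assumes "a \<in> wot closure_of nonunital_alg (x ` I)"
  shows "conj_W l a \<in> wot closure_of nonunital_alg (x ` (\<lambda>i. i + l) ` I)"
proof (rule wot_closure_mapsto[OF _ _ assms])
  show "continuous_map wot wot (conj_W l)"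
    unfolding conj_W_def by (rule continuous_map_wot_conj[OF W_B_H W_B_H])
  fix a assume "a \<in> nonunital_alg (x ` I)"
  then have "a \<in> word_span x I" using nonunital_alg_subset_word_span[of x I] x_B_H by blast
  then have "conj_W l a \<in> nonunital_alg (x ` (\<lambda>i. i + l) ` I)"
  proof induction
    case (word w)
    then show ?case unfolding conj_W_X by (intro word_op_in_nonunital_alg) (auto simp: set_shift)
  qed (auto simp: conj_W_add conj_W_scaleC intro: nonunital_alg.intros)
  then show "conj_W l a \<in> wot closure_of nonunital_alg (x ` (\<lambda>i. i + l) ` I)"
    using closure_of_subset[of "nonunital_alg (x ` (\<lambda>i. i + l) ` I)" wot]
      nonunital_alg_subset_B_H[of "x ` (\<lambda>i. i + l) ` I"] x_B_H by auto
qed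

lemma conj_W_M: "a \<in> M \<Longrightarrow> conj_W l a \<in> M"
  using conj_W_closure[of a UNIV l] M_eq_closure by (simp add: surj_plus_right)

lemma is_shift_conj_W: "is_shift M \<phi> x (conj_W 1)"
  unfolding is_shift_def
proof (intro conjI ballI allI impI)
  show "bij_betw (conj_W 1) M M"
    by (rule bij_betw_byWitness[where f' = "conj_W (- 1)"]) (auto simp: conj_W_conj_W conj_W_0 conj_W_M)
  have "is_adjoint (W 1) (W (- 1))" by (simp add: is_adjoint_def W_adjoint)
  then have "normal_map M (\<lambda>a. W 1 o\<^sub>L a o\<^sub>L W (- 1))"
    using conj_W_M by (intro normal_map_conj[OF vN W_B_H]) (auto simp: conj_W_def)
  then show "normal_map M (conj_W 1)" by (simp add: conj_W_def[abs_def])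
  show "conj_W 1 (a o\<^sub>L b) = conj_W 1 a o\<^sub>L conj_W 1 b" for a b
    by (rule blinfun_eqI) (simp add: conj_W_def W_W W_0)
  show "is_adjoint (conj_W 1 b) (conj_W 1 a)" if "is_adjoint b a" for a b
    using that by (simp add: is_adjoint_def conj_W_def W_adjoint)
  show "\<phi> (conj_W 1 a) = \<phi> a" if "a \<in> M" for a
    using that by (simp add: phi_M conj_W_M) (simp add: conj_W_def W_xi W_adjoint)
  show "conj_W 1 (x i) = x (i + 1)" for i
  proof -
    have "X [j] = x j" for j by (rule blinfun_eqI) (simp add: word_op_Cons)
    then show ?thesis using conj_W_X[of 1 "[i]"] by (simp add: shift_def)
  qed
qed

text \<open>\<open>shift_aut\<close> is an arbitrary choice among shifts. The coefficients of
  \<open>\<beta> a\<close> between word vectors are moments, and multiplicativity and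
  \<open>\<phi>\<close>-invariance pull them back by one step, as conjugation by \<open>W 1\<close>
  does.\<close>

lemma is_shift_unique:
  assumes \<beta>: "is_shift M \<phi> x \<beta>" and a: "a \<in> M"
  shows "\<beta> a = conj_W 1 a"
proof (rule B_H_eqI)
  have \<beta>M: "\<beta> b \<in> M" if "b \<in> M" for b
    using \<beta> that by (auto simp: is_shift_def normal_map_def)
  then show "\<beta> a \<in> B_H" "conj_W 1 a \<in> B_H" using a M_B_H conj_W_B_H by auto
  have mult: "\<beta> (b o\<^sub>L c) = \<beta> b o\<^sub>L \<beta> c" if "b \<in> M" "c \<in> M" for b c
    using \<beta> that by (auto simp: is_shift_def)
  have \<beta>x: "\<beta> (x i) = x (i + 1)" for i using \<beta> by (auto simp: is_shift_def)
  have \<beta>X: "\<beta> (X w) = X (shift 1 w)" if "w \<noteq> []" for w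
    using that
  proof (induction w)
    case (Cons i w)
    show ?case
    proof (cases "w = []")
      case True
      have "X [j] = x j" for j by (rule blinfun_eqI) (simp add: word_op_Cons)
      then show ?thesis using True \<beta>x[of i] by (simp add: shift_def)
    next
      case False
      then show ?thesis using Cons by (simp add: word_op_Cons mult xM X_M \<beta>x shift_def)
    qed
  qed simp
  fix v w :: "int list" assume vw: "v \<noteq> []" "w \<noteq> []"
  \<comment> \<open>Shifted back, so that \<open>\<beta>\<close> maps their words to those of
    \<open>v\<close> and \<open>w\<close>.\<close>
  let ?v = "shift (-1) v" and ?w = "shift (-1) w"
  have "cinner (\<beta> a (vec w)) (vec v) = \<phi> (\<beta> (X (rev ?v) o\<^sub>L a o\<^sub>L X ?w))"
    using vw by (simp add: cinner_vec \<beta>M a mult M_mult X_M \<beta>X shift_rev flip: shift_rev)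
  also have "\<dots> = \<phi> (X (rev ?v) o\<^sub>L a o\<^sub>L X ?w)"
    using \<beta> a M_mult X_M unfolding is_shift_def by blast
  also have "\<dots> = cinner (a (W (-1) (vec w))) (W (-1) (vec v))"
    using vw by (simp add: W_vec cinner_vec[OF a])
  also have "\<dots> = cinner (conj_W 1 a (vec w)) (vec v)" by (simp add: conj_W_def W_adjoint)
  finally show "cinner (\<beta> a (vec w)) (vec v) = cinner (conj_W 1 a (vec w)) (vec v)" .
qed

lemma shift_aut_eq: "a \<in> M \<Longrightarrow> shift_aut M \<phi> x a = conj_W 1 a"
  unfolding shift_aut_def by (rule is_shift_unique[OF someI[of "is_shift M \<phi> x", OF is_shift_conj_W]])

lemma shift_aut_funpow: "a \<in> M \<Longrightarrow> (shift_aut M \<phi> x ^^ l) a = conj_W (int l) a"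
proof (induction l)
  case (Suc l)
  then show ?case by (simp add: shift_aut_eq conj_W_M conj_W_conj_W add.commute)
qed (simp add: conj_W_0)

lemma inv_shift_aut_eq:
  assumes "a \<in> M" shows "inv_into M (shift_aut M \<phi> x) a = conj_W (- 1) a"
proof (rule inv_into_f_eq)
  show "inj_on (shift_aut M \<phi> x) M"
    by (rule inj_on_inverseI[where g = "conj_W (- 1)"]) (simp add: shift_aut_eq conj_W_conj_W conj_W_0)
  show "conj_W (- 1) a \<in> M" "shift_aut M \<phi> x (conj_W (- 1) a) = a"
    using assms by (simp_all add: conj_W_M shift_aut_eq conj_W_conj_W conj_W_0)
qed

lemma inv_shift_aut_funpow: "a \<in> M \<Longrightarrow> (inv_into M (shift_aut M \<phi> x) ^^ l) a = conj_W (- int l) a"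
proof (induction l)
  case (Suc l)
  then show ?case by (simp add: inv_shift_aut_eq conj_W_M conj_W_conj_W)
qed (simp add: conj_W_0)

subsection \<open>The weak limit of the shift\<close>

text \<open>Once the shifted letters of \<open>w\<close> lie above all letters of \<open>v\<close>,
  one further step is a strictly increasing relabelling of the joint word.\<close>

lemma W_vec_convergent:
  assumes "v \<noteq> []" "w \<noteq> []"
  shows "convergent (\<lambda>n. cinner (W (int n) (vec w)) (vec v))"
proof -
  define c where "c = Max (set v)"
  \<comment> \<open>After \<open>n0\<close> steps even the smallest letter of \<open>w\<close>
    exceeds \<open>c\<close>.\<close>
  define n0 where "n0 = nat (c - Min (set w) + 1)"
  have v: "t \<le> c" if "t \<in> set v" for t using that by (simp add: c_def)
  have w: "c < t + int n" if "t \<in> set w" "n0 \<le> n" for t n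
  proof -
    have "Min (set w) \<le> t" using that by simp
    then show ?thesis using that(2) unfolding n0_def by linarith
  qed
  have step: "cinner (W (int (Suc n)) (vec w)) (vec v) = cinner (W (int n) (vec w)) (vec v)" if "n0 \<le> n" for n
  proof -
    let ?f = "\<lambda>t. if t \<le> c then t else t + 1"
    have "map ?f (rev v @ shift (int n) w) = rev v @ shift (int (Suc n)) w"
      using v w[OF _ that] by (auto simp: shift_def intro!: map_idI) force
    moreover have "strict_mono_on (set (rev v @ shift (int n) w)) ?f" by (auto simp: strict_mono_on_def)
    ultimately show ?thesis
      using boolean_spreadable_strict_mono[OF spreadable, of "rev v @ shift (int n) w" ?f] assms
      by (simp add: W_vec cinner_vec_vec)
  qed
  have "cinner (W (int (n + n0)) (vec w)) (vec v) = cinner (W (int n0) (vec w)) (vec v)" for n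
  proof (induction n)
    case (Suc n)
    then show ?case using step[of "n + n0"] by simp
  qed simp
  then have "convergent (\<lambda>n. cinner (W (int (n + n0)) (vec w)) (vec v))" by (simp add: convergent_const)
  then show ?thesis by (subst (asm) convergent_ignore_initial_segment)
qed

lemma norm_W: "norm (W l u) = norm u"
proof -
  have "(norm (W l u))\<^sup>2 = (norm u)\<^sup>2"
    using W_isometry[of l u u] unfolding cinner_self of_real_eq_iff .
  then show ?thesis by (simp add: power2_eq_iff_nonneg)
qed

lemma W_convergent: "convergent (\<lambda>n. cinner (W (int n) u) v)"
proof (rule weak_convergent_dense[OF D_dense, where C = 1 and T = "\<lambda>n. W (int n)"])
  have 1: "convergent (\<lambda>n. cinner (W (int n) u) (vec v))" if "u \<in> D" "v \<noteq> []" for u v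
    using that(1)
    by (induction rule: D_induct) (auto simp: W_vec_convergent that(2) blinfun.add_right cinner_add_left
        cinner_scaleC_left B_H_apply_scaleC[OF W_B_H] convergent_const intro: convergent_add convergent_mult)
  show "convergent (\<lambda>n. cinner (W (int n) u) v)" if "u \<in> D" "v \<in> D" for u v
    using that(2)
    by (induction rule: D_induct) (auto simp: 1 that(1) cinner_add_right cinner_scaleC_right
        convergent_const intro: convergent_add convergent_mult)
qed (simp add: norm_W)

lemma Q_exists: "\<exists>Q\<in>B_H. \<forall>u v. (\<lambda>n. cinner (W (int n) u) v) \<longlonglongrightarrow> cinner (blinfun_apply Q u) v"
proof -
  define B where "B u v = lim (\<lambda>n. cinner (W (int n) u) v)" for u v
  have B: "(\<lambda>n. cinner (W (int n) u) v) \<longlonglongrightarrow> B u v" for u v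
    unfolding B_def using W_convergent convergent_LIMSEQ_iff by blast
  obtain Q where "Q \<in> B_H" "\<And>u v. cinner (blinfun_apply Q u) v = B u v"
  proof (rule bounded_form_operator[of B 1])
    show "B (u + u') v = B u v + B u' v" for u u' v
      using LIMSEQ_unique[OF B[of "u + u'" v]] tendsto_add[OF B[of u v] B[of u' v]]
      by (simp add: blinfun.add_right cinner_add_left)
    show "B (scaleC c u) v = c * B u v" for c u v
      using LIMSEQ_unique[OF B[of "scaleC c u" v]] tendsto_mult_left[OF B[of u v], of c]
      by (simp add: B_H_apply_scaleC[OF W_B_H] cinner_scaleC_left)
    show "B u (v + v') = B u v + B u v'" for u v v'
      using LIMSEQ_unique[OF B[of u "v + v'"]] tendsto_add[OF B[of u v] B[of u v']]
      by (simp add: cinner_add_right)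
    show "B u (scaleC c v) = cnj c * B u v" for c u v
      using LIMSEQ_unique[OF B[of u "scaleC c v"]] tendsto_mult_left[OF B[of u v], of "cnj c"]
      by (simp add: cinner_scaleC_right)
    show "cmod (B u v) \<le> 1 * norm u * norm v" for u v
      using tendsto_norm[OF B[of u v]]
      by (rule LIMSEQ_le_const2) (use cinner_Cauchy_Schwarz[of "W _ u" v] in \<open>auto simp: norm_W\<close>)
  qed blast
  then show ?thesis using B by (intro bexI[of _ Q]) auto
qed

definition Q :: "'h bop" where
  "Q = (SOME Q. Q \<in> B_H \<and> (\<forall>u v. (\<lambda>n. cinner (W (int n) u) v) \<longlonglongrightarrow> cinner (blinfun_apply Q u) v))"

lemma Q_B_H: "Q \<in> B_H" and Q_lim: "(\<lambda>n. cinner (W (int n) u) v) \<longlonglongrightarrow> cinner (Q u) v"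
  using someI_ex[OF Q_exists[unfolded Bex_def]] by (auto simp: Q_def)

text \<open>Delaying a sequence by one step does not change its limit; this gives the step -1, and
  the group law gives all others.\<close>

lemma W_Q: "W l (Q u) = Q u"
proof -
  have one: "W (- 1) (Q u) = Q u" for u
  proof (rule cinner_eqI)
    fix v
    have "(\<lambda>n. cinner (W (int (Suc n)) u) (W 1 v)) \<longlonglongrightarrow> cinner (Q u) (W 1 v)"
      by (rule LIMSEQ_Suc[OF Q_lim])
    moreover have "cinner (W (int (Suc n)) u) (W 1 v) = cinner (W (int n) u) v" for n
      using W_isometry[of 1 "W (int n) u" v] by (simp add: W_W add.commute)
    ultimately have "cinner (Q u) (W 1 v) = cinner (Q u) v" using LIMSEQ_unique[OF Q_lim] by simp
    then show "cinner (W (- 1) (Q u)) v = cinner (Q u) v" by (simp add: W_adjoint)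
  qed
  have neg: "W (- int n) (Q u) = Q u" for n
  proof (induction n)
    case (Suc n)
    have "W (- int (Suc n)) (Q u) = W (- 1) (W (- int n) (Q u))" by (simp add: W_W)
    then show ?case using Suc one by simp
  qed (simp add: W_0)
  show ?thesis
  proof (cases "l \<ge> 0")
    case True
    have "W l (Q u) = W l (W (- l) (Q u))" using neg[of "nat l"] True by simp
    then show ?thesis by (simp add: W_W W_0)
  next
    case False
    then show ?thesis using neg[of "nat (- l)"] by simp
  qed
qed

text \<open>Vectors \<open>Q v\<close> are fixed by the shift, so \<langle>W n u, Q v\<rangle> is
  constant in n and equals its limit \<langle>Q u, Q v\<rangle>. That expression is hermitian in u
  and v.\<close>

lemma Q_selfadjoint: "cinner (Q u) v = cinner u (Q v)"
proof -
  have *: "cinner (Q u) (Q v) = cinner u (Q v)" for u v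
  proof -
    have "cinner (W (int n) u) (Q v) = cinner u (Q v)" for n by (simp add: W_adjoint W_Q)
    then show ?thesis using Q_lim[of u "Q v"] by (simp add: LIMSEQ_const_iff)
  qed
  have "cinner (Q u) v = cinner (Q u) (Q v)" by (metis * cinner_commute)
  then show ?thesis using * by simp
qed

lemma Q_W: "Q (W l u) = Q u"
  by (rule cinner_eqI) (simp add: Q_selfadjoint W_adjoint W_Q)

text \<open>The adjoint of \<open>W n\<close> is \<open>W (- n)\<close>, while \<open>Q\<close> is
  its own adjoint. The sign \<open>\<epsilon>\<close> allows both directions to be treated by one
  argument from here on.\<close>

lemma Q_lim_sign:
  assumes "\<epsilon> \<in> {1, - 1}"
  shows "(\<lambda>n. cinner (W (\<epsilon> * int n) u) v) \<longlonglongrightarrow> cinner (Q u) v"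
proof (cases "\<epsilon> = 1")
  case False
  have "(\<lambda>n. cnj (cinner (W (int n) v) u)) \<longlonglongrightarrow> cnj (cinner (Q v) u)"
    by (intro tendsto_intros Q_lim)
  moreover have "cnj (cinner (Q v) u) = cinner (Q u) v" by (metis Q_selfadjoint cinner_commute)
  moreover have "cnj (cinner (W (int n) v) u) = cinner (W (- int n) u) v" for n
    by (metis W_adjoint cinner_commute)
  ultimately show ?thesis using False assms by simp
qed (simp add: Q_lim)

lemma Q_lim_sign_right:
  assumes "\<epsilon> \<in> {1, - 1}"
  shows "(\<lambda>n. cinner u (W (\<epsilon> * int n) v)) \<longlonglongrightarrow> cinner u (Q v)"
  using Q_lim_sign[of "- \<epsilon>" u v] assms by (auto simp: W_adjoint Q_selfadjoint)

lemma X_Q_lim_sign: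
  assumes "\<epsilon> \<in> {1, - 1}"
  shows "(\<lambda>n. cinner (X b (W (\<epsilon> * int n) u)) v) \<longlonglongrightarrow> cinner (X b (Q u)) v"
  unfolding X_adjoint by (rule Q_lim_sign[OF assms])

subsection \<open>Decoupling\<close>

text \<open>The left-hand side does not change when both \<open>v\<close> and \<open>w\<close> move away from \<open>b\<close>, and
  twice its value is the sum of the two terms in which only one of them moves. Letting
  first this one and then the other one escape to infinity yields the right-hand side twice.\<close>

lemma word_compression:
  assumes \<epsilon>: "\<epsilon> \<in> {1, - 1}" and ne: "v \<noteq> []" "b \<noteq> []" "w \<noteq> []"
    and sep: "\<forall>t\<in>set b. \<forall>r\<in>set v \<union> set w. \<epsilon> * r < \<epsilon> * t"
  shows "cinner (X b (vec w)) (vec v) = cinner (X b (Q (vec w))) (Q (vec v))"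
proof -
  \<comment> \<open>The letters of \<open>v\<close> and \<open>w\<close> lie on the side of
    \<open>b\<close> towards which t \<mapsto> t - \<epsilon> d moves them, so the order of all
    letters is preserved.\<close>
  have mono: "strict_mono_on (set (rev v @ b @ w)) (\<lambda>t. if t \<in> set b then t else t - \<epsilon> * int d)"
    and fixb: "map (\<lambda>t. if t \<in> set b then t else t - \<epsilon> * int d) b = b"
    and move: "set u \<subseteq> set v \<union> set w \<Longrightarrow> map (\<lambda>t. if t \<in> set b then t else t - \<epsilon> * int d) u = shift (- \<epsilon> * int d) u"
    if sep: "\<forall>t\<in>set b. \<forall>r\<in>set v \<union> set w. \<epsilon> * r < \<epsilon> * t" for d u v w
  proof -
    have disj: "t \<notin> set b" if "t \<in> set v \<union> set w" for t using sep that by blast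
    show "strict_mono_on (set (rev v @ b @ w)) (\<lambda>t. if t \<in> set b then t else t - \<epsilon> * int d)"
    proof (rule strict_mono_onI)
      fix r s assume rs: "r \<in> set (rev v @ b @ w)" "s \<in> set (rev v @ b @ w)" "r < s"
      show "(if r \<in> set b then r else r - \<epsilon> * int d) < (if s \<in> set b then s else s - \<epsilon> * int d)"
        using rs sep[rule_format, of r s] sep[rule_format, of s r] \<epsilon> by auto
    qed
    show "map (\<lambda>t. if t \<in> set b then t else t - \<epsilon> * int d) b = b" by (rule map_idI) simp
    show "map (\<lambda>t. if t \<in> set b then t else t - \<epsilon> * int d) u = shift (- \<epsilon> * int d) u"
      if "set u \<subseteq> set v \<union> set w" using that disj by (auto simp: shift_def)
  qed
  have neg: "- \<epsilon> \<in> {1, - 1}" using \<epsilon> by auto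
  \<comment> \<open>Stated for arbitrary \<open>v\<close> and \<open>w\<close>, because it is used
    again for their shifts.\<close>
  have half: "2 * cinner (X b (vec w)) (vec v)
      = cinner (X b (vec w)) (Q (vec v)) + cinner (X b (Q (vec w))) (vec v)"
    if ne: "v \<noteq> []" "w \<noteq> []"
      and sep: "\<forall>t\<in>set b. \<forall>r\<in>set v \<union> set w. \<epsilon> * r < \<epsilon> * t" for v w
  proof -
    have "2 * cinner (X b (vec w)) (vec v) = cinner (X b (vec w)) (W (- \<epsilon> * int d) (vec v))
        + cinner (X b (W (- \<epsilon> * int d) (vec w))) (vec v)" for d
    proof -
      let ?f = "\<lambda>t. if t \<in> set b then t else t - \<epsilon> * int d"
      have "set b \<inter> (set (rev v) \<union> set w) = {}" using sep by fastforce
      then have "2 * \<phi> (X (rev v @ b @ w)) = \<phi> (X (map ?f (rev v) @ b @ w)) + \<phi> (X (rev v @ b @ map ?f w))"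
        using ne \<open>b \<noteq> []\<close> by (intro boolean_spreadable_decouple[OF spreadable mono[OF sep]]) auto
      then show ?thesis
        using ne move[OF sep, of "rev v" d] move[OF sep, of w d]
        by (simp add: W_vec cinner_X_vec shift_rev)
    qed
    moreover have "(\<lambda>d. cinner (X b (vec w)) (W (- \<epsilon> * int d) (vec v)) + cinner (X b (W (- \<epsilon> * int d) (vec w))) (vec v))
        \<longlonglongrightarrow> cinner (X b (vec w)) (Q (vec v)) + cinner (X b (Q (vec w))) (vec v)"
      by (intro tendsto_add X_Q_lim_sign[OF neg] Q_lim_sign_right[OF neg])
    ultimately show ?thesis by (simp add: LIMSEQ_const_iff)
  qed
  have const: "cinner (X b (W (- \<epsilon> * int d) (vec w))) (W (- \<epsilon> * int d) (vec v)) = cinner (X b (vec w)) (vec v)" for d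
    using boolean_spreadable_strict_mono[OF spreadable mono[OF sep, of d]] ne fixb[OF sep, of d]
      move[OF sep, of "rev v" d] move[OF sep, of w d]
    by (simp add: W_vec cinner_X_vec shift_rev)
  \<comment> \<open>\<open>half\<close> for the shifted words: \<open>Q\<close> absorbs the shift in
    one vector of each term, and the other shift is still free to go to infinity.\<close>
  have eq: "2 * cinner (X b (vec w)) (vec v)
      = cinner (X b (W (- \<epsilon> * int d) (vec w))) (Q (vec v)) + cinner (X b (Q (vec w))) (W (- \<epsilon> * int d) (vec v))" for d
  proof -
    have "\<forall>t\<in>set b. \<forall>r\<in>set (shift (- \<epsilon> * int d) v) \<union> set (shift (- \<epsilon> * int d) w). \<epsilon> * r < \<epsilon> * t"
    proof (intro ballI)
      fix t r assume t: "t \<in> set b" and "r \<in> set (shift (- \<epsilon> * int d) v) \<union> set (shift (- \<epsilon> * int d) w)"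
      then obtain r' where "r' \<in> set v \<union> set w" "r = r' - \<epsilon> * int d" by (auto simp: set_shift)
      then show "\<epsilon> * r < \<epsilon> * t" using sep[rule_format, OF t, of r'] \<epsilon> by auto
    qed
    from half[OF _ _ this] have "2 * cinner (X b (W (- \<epsilon> * int d) (vec w))) (W (- \<epsilon> * int d) (vec v))
      = cinner (X b (W (- \<epsilon> * int d) (vec w))) (Q (W (- \<epsilon> * int d) (vec v)))
        + cinner (X b (Q (W (- \<epsilon> * int d) (vec w)))) (W (- \<epsilon> * int d) (vec v))"
      using ne by (simp add: W_vec)
    then show ?thesis unfolding const Q_W .
  qed
  have "(\<lambda>d. cinner (X b (W (- \<epsilon> * int d) (vec w))) (Q (vec v)) + cinner (X b (Q (vec w))) (W (- \<epsilon> * int d) (vec v)))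
      \<longlonglongrightarrow> cinner (X b (Q (vec w))) (Q (vec v)) + cinner (X b (Q (vec w))) (Q (vec v))"
    by (intro tendsto_add X_Q_lim_sign[OF neg] Q_lim_sign_right[OF neg])
  then show ?thesis unfolding eq[symmetric] by (simp add: LIMSEQ_const_iff)
qed

text \<open>For fixed \<open>v\<close> and \<open>w\<close> the identity is a linear and weakly
  closed condition on \<open>a\<close>, so words suffice.\<close>

lemma compression:
  assumes \<epsilon>: "\<epsilon> \<in> {1, - 1}" and ne: "v \<noteq> []" "w \<noteq> []"
    and sep: "\<And>t r. t \<in> I \<Longrightarrow> r \<in> set v \<union> set w \<Longrightarrow> \<epsilon> * r < \<epsilon> * t"
    and a: "a \<in> wot closure_of nonunital_alg (x ` I)"
  shows "cinner (a (vec w)) (vec v) = cinner (a (Q (vec w))) (Q (vec v))"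
proof -
  have "cinner (a (vec w)) (vec v) = cinner (a (Q (vec w))) (Q (vec v))" if "a \<in> word_span x I" for a
    using that
  proof induction
    case (word b)
    then show ?case using word_compression[OF \<epsilon> ne(1) word(1) ne(2)] sep by blast
  qed (auto simp: blinfun.add_left cinner_add_left scaleC_op.rep_eq cinner_scaleC_left)
  then have "nonunital_alg (x ` I) \<subseteq> {T \<in> B_H. cinner (T (vec w)) (vec v) = cinner (T (Q (vec w))) (Q (vec v))}"
    using nonunital_alg_subset_word_span[of x I] nonunital_alg_subset_B_H[of "x ` I"] x_B_H by blast
  then have "wot closure_of nonunital_alg (x ` I)
      \<subseteq> {T \<in> B_H. cinner (T (vec w)) (vec v) = cinner (T (Q (vec w))) (Q (vec v))}"
    by (rule closure_of_minimal[OF _ closedin_wot_cinner_eq])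
  then show ?thesis using a by blast
qed

section \<open>The one-sided algebras in both directions, and the limits of their shifts\<close>

definition A_sign :: "int \<Rightarrow> int \<Rightarrow> 'h bop set" where
  "A_sign \<epsilon> k = wot closure_of nonunital_alg (x ` {t. \<epsilon> * k \<le> \<epsilon> * t})"

lemma A_sign_M: "A_sign \<epsilon> k \<subseteq> M"
  unfolding A_sign_def
  using nonunital_alg_subset_vN[OF vN, of "x ` _"] xM M_closed by (intro closure_of_minimal) auto

lemma conj_W_A_sign:
  assumes "\<epsilon> \<in> {1, - 1}" "a \<in> A_sign \<epsilon> k" "\<epsilon> * (m - k) \<le> int l"
  shows "conj_W (\<epsilon> * int l) a \<in> A_sign \<epsilon> m"
proof -
  have mono: "nonunital_alg S \<subseteq> nonunital_alg T" if ST: "S \<subseteq> T" for S T :: "'h bop set"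
  proof
    fix c assume "c \<in> nonunital_alg S"
    then show "c \<in> nonunital_alg T" by induction (use ST in \<open>auto intro: nonunital_alg.intros\<close>)
  qed
  have "(\<lambda>i. i + \<epsilon> * int l) ` {t. \<epsilon> * k \<le> \<epsilon> * t} \<subseteq> {t. \<epsilon> * m \<le> \<epsilon> * t}"
    using assms(1,3) by auto
  then show ?thesis
    using conj_W_closure[OF assms(2)[unfolded A_sign_def], of "\<epsilon> * int l"]
      closure_of_mono[OF mono[OF image_mono]] unfolding A_sign_def by blast
qed

text \<open>Shifted far enough, \<open>a\<close> lies beyond the letters of two given words, where
  \<open>compression\<close> is exact; as the shift fixes the range of \<open>Q\<close>, the
  compressed coefficient no longer depends on l. Density and the uniform norm bound extend the limit
  to all vectors.\<close>

lemma conj_W_limit: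
  assumes \<epsilon>: "\<epsilon> \<in> {1, - 1}" and a: "a \<in> A_sign \<epsilon> k"
  shows "limitin wot (\<lambda>l. conj_W (\<epsilon> * int l) a) (Q o\<^sub>L a o\<^sub>L Q) sequentially"
proof -
  let ?S = "Q o\<^sub>L a o\<^sub>L Q" and ?C = "max (norm a) (norm (Q o\<^sub>L a o\<^sub>L Q))"
  have aB: "a \<in> B_H" using a A_sign_M M_B_H by blast
  have vecs: "(\<lambda>l. cinner (conj_W (\<epsilon> * int l) a (vec w)) (vec v)) \<longlonglongrightarrow> cinner (?S (vec w)) (vec v)"
    if ne: "v \<noteq> []" "w \<noteq> []" for v w
  proof (rule tendsto_eventually)
    \<comment> \<open>One step beyond the letters of both words in the direction
      \<open>\<epsilon>\<close>; the outer \<open>\<epsilon>\<close> undoes the sign, since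
      \<epsilon>^2 = 1.\<close>
    define m where "m = \<epsilon> * (Max ((*) \<epsilon> ` (set v \<union> set w)) + 1)"
    have sep: "\<epsilon> * r < \<epsilon> * t" if "t \<in> {t. \<epsilon> * m \<le> \<epsilon> * t}" "r \<in> set v \<union> set w" for t r
    proof -
      have "\<epsilon> * r \<le> Max ((*) \<epsilon> ` (set v \<union> set w))" using that by (intro Max_ge) auto
      also have "\<dots> < \<epsilon> * m" using \<epsilon> by (auto simp: m_def)
      finally show ?thesis using that by simp
    qed
    have "cinner (conj_W (\<epsilon> * int l) a (vec w)) (vec v) = cinner (?S (vec w)) (vec v)"
      if "nat (\<epsilon> * (m - k)) \<le> l" for l
    proof -
      have "conj_W (\<epsilon> * int l) a \<in> A_sign \<epsilon> m" using that by (intro conj_W_A_sign[OF \<epsilon> a]) simp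
      from compression[OF \<epsilon> ne sep this[unfolded A_sign_def]]
      have "cinner (conj_W (\<epsilon> * int l) a (vec w)) (vec v) = cinner (conj_W (\<epsilon> * int l) a (Q (vec w))) (Q (vec v))"
        by blast
      then show ?thesis by (simp add: conj_W_def W_adjoint W_Q Q_selfadjoint)
    qed
    then show "eventually (\<lambda>l. cinner (conj_W (\<epsilon> * int l) a (vec w)) (vec v) = cinner (?S (vec w)) (vec v)) sequentially"
      unfolding eventually_sequentially by blast
  qed
  have TB: "conj_W l a \<in> B_H" "?S \<in> B_H" for l using aB Q_B_H by (auto simp: conj_W_B_H B_H_compose)
  have half: "(\<lambda>l. cinner (conj_W (\<epsilon> * int l) a u) (vec v)) \<longlonglongrightarrow> cinner (?S u) (vec v)" if "u \<in> D" "v \<noteq> []" for u v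
    using that(1)
  proof (induction rule: D_induct)
    case (vec w)
    then show ?case using vecs that(2) by blast
  next
    case (add u u')
    from tendsto_add[OF this] show ?case by (simp add: blinfun.add_right cinner_add_left)
  next
    case (scale c u)
    from tendsto_mult_left[OF this, of c] show ?case
      by (simp only: B_H_apply_scaleC[OF TB(1)] B_H_apply_scaleC[OF TB(2)] cinner_scaleC_left)
  qed simp
  have dense: "(\<lambda>l. cinner (conj_W (\<epsilon> * int l) a u) v) \<longlonglongrightarrow> cinner (?S u) v" if "u \<in> D" "v \<in> D" for u v
    using that(2)
  proof (induction rule: D_induct)
    case (vec w)
    then show ?case using half that(1) by blast
  next
    case (add v v')
    from tendsto_add[OF this] show ?case by (simp add: cinner_add_right)
  next
    case (scale c v)
    from tendsto_mult_left[OF this, of "cnj c"] show ?case by (simp add: cinner_scaleC_right)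
  qed simp
  have "(\<lambda>l. cinner (conj_W (\<epsilon> * int l) a u) v) \<longlonglongrightarrow> cinner (?S u) v" for u v
  proof (rule weak_limit_dense[OF D_dense, where C = ?C])
    show "norm (conj_W (\<epsilon> * int l) a w) \<le> ?C * norm w" for l w
    proof -
      have "norm (conj_W (\<epsilon> * int l) a w) \<le> norm a * norm w"
        using norm_blinfun[of a "W (- (\<epsilon> * int l)) w"] by (simp add: conj_W_def norm_W)
      also have "\<dots> \<le> ?C * norm w" by (intro mult_right_mono) auto
      finally show ?thesis .
    qed
    show "norm (?S w) \<le> ?C * norm w" for w
      by (rule order_trans[OF norm_blinfun]) (intro mult_right_mono, auto)
  qed (use dense in auto)
  then show ?thesis using TB by (subst limitin_wot) auto
qed

text \<open>The index \<open>m\<close> is unrelated to \<open>k\<close>: late shifts of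
  \<open>a\<close> lie in every one of these weakly closed algebras. Varying \<open>m\<close> puts
  the limit into the tail algebra.\<close>

lemma compression_A_sign:
  assumes \<epsilon>: "\<epsilon> \<in> {1, - 1}" and a: "a \<in> A_sign \<epsilon> k"
  shows "Q o\<^sub>L a o\<^sub>L Q \<in> A_sign \<epsilon> m"
proof (rule limitin_closedin[OF conj_W_limit[OF assms]])
  show "closedin wot (A_sign \<epsilon> m)" by (simp add: A_sign_def)
  have "conj_W (\<epsilon> * int l) a \<in> A_sign \<epsilon> m" if "nat (\<epsilon> * (m - k)) \<le> l" for l
    using that by (intro conj_W_A_sign[OF assms]) simp
  then show "eventually (\<lambda>l. conj_W (\<epsilon> * int l) a \<in> A_sign \<epsilon> m) sequentially"
    unfolding eventually_sequentially by blast
qed simp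

text \<open>A single word has a smallest index, so its compression is a limit inside
  \<open>M\<close>; linearity and weak continuity reach the rest of \<open>M\<close>.\<close>

lemma compression_M:
  assumes "a \<in> M" shows "Q o\<^sub>L a o\<^sub>L Q \<in> M"
proof -
  have "Q o\<^sub>L a o\<^sub>L Q \<in> M" if "a \<in> word_span x UNIV" for a
    using that
  proof induction
    case (word w)
    \<comment> \<open>The factors 1 are the sign in \<open>A_sign\<close>.\<close>
    have "{t. 1 * Min (set w) \<le> 1 * t} \<supseteq> set w" by auto
    then have "X w \<in> nonunital_alg (x ` {t. 1 * Min (set w) \<le> 1 * t})"
      using word(1) by (intro word_op_in_nonunital_alg)
    then have "X w \<in> A_sign 1 (Min (set w))"
      unfolding A_sign_def
      using closure_of_subset[of _ wot] nonunital_alg_subset_B_H[of "x ` _"] x_B_H by (metis image_subsetI subsetD topspace_wot)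
    then show ?case using compression_A_sign[of 1] A_sign_M by blast
  next
    case (add a b)
    have "Q o\<^sub>L (a + b) o\<^sub>L Q = (Q o\<^sub>L a o\<^sub>L Q) + (Q o\<^sub>L b o\<^sub>L Q)"
      by (rule blinfun_eqI) (simp add: blinfun.add_left blinfun.add_right)
    then show ?case using add vN by (simp add: von_neumann_algebra_def)
  next
    case (scale a c)
    have "Q o\<^sub>L scaleC_op c a o\<^sub>L Q = scaleC_op c (Q o\<^sub>L a o\<^sub>L Q)"
      by (rule blinfun_eqI) (simp add: scaleC_op.rep_eq B_H_apply_scaleC[OF Q_B_H])
    then show ?case using scale vN by (simp add: von_neumann_algebra_def)
  qed
  then have "Q o\<^sub>L a o\<^sub>L Q \<in> wot closure_of nonunital_alg (range x)" if "a \<in> nonunital_alg (range x)" for a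
    using that nonunital_alg_subset_word_span[of x UNIV] x_B_H M_eq_closure by blast
  from wot_closure_mapsto[OF continuous_map_wot_conj[OF Q_B_H Q_B_H] this]
  show ?thesis using assms M_eq_closure by blast
qed

lemma normal_map_compression: "normal_map M (\<lambda>a. Q o\<^sub>L a o\<^sub>L Q)"
  using compression_M by (intro normal_map_conj[OF vN Q_B_H]) (auto simp: is_adjoint_def Q_selfadjoint)

lemma A_plus_eq: "A_plus x k = A_sign 1 k"
  by (simp add: A_plus_def A_sign_def atLeast_def)

lemma A_minus_eq: "A_minus x k = A_sign (- 1) k"
  by (simp add: A_minus_def A_sign_def atMost_def)

text \<open>Weak limits are unique, so the definite description has exactly one candidate, and
  membership in the tail algebra is \<open>compression_A_sign\<close> for all indices.\<close>

lemma E_plus_eq: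
  assumes "a \<in> A_plus x k"
  shows "E_plus M \<phi> x a = Q o\<^sub>L a o\<^sub>L Q"
proof -
  have a: "a \<in> A_sign 1 k" "a \<in> M" using assms A_sign_M by (auto simp: A_plus_eq)
  have lim: "limitin wot (\<lambda>l. (shift_aut M \<phi> x ^^ l) a) (Q o\<^sub>L a o\<^sub>L Q) sequentially"
    using conj_W_limit[OF _ a(1)] a(2) by (simp add: shift_aut_funpow)
  have tail: "Q o\<^sub>L a o\<^sub>L Q \<in> A_plus_tail x"
    using compression_A_sign[OF _ a(1)] by (simp add: A_plus_tail_def A_plus_eq)
  show ?thesis
    unfolding E_plus_def
    by (rule the_equality, rule conjI[OF tail lim], erule conjE)
      (erule wot_limit_unique[OF _ lim trivial_limit_sequentially])
qed

lemma E_minus_eq: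
  assumes "a \<in> A_minus x k"
  shows "E_minus M \<phi> x a = Q o\<^sub>L a o\<^sub>L Q"
proof -
  have a: "a \<in> A_sign (- 1) k" "a \<in> M" using assms A_sign_M by (auto simp: A_minus_eq)
  have lim: "limitin wot (\<lambda>l. (inv_into M (shift_aut M \<phi> x) ^^ l) a) (Q o\<^sub>L a o\<^sub>L Q) sequentially"
    using conj_W_limit[OF _ a(1)] a(2) by (simp add: inv_shift_aut_funpow)
  have tail: "Q o\<^sub>L a o\<^sub>L Q \<in> A_minus_tail x"
    using compression_A_sign[OF _ a(1)] by (simp add: A_minus_tail_def A_minus_eq)
  show ?thesis
    unfolding E_minus_def
    by (rule the_equality, rule conjI[OF tail lim], erule conjE)
      (erule wot_limit_unique[OF _ lim trivial_limit_sequentially])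
qed

end

theorem proposition9p2:
  fixes M :: "'h::complex_hilbert_space bop set"
    and \<phi> :: "'h bop \<Rightarrow> complex"
    and \<xi> :: 'h
    and x :: "int \<Rightarrow> 'h bop"
  assumes "von_neumann_algebra M"
    and "normal_state M \<phi>"
    and "nondegenerated M \<phi>"
    and "gns_identified M \<phi> \<xi>"
    and "\<And>i. x i \<in> M"
    and "\<And>i. selfadjoint (x i)"
    and "M = vN_generated (range x)"
    and "id_blinfun \<in> wot closure_of nonunital_alg (range x)"
    and "boolean_spreadable \<phi> x"
  shows "\<exists>Ep Em. normal_map M Ep \<and> (\<forall>a \<in> (\<Union>k. A_plus x k). Ep a = E_plus M \<phi> x a) \<and>
                 normal_map M Em \<and> (\<forall>a \<in> (\<Union>k. A_minus x k). Em a = E_minus M \<phi> x a) \<and>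
                 (\<forall>a \<in> M. Em a = Ep a)"
proof -
  interpret spreadable_gns M \<phi> \<xi> x
    by unfold_locales (use assms in blast)+
  \<comment> \<open>One compression is the witness for both extensions, so their equality on
    \<open>M\<close> is immediate.\<close>
  show ?thesis
    using normal_map_compression E_plus_eq E_minus_eq
    by (intro exI[of _ "\<lambda>a. Q o\<^sub>L a o\<^sub>L Q"]) auto
qed

end
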